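(* Suppose that the following non-resonance condition holds: for each $\boldsymbol k\in\Lambda'$, $|\boldsymbol k|\ne|\alpha|$, and $h\sqrt{\alpha^2-|\boldsymbol k|^2}\notin\frac{\pi}{2}\mathbb{N}$ if $|\boldsymbol k|<|\alpha|$. Let $\eta\in C^\infty(\mathbb{R}^2/\Lambda)$ with $\min\eta>-h$, let $\delta>0$ be such that $D_\eta=\{-h<z<\eta(\boldsymbol x')\}$ contains the strip $\{\eta(\boldsymbol x')-\delta h\le z<\eta(\boldsymbol x')\}$, and let $$L=a I\partial_w^2+L_1\partial_w+L_0,$$ $$L_1=\begin{pmatrix}\boldsymbol b\cdot\nabla-c&-\frac\alpha\delta&-\frac\alpha\delta\eta_y\\\frac\alpha\delta&\boldsymbol b\cdot\nabla-c&\frac\alpha\delta\eta_x\\\frac\alpha\delta\eta_y&-\frac\alpha\delta\eta_x&\boldsymbol b\cdot\nabla-c\end{pmatrix},\quad L_0=\begin{pmatrix}\Delta&0&\alpha\partial_y\\0&\Delta&-\alpha\partial_x\\-\alpha\partial_y&\alpha\partial_x&\Delta\end{pmatrix},\quad a=\frac{1+|\nabla\eta|^2}{\delta^2},\ \boldsymbol b=-\frac{2\nabla\eta}{\delta},\ c=\frac{\Delta\eta}{\delta}.$$ There are properly supported operators $M,N\in\Psi^1(\mathbb{R}^2/\Lambda)$ such that (i) $L-a(\partial_wI-N)(\partial_wI-M)\in\Psi^{-\infty}(\mathbb{R}^2/\Lambda)$; (ii) the principal symbols $\mathtt M^{(1)},\mathtt N^{(1)}$ of $M,N$ take the form $\mathtt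 M^{(1)}=\mathtt m^{(1)}\mathbb{I}_3$, $\mathtt N^{(1)}=\mathtt n^{(1)}\mathbb{I}_3$, where the scalar-valued symbols $\mathtt m^{(1)},-\mathtt n^{(1)}\in S^1(\mathbb{R}^2/\Lambda)$ are strongly elliptic.
   Context: $\Lambda\subset\mathbb{R}^2$ is the lattice generated by two linearly independent vectors, $\Lambda'$ its dual lattice $\{\boldsymbol k:\boldsymbol k\cdot\boldsymbol\lambda\in2\pi\mathbb{Z}\ \forall\boldsymbol\lambda\in\Lambda\}$; functions on $\mathbb{R}^2/\Lambda$ are $\Lambda$-periodic in $\boldsymbol x'=(x,y)$. $h>0$ and $\alpha\in\mathbb{R}$ are constants; $\nabla=(\partial_x,\partial_y)^T$ and $\Delta=\partial_x^2+\partial_y^2$. The operator $L$ acts on $\mathbb{R}^3$-valued functions of $(\boldsymbol x',w)$, $w\in(-h,0)$; the equation $L\hat{\boldsymbol F}=\boldsymbol 0$ is the equation $-\Delta\boldsymbol F=\alpha\operatorname{curl}\boldsymbol F$ (three-dimensional) in the coordinates $z=\delta w+\eta(\boldsymbol x')$. $S^m(\mathbb{R}^2/\Lambda)$ is the class of (scalar- or matrix-valued) symbols $\mathtt a(\boldsymbol x',\boldsymbol k)$, smooth, $\Lambda$-periodic in $\boldsymbol x'$, with $|\partial_{\boldsymbol x'}^{\boldsymbol\beta}\partial_{\boldsymbol k}^{\boldsymbol\alpha}\mathtt a|\lesssim(1+|\boldsymbol k|)^{m-|\boldsymbol\alpha|}$ for all multi-indices (homogeneous symbols are understood up to a cut-off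 near $\boldsymbol k=\boldsymbol 0$); $\Psi^m(\mathbb{R}^2/\Lambda)$ denotes the corresponding (here $3\times3$-matrix-valued) pseudodifferential operators in $\boldsymbol x'$, and $\Psi^{-\infty}=\bigcap_m\Psi^m$. $M$ and $N$ are independent of $w$. A scalar symbol $\mathtt a\in S^1$ is strongly elliptic if $\operatorname{Re}\mathtt a(\boldsymbol x',\boldsymbol k)\gtrsim(1+|\boldsymbol k|^2)^{1/2}$ for all sufficiently large $|\boldsymbol k|$. *)

theory Defs
  imports "HOL-Analysis.Analysis"
begin

section \<open>Derivatives and smooth functions\<close>

definition dderiv :: "'a::real_normed_vector \<Rightarrow> ('a \<Rightarrow> 'b::real_normed_vector) \<Rightarrow> 'a \<Rightarrow> 'b" where
  "dderiv v f p = vector_derivative (\<lambda>t. f (p + t *\<^sub>R v)) (at 0)"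

fun Ck_on :: "nat \<Rightarrow> 'a::real_normed_vector set \<Rightarrow> ('a \<Rightarrow> 'b::real_normed_vector) \<Rightarrow> bool" where
  "Ck_on 0 S f \<longleftrightarrow> continuous_on S f"
| "Ck_on (Suc n) S f \<longleftrightarrow> (\<forall>p\<in>S. f differentiable (at p)) \<and> (\<forall>v. Ck_on n S (dderiv v f))"

text \<open>Meant for open sets \<open>S\<close> only.\<close>

definition smooth_on :: "'a::real_normed_vector set \<Rightarrow> ('a \<Rightarrow> 'b::real_normed_vector) \<Rightarrow> bool" where
  "smooth_on S f \<longleftrightarrow> (\<forall>n. Ck_on n S f)"

definition grad :: "(real^2 \<Rightarrow> real) \<Rightarrow> real^2 \<Rightarrow> real^2" where
  "grad f x = (\<chi> i. dderiv (axis i 1) f x)"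

definition laplacian :: "(real^2 \<Rightarrow> real) \<Rightarrow> real^2 \<Rightarrow> real" where
  "laplacian f x = (\<Sum>i\<in>UNIV. dderiv (axis i 1) (dderiv (axis i 1) f) x)"


section \<open>Lattices and periodic functions\<close>

definition lattice :: "real^2 \<Rightarrow> real^2 \<Rightarrow> (real^2) set" where
  "lattice v1 v2 = {of_int m *\<^sub>R v1 + of_int n *\<^sub>R v2 | m n :: int. True}"

definition dual_lattice :: "real^2 \<Rightarrow> real^2 \<Rightarrow> (real^2) set" where
  "dual_lattice v1 v2 = {k. \<forall>l\<in>lattice v1 v2. \<exists>n::int. k \<bullet> l = 2 * pi * of_int n}"

text \<open>Functions on the torus are represented by their periodic lifts to the plane.\<close>

definition smooth_periodic :: "real^2 \<Rightarrow> real^2 \<Rightarrow> (real^2 \<Rightarrow> 'b::real_normed_vector) set" where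
  "smooth_periodic v1 v2 =
     {u. smooth_on UNIV u \<and> (\<forall>x. \<forall>l\<in>lattice v1 v2. u (x + l) = u x)}"

text \<open>Smooth functions of \<open>(x', w)\<close> with \<open>x'\<close> in the torus and \<open>-h < w < 0\<close>; the values for other
  \<open>w\<close> are irrelevant.\<close>

definition smooth_periodic_strip ::
    "real^2 \<Rightarrow> real^2 \<Rightarrow> real \<Rightarrow> ((real^2) \<times> real \<Rightarrow> 'b::real_normed_vector) set" where
  "smooth_periodic_strip v1 v2 h =
     {F. smooth_on (UNIV \<times> {-h<..<0}) F \<and>
         (\<forall>x. \<forall>w\<in>{-h<..<0}. \<forall>l\<in>lattice v1 v2. F (x + l, w) = F (x, w))}"


section \<open>Symbols\<close>

text \<open>\<open>sym_deriv b1 b2 a1 a2\<close> differentiates \<open>b1\<close>, \<open>b2\<close> times in the two components of \<open>x'\<close> and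
  \<open>a1\<close>, \<open>a2\<close> times in the two components of \<open>k\<close>.\<close>

definition sym_deriv ::
    "nat \<Rightarrow> nat \<Rightarrow> nat \<Rightarrow> nat \<Rightarrow> ((real^2) \<times> (real^2) \<Rightarrow> 'b::real_normed_vector)
      \<Rightarrow> (real^2) \<times> (real^2) \<Rightarrow> 'b" where
  "sym_deriv b1 b2 a1 a2 s =
     (dderiv (axis 1 1, 0) ^^ b1) ((dderiv (axis 2 1, 0) ^^ b2)
       ((dderiv (0, axis 1 1) ^^ a1) ((dderiv (0, axis 2 1) ^^ a2) s)))"

definition symbol_class ::
    "real^2 \<Rightarrow> real^2 \<Rightarrow> real \<Rightarrow> ((real^2) \<times> (real^2) \<Rightarrow> 'b::real_normed_vector) set" where
  "symbol_class v1 v2 m =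
     {s. smooth_on UNIV s \<and>
         (\<forall>x k. \<forall>l\<in>lattice v1 v2. s (x + l, k) = s (x, k)) \<and>
         (\<forall>b1 b2 a1 a2. \<exists>C. \<forall>x k.
            norm (sym_deriv b1 b2 a1 a2 s (x, k)) \<le> C * (1 + norm k) powr (m - real (a1 + a2)))}"

definition homogeneous_symbol ::
    "real \<Rightarrow> ((real^2) \<times> (real^2) \<Rightarrow> 'b::real_normed_vector) \<Rightarrow> bool" where
  "homogeneous_symbol m s \<longleftrightarrow>
     (\<exists>R>0. \<forall>x k t. norm k \<ge> R \<longrightarrow> t \<ge> 1 \<longrightarrow> s (x, t *\<^sub>R k) = (t powr m) *\<^sub>R s (x, k))"

definition strongly_elliptic :: "real^2 \<Rightarrow> real^2 \<Rightarrow> ((real^2) \<times> (real^2) \<Rightarrow> complex) \<Rightarrow> bool" where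
  "strongly_elliptic v1 v2 s \<longleftrightarrow>
     s \<in> symbol_class v1 v2 1 \<and>
     (\<exists>C>0. \<exists>R. \<forall>x k. norm k \<ge> R \<longrightarrow> Re (s (x, k)) \<ge> C * sqrt (1 + (norm k)\<^sup>2))"


section \<open>Pseudodifferential operators on the torus\<close>

type_synonym torus_op = "(real^2 \<Rightarrow> complex^3) \<Rightarrow> (real^2 \<Rightarrow> complex^3)"

text \<open>The mean value of \<open>exp (- i k \<cdot> y) u(y)\<close> over the fundamental parallelogram, in the coordinates
  \<open>y = s v1 + t v2\<close>.\<close>

definition fourier_coeff ::
    "real^2 \<Rightarrow> real^2 \<Rightarrow> (real^2 \<Rightarrow> complex^3) \<Rightarrow> real^2 \<Rightarrow> complex^3" where
  "fourier_coeff v1 v2 u k =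
     integral (cbox (0, 0) (1, 1)) (\<lambda>(s::real, t::real).
       let y = s *\<^sub>R v1 + t *\<^sub>R v2 in exp (- \<i> * complex_of_real (k \<bullet> y)) *s u y)"

definition Op :: "real^2 \<Rightarrow> real^2 \<Rightarrow> ((real^2) \<times> (real^2) \<Rightarrow> complex^3^3) \<Rightarrow> torus_op" where
  "Op v1 v2 s u x =
     (\<Sum>\<^sub>\<infinity>k\<in>dual_lattice v1 v2.
        exp (\<i> * complex_of_real (k \<bullet> x)) *s (s (x, k) *v fourier_coeff v1 v2 u k))"

text \<open>Only the action on smooth periodic functions matters.\<close>

definition Psi :: "real^2 \<Rightarrow> real^2 \<Rightarrow> real \<Rightarrow> torus_op set" where
  "Psi v1 v2 m =
     {A. \<exists>s\<in>symbol_class v1 v2 m. \<forall>u\<in>smooth_periodic v1 v2. A u = Op v1 v2 s u}"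

definition Psi_minf :: "real^2 \<Rightarrow> real^2 \<Rightarrow> torus_op set" where
  "Psi_minf v1 v2 = (\<Inter>m. Psi v1 v2 m)"

text \<open>The homogeneous representative, up to a cut-off near \<open>k = 0\<close>; it is determined by the operator
  for large \<open>k\<close>.\<close>

definition principal_symbol ::
    "real^2 \<Rightarrow> real^2 \<Rightarrow> real \<Rightarrow> torus_op \<Rightarrow> ((real^2) \<times> (real^2) \<Rightarrow> complex^3^3) \<Rightarrow> bool" where
  "principal_symbol v1 v2 m A p \<longleftrightarrow>
     p \<in> symbol_class v1 v2 m \<and> homogeneous_symbol m p \<and>
     (\<lambda>u x. A u x - Op v1 v2 p u x) \<in> Psi v1 v2 (m - 1)"

text \<open>The periodic lifts of the compact subsets of the torus.\<close>

definition compact_mod :: "real^2 \<Rightarrow> real^2 \<Rightarrow> (real^2) set \<Rightarrow> bool" where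
  "compact_mod v1 v2 K \<longleftrightarrow> (\<exists>C. compact C \<and> K = {x + l | x l. x \<in> C \<and> l \<in> lattice v1 v2})"

text \<open>The usual definition for operators on a manifold. Since the torus is compact, every linear
  operator satisfies it (take \<open>K'\<close> to be everything).\<close>

definition properly_supported :: "real^2 \<Rightarrow> real^2 \<Rightarrow> torus_op \<Rightarrow> bool" where
  "properly_supported v1 v2 A \<longleftrightarrow>
     (\<forall>K. compact_mod v1 v2 K \<longrightarrow> (\<exists>K'. compact_mod v1 v2 K' \<and>
        (\<forall>u\<in>smooth_periodic v1 v2.
           ((\<forall>x. x \<notin> K \<longrightarrow> u x = 0) \<longrightarrow> (\<forall>x. x \<notin> K' \<longrightarrow> A u x = 0)) \<and>
           ((\<forall>x\<in>K'. u x = 0) \<longrightarrow> (\<forall>x\<in>K. A u x = 0)))))"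


section \<open>Operators on functions of \<open>(x', w)\<close>\<close>

type_synonym strip_op = "((real^2) \<times> real \<Rightarrow> complex^3) \<Rightarrow> ((real^2) \<times> real \<Rightarrow> complex^3)"

text \<open>An operator in \<open>x'\<close> alone, applied for each fixed \<open>w\<close>.\<close>

definition fibrewise :: "torus_op \<Rightarrow> strip_op" where
  "fibrewise A F = (\<lambda>(x, w). A (\<lambda>y. F (y, w)) x)"

definition in_Psi_minf :: "real^2 \<Rightarrow> real^2 \<Rightarrow> real \<Rightarrow> strip_op \<Rightarrow> bool" where
  "in_Psi_minf v1 v2 h T \<longleftrightarrow>
     (\<exists>R\<in>Psi_minf v1 v2. \<forall>F\<in>smooth_periodic_strip v1 v2 h.
        \<forall>p\<in>UNIV \<times> {-h<..<0}. T F p = fibrewise R F p)"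

definition dx :: "2 \<Rightarrow> ((real^2) \<times> real \<Rightarrow> 'b::real_normed_vector) \<Rightarrow> (real^2) \<times> real \<Rightarrow> 'b" where
  "dx i = dderiv (axis i 1, 0)"

definition dw :: "((real^2) \<times> real \<Rightarrow> 'b::real_normed_vector) \<Rightarrow> (real^2) \<times> real \<Rightarrow> 'b" where
  "dw = dderiv (0, 1)"

definition coeff_a :: "real \<Rightarrow> (real^2 \<Rightarrow> real) \<Rightarrow> real^2 \<Rightarrow> real" where
  "coeff_a \<delta> \<eta> x = (1 + (norm (grad \<eta> x))\<^sup>2) / \<delta>\<^sup>2"

definition coeff_b :: "real \<Rightarrow> (real^2 \<Rightarrow> real) \<Rightarrow> real^2 \<Rightarrow> real^2" where
  "coeff_b \<delta> \<eta> x = - (2 / \<delta>) *\<^sub>R grad \<eta> x"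

definition coeff_c :: "real \<Rightarrow> (real^2 \<Rightarrow> real) \<Rightarrow> real^2 \<Rightarrow> real" where
  "coeff_c \<delta> \<eta> x = laplacian \<eta> x / \<delta>"

definition op_L1 :: "real \<Rightarrow> real \<Rightarrow> (real^2 \<Rightarrow> real) \<Rightarrow> strip_op" where
  "op_L1 \<alpha> \<delta> \<eta> F = (\<lambda>(x, w).
     let f = (\<lambda>j. F (x, w) $ j);
         T = (\<lambda>j. (\<Sum>i\<in>UNIV. (coeff_b \<delta> \<eta> x $ i) *\<^sub>R dx i (\<lambda>q. F q $ j) (x, w))
                  - coeff_c \<delta> \<eta> x *\<^sub>R f j);
         g = \<alpha> / \<delta>; gx = \<alpha> / \<delta> * grad \<eta> x $ 1; gy = \<alpha> / \<delta> * grad \<eta> x $ 2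
     in vector [T 1 - g *\<^sub>R f 2 - gy *\<^sub>R f 3,
                g *\<^sub>R f 1 + T 2 + gx *\<^sub>R f 3,
                gy *\<^sub>R f 1 - gx *\<^sub>R f 2 + T 3])"

definition op_L0 :: "real \<Rightarrow> strip_op" where
  "op_L0 \<alpha> F p =
     (let f = (\<lambda>j q. F q $ j);
          Lap = (\<lambda>j. \<Sum>i\<in>UNIV. dx i (dx i (f j)) p)
      in vector [Lap 1 + \<alpha> *\<^sub>R dx 2 (f 3) p,
                 Lap 2 - \<alpha> *\<^sub>R dx 1 (f 3) p,
                 - (\<alpha> *\<^sub>R dx 2 (f 1) p) + \<alpha> *\<^sub>R dx 1 (f 2) p + Lap 3])"

definition op_L :: "real \<Rightarrow> real \<Rightarrow> (real^2 \<Rightarrow> real) \<Rightarrow> strip_op" where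
  "op_L \<alpha> \<delta> \<eta> F p =
     coeff_a \<delta> \<eta> (fst p) *\<^sub>R dw (dw F) p + op_L1 \<alpha> \<delta> \<eta> (dw F) p + op_L0 \<alpha> F p"

definition dw_minus :: "torus_op \<Rightarrow> strip_op" where
  "dw_minus A F p = dw F p - fibrewise A F p"

end

theory Submission
  imports Defs
begin

text \<open>
  Since \<open>M\<close> does not depend on \<open>w\<close>, the choice \<open>N = - M - a\<^sup>-\<^sup>1 L\<^sub>1\<close> makes the terms in
  \<open>\<partial>\<^sub>w\<close> agree exactly, and the factorisation becomes the operator Riccati equation
  \<open>a M\<^sup>2 + L\<^sub>1 M + L\<^sub>0 \<in> \<Psi>\<^sup>-\<^sup>\<infinity>\<close>. Its principal part is a scalar quadratic equation whose
  discriminant is elliptic of order 2. A correction \<open>d\<close> of the symbol of \<open>M\<close> changes the residual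
  by the square root of the discriminant times \<open>d\<close>, up to terms one order lower, so the residual
  can be removed order by order, and the corrections are summed asymptotically.

  On the torus the symbol of a composition is a convergent series: the sum of
  \<open>s(x, k + l) c(l, k) e\<^sup>i\<^sup>l\<^sup>x\<close> over \<open>l\<close> in the dual lattice, where \<open>c(l, k)\<close> are the Fourier
  coefficients of \<open>t(x, k)\<close> in \<open>x\<close>. It makes sense for all real \<open>k\<close>. The terms of this series, and
  of its difference from the product \<open>s t\<close>, obey the Leibniz rule in \<open>s\<close> and \<open>t\<close>, so the symbol
  estimates follow from estimates without derivatives.
\<close>

text \<open>The matrix structure is the obstacle: linearising the Riccati equation leads to a
  Sylvester equation \<open>a (M d + d M) + L1 d = r\<close>. Here the principal parts are scalar,
  so they commute with \<open>d\<close>, and solving becomes division by the symbol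
  \<open>2 a m + i (b . k)\<close>, the root of the discriminant. That root is elliptic by
  Cauchy-Schwarz: \<open>4 a |k|^2 - (b . k)^2\<close> is \<open>4 / \<delta>^2\<close> times
  \<open>(1 + |grad \<eta>|^2) |k|^2 - (grad \<eta> . k)^2\<close>, and the last expression is at
  least \<open>|k|^2\<close>. A bump near \<open>k = 0\<close> makes the discriminant positive
  everywhere, so the division is exact for all \<open>k\<close>. The cut-offs have no plateau. They
  are built from \<open>exp (- 1 / t)\<close> at \<open>t = 1 - \<epsilon>^2 |k|^2\<close>; their
  normalised complement is bounded by a multiple of \<open>\<epsilon> |k|\<close>, so it becomes
  small at the price of one order, and that order is recovered afterwards. In the product the outer
  \<open>w\<close>-derivative falls on \<open>M F\<close>, so the series of \<open>M\<close> has to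
  be differentiated in \<open>w\<close>. This rests on Fourier bounds uniform on compact
  subintervals of \<open>(-h, 0)\<close>.\<close>

type_synonym phase = "(real^2) \<times> (real^2)"


section \<open>Directional derivatives\<close>

lemma has_vector_derivative_line:
  assumes "(f has_derivative f') (at (p + t *\<^sub>R v))"
  shows "((\<lambda>t. f (p + t *\<^sub>R v)) has_vector_derivative f' v) (at t within A)"
proof -
  have "((\<lambda>t. p + t *\<^sub>R v) has_derivative (\<lambda>t. t *\<^sub>R v)) (at t within A)"
    by (auto intro!: derivative_eq_intros)
  from has_derivative_compose[OF this assms]
  have "((\<lambda>t. f (p + t *\<^sub>R v)) has_derivative (\<lambda>t. f' (t *\<^sub>R v))) (at t within A)" .
  moreover have "f' (s *\<^sub>R v) = s *\<^sub>R f' v" for s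
    using assms by (simp add: has_derivative_def linear_simps)
  ultimately show ?thesis
    by (simp add: has_vector_derivative_def)
qed

lemma dderiv_eq:
  assumes "(f has_derivative f') (at p)"
  shows "dderiv v f p = f' v"
  using has_vector_derivative_line[where t = 0 and A = UNIV] assms
  unfolding dderiv_def by (auto intro!: vector_derivative_at)

lemma has_derivative_dderiv:
  assumes "f differentiable (at p)"
  shows "(f has_derivative (\<lambda>v. dderiv v f p)) (at p)"
proof -
  obtain f' where f': "(f has_derivative f') (at p)"
    using assms by (auto simp: differentiable_def)
  moreover have "(\<lambda>v. dderiv v f p) = f'"
    by (rule ext) (rule dderiv_eq[OF f'])
  ultimately show ?thesis by simp
qed

lemma has_vector_derivative_dderiv:
  assumes "f differentiable (at (p + t *\<^sub>R v))"
  shows "((\<lambda>t. f (p + t *\<^sub>R v)) has_vector_derivative dderiv v f (p + t *\<^sub>R v)) (at t within A)"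
  by (rule has_vector_derivative_line[OF has_derivative_dderiv[OF assms]])

lemma dderiv_Basis:
  fixes f :: "'a::euclidean_space \<Rightarrow> 'b::real_normed_vector"
  assumes "f differentiable (at p)"
  shows "dderiv v f p = (\<Sum>b\<in>Basis. (v \<bullet> b) *\<^sub>R dderiv b f p)"
proof -
  have lin: "linear (\<lambda>v. dderiv v f p)"
    using has_derivative_dderiv[OF assms] has_derivative_linear by blast
  have "dderiv v f p = dderiv (\<Sum>b\<in>Basis. (v \<bullet> b) *\<^sub>R b) f p"
    by (simp add: euclidean_representation)
  also have "\<dots> = (\<Sum>b\<in>Basis. (v \<bullet> b) *\<^sub>R dderiv b f p)"
    using linear_sum[OF lin, of "\<lambda>b. (v \<bullet> b) *\<^sub>R b" Basis] linear_scale[OF lin]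
    by simp
  finally show ?thesis .
qed

lemma dderiv_cong_open:
  assumes "open S" "p \<in> S" "\<And>q. q \<in> S \<Longrightarrow> f q = g q"
  shows "dderiv v f p = dderiv v g p"
proof -
  have "((\<lambda>t. p + t *\<^sub>R v) \<longlongrightarrow> p + 0 *\<^sub>R v) (nhds 0)"
    by (intro tendsto_intros filterlim_ident)
  then have "\<forall>\<^sub>F t in nhds 0. p + t *\<^sub>R v \<in> S"
    using topological_tendstoD[OF _ assms(1)] assms(2) by fastforce
  then have ev: "\<forall>\<^sub>F t in nhds 0. f (p + t *\<^sub>R v) = g (p + t *\<^sub>R v)"
    by eventually_elim (rule assms(3))
  then have "((\<lambda>t. f (p + t *\<^sub>R v)) has_vector_derivative D) (at 0) \<longleftrightarrow>
      ((\<lambda>t. g (p + t *\<^sub>R v)) has_vector_derivative D) (at 0)" for D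
    by (intro has_vector_derivative_cong_ev) (auto elim: eventually_mono dest: eventually_nhds_x_imp_x)
  then show ?thesis
    unfolding dderiv_def vector_derivative_def by simp
qed

lemma dderiv_const [simp]: "dderiv v (\<lambda>q. c) p = 0"
  by (rule dderiv_eq[where f' = "\<lambda>_. 0", simplified]) simp

lemma dderiv_add:
  assumes "f differentiable (at p)" "g differentiable (at p)"
  shows "dderiv v (\<lambda>q. f q + g q) p = dderiv v f p + dderiv v g p"
  by (rule dderiv_eq[OF has_derivative_add[OF assms[THEN has_derivative_dderiv]]])

lemma dderiv_mult:
  fixes f g :: "'a::real_normed_vector \<Rightarrow> 'b::real_normed_algebra"
  assumes "f differentiable (at p)" "g differentiable (at p)"
  shows "dderiv v (\<lambda>q. f q * g q) p = f p * dderiv v g p + dderiv v f p * g p"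
  by (rule dderiv_eq[OF has_derivative_mult[OF assms[THEN has_derivative_dderiv]]])

lemma differentiable_bounded_linear:
  assumes "bounded_linear L" "f differentiable (at p)"
  shows "(\<lambda>q. L (f q)) differentiable (at p)"
  using bounded_linear.has_derivative[OF assms(1)] assms(2) unfolding differentiable_def by blast

lemma dderiv_bounded_linear:
  assumes "bounded_linear L" "f differentiable (at p)"
  shows "dderiv v (\<lambda>q. L (f q)) p = L (dderiv v f p)"
  by (rule dderiv_eq[OF bounded_linear.has_derivative[OF assms(1) has_derivative_dderiv[OF assms(2)]]])

lemma dderiv_scaleR:
  assumes "f differentiable (at p)"
  shows "dderiv v (\<lambda>q. c *\<^sub>R f q) p = c *\<^sub>R dderiv v f p"
  by (rule dderiv_bounded_linear[OF bounded_linear_scaleR_right assms])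

lemma differentiable_scaleR_const:
  "f differentiable (at p) \<Longrightarrow> (\<lambda>q. c *\<^sub>R f q) differentiable (at p)"
  by (rule differentiable_bounded_linear[OF bounded_linear_scaleR_right])


section \<open>Smooth functions\<close>

lemma Ck_on_cong:
  assumes "open S" "\<And>q. q \<in> S \<Longrightarrow> f q = g q"
  shows "Ck_on n S f = Ck_on n S g"
  using assms(2)
proof (induction n arbitrary: f g)
  case 0
  then show ?case by (auto cong: continuous_on_cong)
next
  case (Suc n)
  have "f differentiable (at p) \<longleftrightarrow> g differentiable (at p)" if "p \<in> S" for p
    unfolding differentiable_def using Suc.prems that
    by (metis assms(1) has_derivative_transform_within_open)
  moreover have "Ck_on n S (dderiv v f) = Ck_on n S (dderiv v g)" for v
    by (rule Suc.IH) (rule dderiv_cong_open[OF assms(1) _ Suc.prems])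
  ultimately show ?case by simp
qed

lemma smooth_on_differentiable: "smooth_on S f \<Longrightarrow> p \<in> S \<Longrightarrow> f differentiable (at p)"
  unfolding smooth_on_def by (metis Ck_on.simps(2))

lemma smooth_on_dderiv: "smooth_on S f \<Longrightarrow> smooth_on S (dderiv v f)"
  unfolding smooth_on_def by (metis Ck_on.simps(2))

lemma smooth_on_continuous: "smooth_on S f \<Longrightarrow> continuous_on S f"
  unfolding smooth_on_def by (metis Ck_on.simps(1))

text \<open>Replaces formulas for higher derivatives by a closure argument: induction on
  \<open>n\<close> puts the whole class \<open>T\<close> into \<open>Ck_on n S\<close>
  simultaneously. Derivatives have to agree with a member of \<open>T\<close> on \<open>S\<close>
  only, which is enough by \<open>Ck_on_cong\<close>.\<close>

lemma smooth_on_coinduct: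
  assumes S: "open S" and "f \<in> T"
    and diff: "\<And>f p. f \<in> T \<Longrightarrow> p \<in> S \<Longrightarrow> f differentiable (at p)"
    and step: "\<And>f v. f \<in> T \<Longrightarrow> \<exists>g\<in>T. \<forall>p\<in>S. dderiv v f p = g p"
  shows "smooth_on S f"
proof -
  have "Ck_on n S f" if "f \<in> T" for n f
    using that
  proof (induction n arbitrary: f)
    case 0
    then show ?case
      using diff[OF 0] by (auto intro!: continuous_at_imp_continuous_on differentiable_imp_continuous_within)
  next
    case (Suc n)
    have "Ck_on n S (dderiv v f)" for v
    proof -
      obtain g where "g \<in> T" "\<forall>p\<in>S. dderiv v f p = g p" using step[OF Suc.prems] by blast
      then show ?thesis using Ck_on_cong[OF S, of "dderiv v f" g] Suc.IH by simp
    qed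
    then show ?case using diff[OF Suc.prems] by simp
  qed
  then show ?thesis using \<open>f \<in> T\<close> by (simp add: smooth_on_def)
qed

lemma smooth_on_add:
  assumes "open S" "smooth_on S f" "smooth_on S g"
  shows "smooth_on S (\<lambda>q. f q + g q)"
proof (rule smooth_on_coinduct[OF assms(1), where T = "{\<lambda>q. f q + g q | f g. smooth_on S f \<and> smooth_on S g}"])
  fix F v assume "F \<in> {\<lambda>q. f q + g q | f g. smooth_on S f \<and> smooth_on S g}"
  then obtain f g where fg: "F = (\<lambda>q. f q + g q)" "smooth_on S f" "smooth_on S g" by blast
  then show "\<exists>h\<in>{\<lambda>q. f q + g q | f g. smooth_on S f \<and> smooth_on S g}. \<forall>p\<in>S. dderiv v F p = h p"
    by (intro bexI[of _ "\<lambda>q. dderiv v f q + dderiv v g q"])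
      (auto simp: dderiv_add smooth_on_differentiable intro: smooth_on_dderiv)
qed (use assms in \<open>auto simp: smooth_on_differentiable intro!: differentiable_add\<close>)

lemma smooth_on_bounded_linear:
  assumes "open S" "bounded_linear L" "smooth_on S f"
  shows "smooth_on S (\<lambda>q. L (f q))"
proof (rule smooth_on_coinduct[OF assms(1), where T = "{\<lambda>q. L (f q) | f. smooth_on S f}"])
  fix F v assume "F \<in> {\<lambda>q. L (f q) | f. smooth_on S f}"
  then obtain f where f: "F = (\<lambda>q. L (f q))" "smooth_on S f" by blast
  then show "\<exists>h\<in>{\<lambda>q. L (f q) | f. smooth_on S f}. \<forall>p\<in>S. dderiv v F p = h p"
    by (intro bexI[of _ "\<lambda>q. L (dderiv v f q)"])
      (auto simp: dderiv_bounded_linear[OF assms(2)] smooth_on_differentiable intro: smooth_on_dderiv)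
qed (use assms in \<open>auto simp: smooth_on_differentiable differentiable_bounded_linear\<close>)

lemma smooth_on_zero: "smooth_on UNIV (\<lambda>q. 0)"
  by (rule smooth_on_coinduct[where T = "{\<lambda>q. 0}"]) auto

lemma smooth_on_sum:
  "(\<And>i. i \<in> A \<Longrightarrow> smooth_on UNIV (f i)) \<Longrightarrow> smooth_on UNIV (\<lambda>q. \<Sum>i\<in>A. f i q)"
  by (induction A rule: infinite_finite_induct) (auto intro!: smooth_on_zero smooth_on_add)

lemma Ck_on_sum_scaleR:
  fixes f :: "'i \<Rightarrow> 'a::real_normed_vector \<Rightarrow> 'b::real_normed_vector"
  assumes "\<And>i. i \<in> A \<Longrightarrow> Ck_on n UNIV (f i)"
  shows "Ck_on n UNIV (\<lambda>q. \<Sum>i\<in>A. c i *\<^sub>R f i q)"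
  using assms
proof (induction n arbitrary: f)
  case 0
  then show ?case by (auto intro!: continuous_intros)
next
  case (Suc n)
  then have diff: "i \<in> A \<Longrightarrow> f i differentiable (at p)" for i p by simp
  have "((\<lambda>q. \<Sum>i\<in>A. c i *\<^sub>R f i q) has_derivative (\<lambda>v. \<Sum>i\<in>A. c i *\<^sub>R dderiv v (f i) p)) (at p)" for p
    by (intro has_derivative_sum has_derivative_scaleR_right has_derivative_dderiv diff)
  note der = this
  then have "dderiv v (\<lambda>q. \<Sum>i\<in>A. c i *\<^sub>R f i q) = (\<lambda>p. \<Sum>i\<in>A. c i *\<^sub>R dderiv v (f i) p)" for v
    by (intro ext dderiv_eq)
  moreover have "Ck_on n UNIV (\<lambda>p. \<Sum>i\<in>A. c i *\<^sub>R dderiv v (f i) p)" for v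
    by (rule Suc.IH) (use Suc.prems in simp)
  ultimately show ?case using der by (auto simp: differentiable_def)
qed

text \<open>Only coordinate derivatives have to stay in \<open>T\<close>. A general directional
  derivative is a linear combination of them and may leave \<open>T\<close>, so the induction relies
  on \<open>Ck_on n\<close> being closed under such combinations.\<close>

lemma smooth_on_UNIV_Basis_coinduct:
  fixes f :: "'a::euclidean_space \<Rightarrow> 'b::real_normed_vector"
  assumes "f \<in> T"
    and diff: "\<And>f p. f \<in> T \<Longrightarrow> f differentiable (at p)"
    and step: "\<And>f b. f \<in> T \<Longrightarrow> b \<in> Basis \<Longrightarrow> dderiv b f \<in> T"
  shows "smooth_on UNIV f"
proof -
  have "Ck_on n UNIV f" if "f \<in> T" for n f
    using that
  proof (induction n arbitrary: f)
    case 0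
    then show ?case
      using diff[OF 0] by (auto intro!: continuous_at_imp_continuous_on differentiable_imp_continuous_within)
  next
    case (Suc n)
    have eq: "dderiv v f = (\<lambda>p. \<Sum>b\<in>Basis. (v \<bullet> b) *\<^sub>R dderiv b f p)" for v
      by (rule ext) (rule dderiv_Basis[OF diff[OF Suc.prems]])
    have "Ck_on n UNIV (dderiv v f)" for v
      by (subst eq, rule Ck_on_sum_scaleR) (rule Suc.IH[OF step[OF Suc.prems]])
    then show ?case using diff[OF Suc.prems] by simp
  qed
  then show ?thesis using \<open>f \<in> T\<close> by (simp add: smooth_on_def)
qed

text \<open>Schwarz's theorem by integration: the fundamental theorem along \<open>v\<close>,
  differentiation under the integral along \<open>u\<close>, then differentiation of the integral at
  its end point. It makes the fixed order of derivatives in \<open>sym_deriv\<close>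
  harmless.\<close>

lemma dderiv_commute:
  fixes f :: "'a::real_normed_vector \<Rightarrow> 'b::banach"
  assumes f: "smooth_on UNIV f"
  shows "dderiv u (dderiv v f) = dderiv v (dderiv u f)"
proof
  fix p
  note sm = f smooth_on_dderiv[OF f] smooth_on_dderiv[OF smooth_on_dderiv[OF f]]
  note diff = sm[THEN smooth_on_differentiable, OF UNIV_I]
  note cont = sm[THEN smooth_on_continuous]
  have cont_line: "continuous_on A (\<lambda>t. g (p + t *\<^sub>R v))" if "continuous_on UNIV g" for A and g :: "'a \<Rightarrow> 'b"
    by (rule continuous_on_compose2[OF that]) (auto intro!: continuous_intros)
  have ftc: "integral (cbox 0 t) (\<lambda>\<tau>. dderiv v f (p + s *\<^sub>R u + \<tau> *\<^sub>R v)) =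
      f (p + s *\<^sub>R u + t *\<^sub>R v) - f (p + s *\<^sub>R u)" if "0 \<le> t" for s t :: real
  proof -
    have "((\<lambda>\<tau>. dderiv v f (p + s *\<^sub>R u + \<tau> *\<^sub>R v)) has_integral
        f (p + s *\<^sub>R u + t *\<^sub>R v) - f (p + s *\<^sub>R u + 0 *\<^sub>R v)) {0..t}"
      by (rule fundamental_theorem_of_calculus[OF that]) (rule has_vector_derivative_dderiv[OF diff(1)])
    then show ?thesis by (simp add: integral_unique)
  qed
  have swap: "p + \<tau> *\<^sub>R v + s *\<^sub>R u = p + s *\<^sub>R u + \<tau> *\<^sub>R v" for s \<tau> by simp
  \<comment> \<open>The identity \<open>ftc\<close> is differentiated in \<open>s\<close> at 0,
    under the integral on the left and directly on the right.\<close>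
  have eq: "integral (cbox 0 t) (\<lambda>\<tau>. dderiv u (dderiv v f) (p + \<tau> *\<^sub>R v)) =
      dderiv u f (p + t *\<^sub>R v) - dderiv u f p" if "0 \<le> t" for t :: real
  proof -
    have "((\<lambda>s. integral (cbox 0 t) (\<lambda>\<tau>. dderiv v f (p + s *\<^sub>R u + \<tau> *\<^sub>R v))) has_vector_derivative
       integral (cbox 0 t) (\<lambda>\<tau>. dderiv u (dderiv v f) (p + 0 *\<^sub>R u + \<tau> *\<^sub>R v))) (at 0 within UNIV)"
    proof (rule leibniz_rule_vector_derivative)
      fix s \<tau> :: real
      show "((\<lambda>s. dderiv v f (p + s *\<^sub>R u + \<tau> *\<^sub>R v)) has_vector_derivative
          dderiv u (dderiv v f) (p + s *\<^sub>R u + \<tau> *\<^sub>R v)) (at s)"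
        using has_vector_derivative_dderiv[of "dderiv v f" "p + \<tau> *\<^sub>R v" s u UNIV] diff(2)
        unfolding swap by simp
    next
      show "(\<lambda>\<tau>. dderiv v f (p + s *\<^sub>R u + \<tau> *\<^sub>R v)) integrable_on cbox 0 t" for s
        by (intro integrable_continuous continuous_on_compose2[OF cont(2)]) (auto intro!: continuous_intros)
      show "continuous_on (UNIV \<times> cbox 0 t) (\<lambda>(s, \<tau>). dderiv u (dderiv v f) (p + s *\<^sub>R u + \<tau> *\<^sub>R v))"
        unfolding case_prod_unfold
        by (intro continuous_on_compose2[OF cont(3)]) (auto intro!: continuous_intros)
    qed auto
    moreover have "((\<lambda>s. f (p + t *\<^sub>R v + s *\<^sub>R u) - f (p + s *\<^sub>R u)) has_vector_derivative
        dderiv u f (p + t *\<^sub>R v + 0 *\<^sub>R u) - dderiv u f (p + 0 *\<^sub>R u)) (at 0)"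
      by (intro has_vector_derivative_diff has_vector_derivative_dderiv diff(1))
    ultimately show ?thesis
      unfolding ftc[OF that] swap using vector_derivative_unique_at by fastforce
  qed
  \<comment> \<open>As \<open>eq\<close> is known for nonnegative \<open>t\<close>, the two sides
    are compared through one-sided derivatives at the left end of the unit interval.\<close>
  have "((\<lambda>t. integral {0..t} (\<lambda>\<tau>. dderiv u (dderiv v f) (p + \<tau> *\<^sub>R v))) has_vector_derivative
      dderiv u (dderiv v f) (p + 0 *\<^sub>R v)) (at 0 within {0..1})"
    by (rule integral_has_vector_derivative) (auto intro: cont_line cont)
  then have "((\<lambda>t. dderiv u f (p + t *\<^sub>R v) - dderiv u f p) has_vector_derivative
      dderiv u (dderiv v f) p) (at 0 within {0..1})"
    using eq by (intro has_vector_derivative_transform[where g = "\<lambda>t. dderiv u f (p + t *\<^sub>R v) - dderiv u f p",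
      of 0 "{0..1}" "\<lambda>t. integral {0..t} (\<lambda>\<tau>. dderiv u (dderiv v f) (p + \<tau> *\<^sub>R v))"]) auto
  moreover have "((\<lambda>t. dderiv u f (p + t *\<^sub>R v) - dderiv u f p) has_vector_derivative
      dderiv v (dderiv u f) (p + 0 *\<^sub>R v) - 0) (at 0 within {0..1})"
    by (intro has_vector_derivative_diff has_vector_derivative_dderiv diff) simp
  moreover have "at (0::real) within {0..1} \<noteq> bot"
    by (simp add: at_within_Icc_at_right)
  ultimately show "dderiv u (dderiv v f) p = dderiv v (dderiv u f) p"
    using vector_derivative_unique_within by fastforce
qed


section \<open>Families of symbols with uniform estimates\<close>

text \<open>Meant for basis vectors of phase space: a vanishing first component marks a derivative
  in \<open>k\<close>, which lowers the order by one; derivatives in \<open>x'\<close> leave it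
  alone.\<close>

definition order_drop :: "phase \<Rightarrow> real" where
  "order_drop b = (if fst b = 0 then 1 else 0)"

text \<open>The estimates are uniform in the index up to the weight \<open>W\<close>: with a summable weight the
  families can be summed, and with \<open>W \<epsilon> = \<epsilon>\<close> they become small.\<close>

definition symbol_family ::
    "real^2 \<Rightarrow> real^2 \<Rightarrow> 'i set \<Rightarrow> ('i \<Rightarrow> real) \<Rightarrow> real \<Rightarrow>
      ('i \<Rightarrow> phase \<Rightarrow> 'b::real_normed_vector) \<Rightarrow> bool" where
  "symbol_family v1 v2 I W m g \<longleftrightarrow>
     (\<forall>i\<in>I. smooth_on UNIV (g i)) \<and>
     (\<forall>i\<in>I. \<forall>x k. \<forall>l\<in>lattice v1 v2. g i (x + l, k) = g i (x, k)) \<and>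
     (\<forall>b1 b2 a1 a2. \<exists>C. \<forall>i\<in>I. \<forall>x k.
        norm (sym_deriv b1 b2 a1 a2 (g i) (x, k)) \<le> C * W i * (1 + norm k) powr (m - real (a1 + a2)))"

text \<open>The Leibniz rule turns a derivative into a sum of members of a class, so closure is
  asked only up to linear combinations of fixed order. The rule \<open>cong\<close> ignores indices
  outside \<open>I\<close>, where nothing is known about the functions.\<close>

inductive family_span ::
    "'i set \<Rightarrow> (real \<Rightarrow> ('i \<Rightarrow> phase \<Rightarrow> 'b::real_normed_vector) \<Rightarrow> bool) \<Rightarrow>
      real \<Rightarrow> ('i \<Rightarrow> phase \<Rightarrow> 'b) \<Rightarrow> bool"
  for I T where
  base: "T m g \<Longrightarrow> family_span I T m g"
| zero: "family_span I T m (\<lambda>i q. 0)"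
| add: "family_span I T m g \<Longrightarrow> family_span I T m g' \<Longrightarrow> family_span I T m (\<lambda>i q. g i q + g' i q)"
| scale: "family_span I T m g \<Longrightarrow> family_span I T m (\<lambda>i q. c *\<^sub>R g i q)"
| cong: "family_span I T m g \<Longrightarrow> (\<And>i q. i \<in> I \<Longrightarrow> g' i q = g i q) \<Longrightarrow> family_span I T m g'"

lemma symbol_class_iff_family:
  "s \<in> symbol_class v1 v2 m \<longleftrightarrow> symbol_family v1 v2 {()} (\<lambda>_. 1) m (\<lambda>_. s)"
  by (simp add: symbol_class_def symbol_family_def)

lemma Basis_phase_space:
  "(Basis :: phase set) =
     {(axis 1 1, 0), (axis 2 1, 0), (0, axis 1 1), (0, axis 2 1)}"
  by (simp add: Basis_prod_def Basis_vec_def UNIV_2 insert_commute)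

lemma order_drop_Basis [simp]:
  "order_drop (axis i 1, 0) = 0" "order_drop (0, axis i 1) = 1"
  by (simp_all add: order_drop_def axis_eq_0_iff)

text \<open>Coinduction: a graded class of families that is closed, up to sums, under the coordinate
  derivatives needs only be estimated in order zero.\<close>

locale symbol_family_coinduct =
  fixes v1 v2 :: "real^2" and I :: "'i set" and W :: "'i \<Rightarrow> real"
    and T :: "real \<Rightarrow> ('i \<Rightarrow> phase \<Rightarrow> 'b::real_normed_vector) \<Rightarrow> bool"
  assumes diff: "T m g \<Longrightarrow> i \<in> I \<Longrightarrow> g i differentiable (at p)"
    and periodic: "T m g \<Longrightarrow> i \<in> I \<Longrightarrow> l \<in> lattice v1 v2 \<Longrightarrow> g i (x + l, k) = g i (x, k)"
    and bound: "T m g \<Longrightarrow> \<exists>C. \<forall>i\<in>I. \<forall>x k. norm (g i (x, k)) \<le> C * W i * (1 + norm k) powr m"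
    and step: "T m g \<Longrightarrow> b \<in> Basis \<Longrightarrow> family_span I T (m - order_drop b) (\<lambda>i. dderiv b (g i))"
begin

lemma span_diff: "family_span I T m g \<Longrightarrow> i \<in> I \<Longrightarrow> g i differentiable (at p)"
proof (induction arbitrary: p rule: family_span.induct)
  case (cong m g g')
  moreover from this have "g' i = g i" by auto
  ultimately show ?case by simp
qed (auto intro: diff differentiable_add differentiable_scaleR_const)

lemma span_periodic:
  "family_span I T m g \<Longrightarrow> i \<in> I \<Longrightarrow> l \<in> lattice v1 v2 \<Longrightarrow> g i (x + l, k) = g i (x, k)"
  by (induction rule: family_span.induct) (auto simp: periodic)

lemma span_bound:
  "family_span I T m g \<Longrightarrow> \<exists>C. \<forall>i\<in>I. \<forall>x k. norm (g i (x, k)) \<le> C * W i * (1 + norm k) powr m"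
proof (induction rule: family_span.induct)
  case (base m g)
  then show ?case by (rule bound)
next
  case (zero m)
  show ?case by (rule exI[of _ 0]) simp
next
  case (add m g g')
  then obtain C C' where
    "\<forall>i\<in>I. \<forall>x k. norm (g i (x, k)) \<le> C * W i * (1 + norm k) powr m"
    "\<forall>i\<in>I. \<forall>x k. norm (g' i (x, k)) \<le> C' * W i * (1 + norm k) powr m" by blast
  then show ?case
    by (intro exI[of _ "C + C'"]) (auto simp: algebra_simps intro!: norm_triangle_le add_mono)
next
  case (scale m g c)
  then obtain C where
    "\<forall>i\<in>I. \<forall>x k. norm (g i (x, k)) \<le> C * W i * (1 + norm k) powr m" by blast
  then have "\<forall>i\<in>I. \<forall>x k. \<bar>c\<bar> * norm (g i (x, k)) \<le> \<bar>c\<bar> * (C * W i * (1 + norm k) powr m)"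
    by (simp add: mult_left_mono)
  then show ?case
    by (intro exI[of _ "\<bar>c\<bar> * C"]) (auto simp: mult.assoc)
next
  case (cong m g g')
  then show ?case by auto
qed

lemma span_dderiv:
  "family_span I T m g \<Longrightarrow> b \<in> Basis \<Longrightarrow> family_span I T (m - order_drop b) (\<lambda>i. dderiv b (g i))"
proof (induction rule: family_span.induct)
  case (base m g)
  then show ?case by (rule step)
next
  case (zero m)
  show ?case by (rule family_span.cong[OF family_span.zero]) simp
next
  case (add m g g')
  then show ?case
    by (intro family_span.cong[OF family_span.add[OF add.IH]])
      (auto simp: dderiv_add span_diff)
next
  case (scale m g c)
  then show ?case
    by (intro family_span.cong[OF family_span.scale[OF scale.IH]])
      (auto simp: dderiv_scaleR span_diff)
next
  case (cong m g g')
  then have "g' i = g i" if "i \<in> I" for i using that by auto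
  then show ?case by (intro family_span.cong[OF cong.IH[OF cong.prems]]) auto
qed

lemma span_funpow:
  assumes "family_span I T m g" "b \<in> Basis"
  shows "family_span I T (m - order_drop b * real n) (\<lambda>i. (dderiv b ^^ n) (g i))"
proof (induction n)
  case 0
  then show ?case using assms by simp
next
  case (Suc n)
  from span_dderiv[OF Suc assms(2)] show ?case by (simp add: algebra_simps)
qed

lemma span_sym_deriv:
  assumes "family_span I T m g"
  shows "family_span I T (m - real (a1 + a2)) (\<lambda>i. sym_deriv b1 b2 a1 a2 (g i))"
proof -
  note 1 = span_funpow[OF assms, of "(0, axis 2 1)" a2]
  note 2 = span_funpow[OF 1, of "(0, axis 1 1)" a1]
  note 3 = span_funpow[OF 2, of "(axis 2 1, 0)" b2]
  note 4 = span_funpow[OF 3, of "(axis 1 1, 0)" b1]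
  show ?thesis
    using 4 by (simp add: Basis_phase_space sym_deriv_def algebra_simps)
qed

lemma span_smooth:
  assumes "family_span I T m g" "i \<in> I"
  shows "smooth_on UNIV (g i)"
proof (rule smooth_on_UNIV_Basis_coinduct[where T = "{f. \<exists>m g. f = g i \<and> family_span I T m g}"])
  fix f and b :: "phase"
  assume "f \<in> {f. \<exists>m g. f = g i \<and> family_span I T m g}" "b \<in> Basis"
  then obtain m g where "f = g i" "family_span I T (m - order_drop b) (\<lambda>i. dderiv b (g i))"
    using span_dderiv by blast
  then show "dderiv b f \<in> {f. \<exists>m g. f = g i \<and> family_span I T m g}"
    by (intro CollectI exI[of _ "m - order_drop b"] exI[of _ "\<lambda>i. dderiv b (g i)"]) simp
qed (use assms in \<open>auto simp: span_diff\<close>)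

text \<open>By \<open>span_sym_deriv\<close> every derivative of a member is again in the span, at
  exactly the order that the symbol estimate demands, so \<open>span_bound\<close> applied to it is
  that estimate.\<close>

theorem span_symbol_family:
  assumes "family_span I T m g"
  shows "symbol_family v1 v2 I W m g"
  unfolding symbol_family_def
  using span_smooth[OF assms] span_periodic[OF assms] span_bound[OF span_sym_deriv[OF assms]]
  by blast

lemmas symbol_family = span_symbol_family[OF family_span.base]

end

lemma symbol_family_smooth: "symbol_family v1 v2 I W m g \<Longrightarrow> i \<in> I \<Longrightarrow> smooth_on UNIV (g i)"
  and symbol_family_periodic: "symbol_family v1 v2 I W m g \<Longrightarrow> i \<in> I \<Longrightarrow> l \<in> lattice v1 v2 \<Longrightarrow>
    g i (x + l, k) = g i (x, k)"
  by (auto simp: symbol_family_def)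

lemma symbol_family_diff:
  "symbol_family v1 v2 I W m g \<Longrightarrow> i \<in> I \<Longrightarrow> g i differentiable (at p)"
  by (rule smooth_on_differentiable[OF symbol_family_smooth UNIV_I])

lemma symbol_family_bound:
  assumes "symbol_family v1 v2 I W m g"
  shows "\<exists>C. \<forall>i\<in>I. \<forall>x k. norm (g i (x, k)) \<le> C * W i * (1 + norm k) powr m"
proof -
  from assms obtain C where
    "\<forall>i\<in>I. \<forall>x k. norm (sym_deriv 0 0 0 0 (g i) (x, k)) \<le> C * W i * (1 + norm k) powr (m - real (0 + 0))"
    unfolding symbol_family_def by blast
  then show ?thesis by (auto simp: sym_deriv_def)
qed

lemma funpow_dderiv_smooth: "smooth_on S f \<Longrightarrow> smooth_on S ((dderiv b ^^ n) f)"
  by (induction n) (auto intro: smooth_on_dderiv)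

lemma funpow_dderiv_commute:
  fixes f :: "'a::real_normed_vector \<Rightarrow> 'b::banach"
  assumes "smooth_on UNIV f"
  shows "(dderiv b ^^ n) (dderiv c f) = dderiv c ((dderiv b ^^ n) f)"
proof (induction n)
  case (Suc n)
  show ?case
    using Suc by (simp add: dderiv_commute[OF funpow_dderiv_smooth[OF assms], of b c])
qed simp

text \<open>The additional derivative is commuted past the others into its own slot in the fixed
  order of \<open>sym_deriv\<close>.\<close>

lemma sym_deriv_dderiv:
  fixes s :: "phase \<Rightarrow> 'b::banach"
  assumes "smooth_on UNIV s"
  shows "sym_deriv b1 b2 a1 a2 (dderiv (axis 1 1, 0) s) = sym_deriv (Suc b1) b2 a1 a2 s"
    and "sym_deriv b1 b2 a1 a2 (dderiv (axis 2 1, 0) s) = sym_deriv b1 (Suc b2) a1 a2 s"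
    and "sym_deriv b1 b2 a1 a2 (dderiv (0, axis 1 1) s) = sym_deriv b1 b2 (Suc a1) a2 s"
    and "sym_deriv b1 b2 a1 a2 (dderiv (0, axis 2 1) s) = sym_deriv b1 b2 a1 (Suc a2) s"
  unfolding sym_deriv_def
  by (simp_all add: funpow_dderiv_commute funpow_dderiv_smooth assms del: funpow.simps
      add: funpow_Suc_right)

lemma symbol_family_dderiv:
  fixes g :: "'i \<Rightarrow> phase \<Rightarrow> 'b::banach"
  assumes g: "symbol_family v1 v2 I W m g" and b: "b \<in> Basis"
  shows "symbol_family v1 v2 I W (m - order_drop b) (\<lambda>i. dderiv b (g i))"
  unfolding symbol_family_def
proof (intro conjI allI ballI)
  fix i x k l assume i: "i \<in> I" and l: "l \<in> lattice v1 v2"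
  have "g i ((x + l, k) + t *\<^sub>R b) = g i ((x, k) + t *\<^sub>R b)" for t
    using symbol_family_periodic[OF g i l, of "x + t *\<^sub>R fst b" "k + t *\<^sub>R snd b"]
    by (simp add: plus_prod_def add_ac)
  then show "dderiv b (g i) (x + l, k) = dderiv b (g i) (x, k)"
    by (simp add: dderiv_def)
next
  fix b1 b2 a1 a2
  have *: "\<exists>C. \<forall>i\<in>I. \<forall>x k. norm (sym_deriv b1 b2 a1 a2 (g i) (x, k))
      \<le> C * W i * (1 + norm k) powr (m - real (a1 + a2))" for b1 b2 a1 a2
    using g unfolding symbol_family_def by blast
  have sm: "i \<in> I \<Longrightarrow> smooth_on UNIV (g i)" for i by (rule symbol_family_smooth[OF g])
  consider "b = (axis 1 1, 0)" | "b = (axis 2 1, 0)" | "b = (0, axis 1 1)" | "b = (0, axis 2 1)"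
    using b by (auto simp: Basis_phase_space)
  then show "\<exists>C. \<forall>i\<in>I. \<forall>x k. norm (sym_deriv b1 b2 a1 a2 (dderiv b (g i)) (x, k))
      \<le> C * W i * (1 + norm k) powr (m - order_drop b - real (a1 + a2))"
  proof cases
    case 1
    then show ?thesis using *[of "Suc b1" b2 a1 a2] by (simp add: sym_deriv_dderiv sm)
  next
    case 2
    then show ?thesis using *[of b1 "Suc b2" a1 a2] by (simp add: sym_deriv_dderiv sm)
  next
    case 3
    then show ?thesis using *[of b1 b2 "Suc a1" a2] by (simp add: sym_deriv_dderiv sm algebra_simps)
  next
    case 4
    then show ?thesis using *[of b1 b2 a1 "Suc a2"] by (simp add: sym_deriv_dderiv sm algebra_simps)
  qed
qed (rule smooth_on_dderiv[OF symbol_family_smooth[OF g]])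

text \<open>The coinduction applied to the class of all symbol families, which yields closure under
  linear combinations.\<close>

lemma symbol_family_span:
  fixes g :: "'i \<Rightarrow> phase \<Rightarrow> 'b::banach"
  assumes "family_span I (symbol_family v1 v2 I W) m g"
  shows "symbol_family v1 v2 I W m g"
proof -
  interpret symbol_family_coinduct v1 v2 I W "symbol_family v1 v2 I W :: _ \<Rightarrow> ('i \<Rightarrow> _ \<Rightarrow> 'b) \<Rightarrow> _"
    by unfold_locales (auto intro: symbol_family_diff symbol_family_periodic symbol_family_bound
        symbol_family_dderiv family_span.base)
  show ?thesis by (rule span_symbol_family[OF assms])
qed

lemma symbol_family_mono:
  assumes g: "symbol_family v1 v2 I W m g" and "m \<le> m'" and W: "\<And>i. i \<in> I \<Longrightarrow> 0 \<le> W i"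
  shows "symbol_family v1 v2 I W m' g"
  unfolding symbol_family_def
proof (intro conjI allI ballI)
  fix b1 b2 a1 a2
  obtain C where C: "\<forall>i\<in>I. \<forall>x k. norm (sym_deriv b1 b2 a1 a2 (g i) (x, k))
      \<le> C * W i * (1 + norm k) powr (m - real (a1 + a2))"
    using g unfolding symbol_family_def by blast
  have "norm (sym_deriv b1 b2 a1 a2 (g i) (x, k)) \<le> \<bar>C\<bar> * W i * (1 + norm k) powr (m' - real (a1 + a2))"
    if i: "i \<in> I" for i x k
  proof -
    have "norm (sym_deriv b1 b2 a1 a2 (g i) (x, k)) \<le> C * W i * (1 + norm k) powr (m - real (a1 + a2))"
      using C i by blast
    also have "\<dots> \<le> \<bar>C\<bar> * W i * (1 + norm k) powr (m' - real (a1 + a2))"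
      using W[OF i] assms(2) by (intro mult_mono powr_mono) auto
    finally show ?thesis .
  qed
  then show "\<exists>C. \<forall>i\<in>I. \<forall>x k. norm (sym_deriv b1 b2 a1 a2 (g i) (x, k))
      \<le> C * W i * (1 + norm k) powr (m' - real (a1 + a2))" by blast
qed (use g in \<open>auto simp: symbol_family_def\<close>)


section \<open>Differentiation of series\<close>

text \<open>A summable majorant has countable support, and off this support \<open>f i\<close> and
  \<open>f' i\<close> vanish on \<open>U\<close>. Hence the sum can be enumerated by natural
  numbers, where \<open>has_derivative_series\<close> applies with the tails of the majorant as
  error bound.\<close>

lemma has_derivative_infsum:
  fixes f :: "'i \<Rightarrow> 'a::real_normed_vector \<Rightarrow> 'b::banach"
  assumes U: "open U" "convex U" "p \<in> U"
    and der: "\<And>i x. i \<in> I \<Longrightarrow> x \<in> U \<Longrightarrow> (f i has_derivative f' i x) (at x)"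
    and bf: "\<And>i x. i \<in> I \<Longrightarrow> x \<in> U \<Longrightarrow> norm (f i x) \<le> M i"
    and bf': "\<And>i x h. i \<in> I \<Longrightarrow> x \<in> U \<Longrightarrow> norm (f' i x h) \<le> M i * norm h"
    and M: "M summable_on I"
  shows "((\<lambda>x. \<Sum>\<^sub>\<infinity>i\<in>I. f i x) has_derivative (\<lambda>h. \<Sum>\<^sub>\<infinity>i\<in>I. f' i p h)) (at p)"
proof -
  define I0 where "I0 = {i\<in>I. M i \<noteq> 0}"
  have M0: "M i \<ge> 0" if "i \<in> I" for i
    using bf[OF that U(3)] norm_ge_zero order_trans by blast
  have "(\<lambda>i. norm (M i)) summable_on I"
    using M M0 by (auto cong: summable_on_cong)
  then have count: "countable I0"
    unfolding I0_def by (rule Infinite_Sum.abs_summable_countable)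
  \<comment> \<open>\<open>J\<close> may be a proper or even finite set of naturals; the sequences
    below are padded with 0 outside it.\<close>
  define J where "J = to_nat_on I0 ` I0"
  define e where "e = from_nat_into I0"
  have bij: "bij_betw e J I0"
    unfolding e_def J_def
    by (rule bij_betwI[where g = "to_nat_on I0"])
      (use count in \<open>auto simp: from_nat_into_to_nat_on\<close>)
  then have eI: "n \<in> J \<Longrightarrow> e n \<in> I" for n
    unfolding I0_def bij_betw_def by auto
  have to_nat: "infsum g I = infsum (\<lambda>n. if n \<in> J then g (e n) else 0) UNIV"
    if "\<And>i. i \<in> I \<Longrightarrow> M i = 0 \<Longrightarrow> g i = 0" for g :: "'i \<Rightarrow> 'b"
  proof -
    have "infsum g I = infsum g I0"
      by (rule infsum_cong_neutral) (use that in \<open>auto simp: I0_def\<close>)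
    also have "\<dots> = infsum (\<lambda>n. g (e n)) J"
      by (rule infsum_reindex_bij_betw[OF bij, symmetric])
    also have "\<dots> = infsum (\<lambda>n. if n \<in> J then g (e n) else 0) UNIV"
      by (rule infsum_cong_neutral) auto
    finally show ?thesis .
  qed
  define N where "N n = (if n \<in> J then M (e n) else 0)" for n
  have N0: "N n \<ge> 0" for n unfolding N_def using M0 eI by auto
  have "M summable_on I0"
    by (rule summable_on_subset_banach[OF M]) (auto simp: I0_def)
  then have "(\<lambda>n. M (e n)) summable_on J"
    using summable_on_reindex_bij_betw[OF bij] by blast
  then have "N summable_on UNIV"
    unfolding N_def by (subst summable_on_cong_neutral[where T = J and g = "\<lambda>n. M (e n)"]) auto
  then have N: "summable N" by (rule summable_on_imp_summable)
  have infsum_suminf: "infsum g UNIV = suminf g" "summable g"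
    if "\<And>n. norm (g n) \<le> N n * c" for g :: "nat \<Rightarrow> 'b" and c
  proof -
    have *: "summable (\<lambda>n. norm (g n))"
      by (rule summable_comparison_test'[OF summable_mult2[OF N, of c], of 0]) (use that in auto)
    then show "summable g" by (rule summable_norm_cancel)
    have "g summable_on UNIV" by (rule norm_summable_imp_summable_on[OF *])
    then show "infsum g UNIV = suminf g"
      using has_sum_imp_sums sums_unique has_sum_infsum by blast
  qed
  define F where "F n x = (if n \<in> J then f (e n) x else 0)" for n x
  define F' where "F' n x h = (if n \<in> J then f' (e n) x h else 0)" for n x h
  have F: "norm (F n x) \<le> N n * 1" and F': "norm (F' n x h) \<le> N n * norm h" if "x \<in> U" for n x h
    using bf[OF eI that] bf'[OF eI that] by (auto simp: F_def F'_def N_def)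
  have eqF: "(\<Sum>\<^sub>\<infinity>i\<in>I. f i x) = (\<Sum>n. F n x)" if "x \<in> U" for x
  proof -
    have "(\<Sum>\<^sub>\<infinity>i\<in>I. f i x) = infsum (\<lambda>n. F n x) UNIV"
      unfolding F_def by (rule to_nat) (use bf that in force)
    then show ?thesis using infsum_suminf(1)[OF F[OF that]] by simp
  qed
  have eqF': "(\<Sum>\<^sub>\<infinity>i\<in>I. f' i x h) = (\<Sum>n. F' n x h)" if "x \<in> U" for x h
  proof -
    have "(\<Sum>\<^sub>\<infinity>i\<in>I. f' i x h) = infsum (\<lambda>n. F' n x h) UNIV"
      unfolding F'_def by (rule to_nat) (use bf' that in force)
    then show ?thesis using infsum_suminf(1)[OF F'[OF that]] by simp
  qed
  have "\<exists>g. \<forall>x\<in>U. (\<lambda>n. F n x) sums g x \<and> (g has_derivative (\<lambda>h. \<Sum>n. F' n x h)) (at x within U)"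
  proof (rule has_derivative_series[OF U(2) _ _ U(3)])
    show "(F n has_derivative F' n x) (at x within U)" if "x \<in> U" for n x
      using der[OF eI that] unfolding F_def F'_def by (cases "n \<in> J") (auto intro: has_derivative_at_withinI)
    show "(\<lambda>n. F n p) sums (\<Sum>n. F n p)"
      by (rule summable_sums) (rule infsum_suminf(2)[OF F[OF U(3)]])
    fix r :: real assume "r > 0"
    from suminf_exist_split[OF this N] obtain K where K: "\<And>n. n \<ge> K \<Longrightarrow> norm (\<Sum>i. N (i + n)) < r" by blast
    have "norm ((\<Sum>i<n. F' i x h) - (\<Sum>n. F' n x h)) \<le> r * norm h" if "n \<ge> K" "x \<in> U" for n x h
    proof -
      note sumF = infsum_suminf(2)[OF F'[OF that(2)]]
      have sN: "summable (\<lambda>i. N (i + n) * norm h)"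
        using N by (intro summable_mult2 summable_ignore_initial_segment)
      have "norm ((\<Sum>i<n. F' i x h) - (\<Sum>n. F' n x h)) = norm (\<Sum>i. F' (i + n) x h)"
        using suminf_split_initial_segment[OF sumF, of h n] by simp
      also have "\<dots> \<le> (\<Sum>i. N (i + n) * norm h)"
        by (rule norm_suminf_le[OF F'[OF that(2)] sN])
      also have "\<dots> = (\<Sum>i. N (i + n)) * norm h"
        using N by (intro suminf_mult2[symmetric] summable_ignore_initial_segment)
      also have "\<dots> \<le> r * norm h"
        using K[OF that(1)] by (intro mult_right_mono) auto
      finally show ?thesis .
    qed
    then show "\<forall>\<^sub>F n in sequentially. \<forall>x\<in>U. \<forall>h. norm ((\<Sum>i<n. F' i x h) - (\<Sum>n. F' n x h)) \<le> r * norm h"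
      unfolding eventually_sequentially by blast
  qed
  then obtain g where g: "\<And>x. x \<in> U \<Longrightarrow> (\<lambda>n. F n x) sums g x"
    "(g has_derivative (\<lambda>h. \<Sum>n. F' n p h)) (at p within U)"
    using U(3) by blast
  have "(g has_derivative (\<lambda>h. \<Sum>n. F' n p h)) (at p)"
    using g(2) at_within_open[OF U(3,1)] by simp
  then have "((\<lambda>x. \<Sum>\<^sub>\<infinity>i\<in>I. f i x) has_derivative (\<lambda>h. \<Sum>n. F' n p h)) (at p)"
    by (rule has_derivative_transform_within_open[OF _ U(1,3)])
      (use eqF g(1) sums_unique in fastforce)
  then show ?thesis by (simp add: eqF'[OF U(3)])
qed

lemma summable_on_bounded:
  fixes f :: "'i \<Rightarrow> 'b::banach"
  assumes "W summable_on I" "\<And>i. i \<in> I \<Longrightarrow> norm (f i) \<le> c * W i"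
  shows "f summable_on I" "(\<lambda>i. norm (f i)) summable_on I"
    "norm (infsum f I) \<le> c * infsum W I"
proof -
  have cW: "(\<lambda>i. c * W i) summable_on I" by (rule summable_on_cmult_right[OF assms(1)])
  show *: "(\<lambda>i. norm (f i)) summable_on I"
    by (rule Infinite_Sum.abs_summable_on_comparison_test'[OF cW assms(2)])
  then show "f summable_on I" by (rule abs_summable_summable)
  have "norm (infsum f I) \<le> (\<Sum>\<^sub>\<infinity>i\<in>I. norm (f i))"
    by (rule norm_infsum_bound[OF *])
  also have "\<dots> \<le> (\<Sum>\<^sub>\<infinity>i\<in>I. c * W i)"
    by (rule infsum_mono[OF * cW assms(2)])
  also have "\<dots> = c * infsum W I" by (rule infsum_cmult_right') 
  finally show "norm (infsum f I) \<le> c * infsum W I" .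
qed

lemma powr_le_exp_abs:
  fixes x y m :: real
  assumes "1 \<le> x" "x \<le> y"
  shows "x powr m \<le> y powr \<bar>m\<bar>"
proof -
  have "x powr m \<le> x powr \<bar>m\<bar>" using assms by (intro powr_mono) auto
  also have "\<dots> \<le> y powr \<bar>m\<bar>" using assms by (intro powr_mono2) auto
  finally show ?thesis .
qed

text \<open>Sums of families with the fixed weight \<open>W\<close> form a class closed under
  coordinate derivatives: terms and first derivatives are bounded near each point by a multiple of
  \<open>W\<close>, so differentiation goes under the sum. What remains is the order zero bound,
  obtained by summing \<open>W\<close>.\<close>

theorem symbol_family_infsum:
  fixes g :: "'i \<Rightarrow> phase \<Rightarrow> 'b::banach"
  assumes g: "symbol_family v1 v2 I W m g" and W: "W summable_on I" "\<And>i. i \<in> I \<Longrightarrow> 0 \<le> W i"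
  shows "(\<lambda>q. \<Sum>\<^sub>\<infinity>i\<in>I. g i q) \<in> symbol_class v1 v2 m"
proof -
  define T :: "real \<Rightarrow> (unit \<Rightarrow> phase \<Rightarrow> 'b) \<Rightarrow> bool" where
    "T m G \<longleftrightarrow> (\<exists>g. symbol_family v1 v2 I W m g \<and> G = (\<lambda>_ q. \<Sum>\<^sub>\<infinity>i\<in>I. g i q))" for m G
  have der: "((\<lambda>q. \<Sum>\<^sub>\<infinity>i\<in>I. g i q) has_derivative (\<lambda>h. \<Sum>\<^sub>\<infinity>i\<in>I. dderiv h (g i) p)) (at p)"
    if g: "symbol_family v1 v2 I W m g" for m and g :: "'i \<Rightarrow> phase \<Rightarrow> 'b" and p
  proof -
    \<comment> \<open>On the unit ball about \<open>p\<close> the quantity \<open>1 + |k|\<close>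
      lies between 1 and \<open>R\<close>, so its power of either sign is at most
      \<open>R powr \<bar>m\<bar>\<close>.\<close>
    define R where "R = 1 + norm p + 1"
    have local_bound: "\<exists>C\<ge>0. \<forall>i\<in>I. \<forall>q\<in>ball p 1. norm (g i q) \<le> C * W i"
      if g: "symbol_family v1 v2 I W m g" for m and g :: "'i \<Rightarrow> phase \<Rightarrow> 'b"
    proof -
      obtain C where C: "\<forall>i\<in>I. \<forall>x k. norm (g i (x, k)) \<le> C * W i * (1 + norm k) powr m"
        using symbol_family_bound[OF g] by blast
      have "norm (g i q) \<le> \<bar>C\<bar> * R powr \<bar>m\<bar> * W i" if "i \<in> I" "q \<in> ball p 1" for i q
      proof -
        have "norm (snd q) \<le> norm q" using norm_snd_le[of "snd q" "fst q"] by simp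
        also have "norm q \<le> norm p + 1"
          using that(2) norm_triangle_sub[of q p] by (simp add: dist_norm norm_minus_commute)
        finally have "(1 + norm (snd q)) powr m \<le> R powr \<bar>m\<bar>"
          by (intro powr_le_exp_abs) (auto simp: R_def)
        then have "\<bar>C\<bar> * W i * (1 + norm (snd q)) powr m \<le> \<bar>C\<bar> * W i * R powr \<bar>m\<bar>"
          using W(2)[OF that(1)] by (intro mult_left_mono) auto
        moreover have "norm (g i q) \<le> C * W i * (1 + norm (snd q)) powr m"
          using C that(1) by (metis prod.collapse)
        moreover have "C * W i * (1 + norm (snd q)) powr m \<le> \<bar>C\<bar> * W i * (1 + norm (snd q)) powr m"
          using W(2)[OF that(1)] by (intro mult_right_mono) auto
        ultimately show ?thesis by (simp add: mult_ac)
      qed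
      then show ?thesis by (intro exI[of _ "\<bar>C\<bar> * R powr \<bar>m\<bar>"]) auto
    qed
    obtain C0 where C0: "C0 \<ge> 0" "\<And>i q. i \<in> I \<Longrightarrow> q \<in> ball p 1 \<Longrightarrow> norm (g i q) \<le> C0 * W i"
      using local_bound[OF g] by blast
    have "\<forall>b\<in>Basis. \<exists>C\<ge>0. \<forall>i\<in>I. \<forall>q\<in>ball p 1. norm (dderiv b (g i) q) \<le> C * W i"
      using local_bound[OF symbol_family_dderiv[OF g]] by blast
    then obtain C where C: "\<And>b. b \<in> Basis \<Longrightarrow> C b \<ge> 0"
      "\<And>b i q. b \<in> Basis \<Longrightarrow> i \<in> I \<Longrightarrow> q \<in> ball p 1 \<Longrightarrow> norm (dderiv b (g i) q) \<le> C b * W i"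
      by metis
    define M where "M = C0 + sum C Basis"
    have sC: "sum C Basis \<ge> 0" using C(1) by (rule sum_nonneg)
    show ?thesis
    proof (rule has_derivative_infsum[where U = "ball p 1" and M = "\<lambda>i. M * W i"])
      show "(g i has_derivative (\<lambda>h. dderiv h (g i) x)) (at x)" if "i \<in> I" for i x
        by (rule has_derivative_dderiv[OF symbol_family_diff[OF g that]])
      show "norm (g i x) \<le> M * W i" if "i \<in> I" "x \<in> ball p 1" for i x
        using C0(2)[OF that] sC W(2)[OF that(1)] mult_right_mono[of C0 M "W i"] by (simp add: M_def)
      show "norm (dderiv h (g i) x) \<le> M * W i * norm h" if "i \<in> I" "x \<in> ball p 1" for i x h
      proof -
        have "norm (dderiv h (g i) x) = norm (\<Sum>b\<in>Basis. (h \<bullet> b) *\<^sub>R dderiv b (g i) x)"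
          using dderiv_Basis[OF symbol_family_diff[OF g that(1)]] by (metis (no_types, lifting))
        also have "\<dots> \<le> (\<Sum>b\<in>Basis. norm h * (C b * W i))"
        proof (rule sum_norm_le)
          fix b :: "phase" assume b: "b \<in> Basis"
          then show "norm ((h \<bullet> b) *\<^sub>R dderiv b (g i) x) \<le> norm h * (C b * W i)"
            using C(2)[OF b that] Basis_le_norm[OF b, of h] by (auto intro!: mult_mono)
        qed
        also have "\<dots> = sum C Basis * W i * norm h"
          by (simp add: sum_distrib_left sum_distrib_right mult_ac)
        also have "\<dots> \<le> M * W i * norm h"
          using C0(1) W(2)[OF that(1)] by (intro mult_right_mono) (auto simp: M_def)
        finally show ?thesis .
      qed
      show "(\<lambda>i. M * W i) summable_on I" by (rule summable_on_cmult_right[OF W(1)])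
    qed auto
  qed
  interpret symbol_family_coinduct v1 v2 "{()}" "\<lambda>_. 1" T
  proof
    fix m G p and i :: unit assume "T m G"
    then obtain g where g: "symbol_family v1 v2 I W m g" and G: "G = (\<lambda>_ q. \<Sum>\<^sub>\<infinity>i\<in>I. g i q)"
      unfolding T_def by blast
    show "G i differentiable (at p)"
      using der[OF g] G unfolding differentiable_def by blast
    show "G i (x + l, k) = G i (x, k)" if "l \<in> lattice v1 v2" for x l k
      unfolding G using symbol_family_periodic[OF g _ that] by (auto cong: infsum_cong)
    obtain C where C: "\<forall>i\<in>I. \<forall>x k. norm (g i (x, k)) \<le> C * W i * (1 + norm k) powr m"
      using symbol_family_bound[OF g] by blast
    show "\<exists>C. \<forall>i\<in>{()}. \<forall>x k. norm (G i (x, k)) \<le> C * 1 * (1 + norm k) powr m"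
    proof (intro exI[of _ "C * infsum W I"] ballI allI)
      fix i x k
      have "norm (G i (x, k)) \<le> (C * (1 + norm k) powr m) * infsum W I"
        unfolding G by (rule summable_on_bounded(3)[OF W(1)]) (use C in \<open>auto simp: mult_ac\<close>)
      then show "norm (G i (x, k)) \<le> C * infsum W I * 1 * (1 + norm k) powr m"
        by (simp add: mult_ac)
    qed
    fix b :: "phase" assume b: "b \<in> Basis"
    have "T (m - order_drop b) (\<lambda>i. dderiv b (G i))"
      unfolding T_def G
      by (intro exI[of _ "\<lambda>i. dderiv b (g i)"] conjI symbol_family_dderiv[OF g b] ext dderiv_eq der[OF g])
    then show "family_span {()} T (m - order_drop b) (\<lambda>i. dderiv b (G i))" by (rule family_span.base)
  qed
  have "T m (\<lambda>_ q. \<Sum>\<^sub>\<infinity>i\<in>I. g i q)" unfolding T_def using g by blast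
  from symbol_family[OF this] show ?thesis by (simp add: symbol_class_iff_family)
qed


section \<open>Algebra of symbols\<close>

lemma symbol_class_periodic:
  "s \<in> symbol_class v1 v2 m \<Longrightarrow> l \<in> lattice v1 v2 \<Longrightarrow> s (x + l, k) = s (x, k)"
  by (auto simp: symbol_class_def)

lemma symbol_class_smooth: "s \<in> symbol_class v1 v2 m \<Longrightarrow> smooth_on UNIV s"
  by (auto simp: symbol_class_def)

lemma symbol_class_diff: "s \<in> symbol_class v1 v2 m \<Longrightarrow> s differentiable (at p)"
  by (rule smooth_on_differentiable[OF symbol_class_smooth UNIV_I])

lemma symbol_class_continuous: "s \<in> symbol_class v1 v2 m \<Longrightarrow> continuous_on UNIV s"
  by (rule smooth_on_continuous[OF symbol_class_smooth])

lemma symbol_class_bound: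
  assumes "s \<in> symbol_class v1 v2 m"
  obtains C where "C \<ge> 0" "\<And>x k. norm (s (x, k)) \<le> C * (1 + norm k) powr m"
proof -
  from symbol_family_bound[OF assms[unfolded symbol_class_iff_family]] obtain C
    where C: "\<And>x k. norm (s (x, k)) \<le> C * (1 + norm k) powr m" by auto
  have "C * (1 + norm k) powr m \<le> \<bar>C\<bar> * (1 + norm k) powr m" for k :: "real^2"
    by (rule mult_right_mono) auto
  from order_trans[OF C this] show ?thesis by (intro that[of "\<bar>C\<bar>"]) auto
qed

lemma symbol_class_dderiv:
  fixes s :: "phase \<Rightarrow> 'b::banach"
  shows "s \<in> symbol_class v1 v2 m \<Longrightarrow> b \<in> Basis \<Longrightarrow> dderiv b s \<in> symbol_class v1 v2 (m - order_drop b)"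
  unfolding symbol_class_iff_family by (rule symbol_family_dderiv)

lemma symbol_class_mono:
  "s \<in> symbol_class v1 v2 m \<Longrightarrow> m \<le> m' \<Longrightarrow> s \<in> symbol_class v1 v2 m'"
  unfolding symbol_class_iff_family by (erule symbol_family_mono) auto

lemma symbol_class_add:
  fixes s :: "phase \<Rightarrow> 'b::banach"
  assumes "s \<in> symbol_class v1 v2 m" "t \<in> symbol_class v1 v2 m"
  shows "(\<lambda>q. s q + t q) \<in> symbol_class v1 v2 m"
  unfolding symbol_class_iff_family
  by (rule symbol_family_span, rule family_span.add; rule family_span.base)
    (use assms in \<open>auto simp: symbol_class_iff_family\<close>)

lemma symbol_class_scaleR:
  fixes s :: "phase \<Rightarrow> 'b::banach"
  assumes "s \<in> symbol_class v1 v2 m"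
  shows "(\<lambda>q. c *\<^sub>R s q) \<in> symbol_class v1 v2 m"
  unfolding symbol_class_iff_family
  by (rule symbol_family_span, rule family_span.scale, rule family_span.base)
    (use assms in \<open>auto simp: symbol_class_iff_family\<close>)

lemma symbol_class_uminus:
  fixes s :: "phase \<Rightarrow> 'b::banach"
  assumes "s \<in> symbol_class v1 v2 m"
  shows "(\<lambda>q. - s q) \<in> symbol_class v1 v2 m"
  using symbol_class_scaleR[OF assms, of "-1"] by simp

lemma symbol_class_diff_closed:
  fixes s :: "phase \<Rightarrow> 'b::banach"
  assumes "s \<in> symbol_class v1 v2 m" "t \<in> symbol_class v1 v2 m"
  shows "(\<lambda>q. s q - t q) \<in> symbol_class v1 v2 m"
  using symbol_class_add[OF assms(1) symbol_class_uminus[OF assms(2)]] by simp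

lemma symbol_class_zero:
  "(\<lambda>q. 0 :: 'b::banach) \<in> symbol_class v1 v2 m"
  unfolding symbol_class_iff_family by (rule symbol_family_span[OF family_span.zero])

lemma symbol_class_sum:
  fixes s :: "'j \<Rightarrow> phase \<Rightarrow> 'b::banach"
  shows "(\<And>j. j \<in> A \<Longrightarrow> s j \<in> symbol_class v1 v2 m) \<Longrightarrow> (\<lambda>q. \<Sum>j\<in>A. s j q) \<in> symbol_class v1 v2 m"
  by (induction A rule: infinite_finite_induct) (auto intro: symbol_class_zero symbol_class_add)

text \<open>The class used for coinduction lets both factors and both orders vary, so the two terms
  of the Leibniz rule fall back into it.\<close>

lemma symbol_family_mult:
  fixes s :: "phase \<Rightarrow> 'b::{banach, real_normed_algebra}"
    and g :: "'i \<Rightarrow> phase \<Rightarrow> 'b"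
  assumes s: "s \<in> symbol_class v1 v2 m1" and g: "symbol_family v1 v2 I W m2 g"
    and W: "\<And>i. i \<in> I \<Longrightarrow> 0 \<le> W i" and m: "m = m1 + m2"
  shows "symbol_family v1 v2 I W m (\<lambda>i q. s q * g i q)"
proof -
  define T :: "real \<Rightarrow> ('i \<Rightarrow> phase \<Rightarrow> 'b) \<Rightarrow> bool" where
    "T m G \<longleftrightarrow> (\<exists>m1 m2 s g. s \<in> symbol_class v1 v2 m1 \<and> symbol_family v1 v2 I W m2 g \<and>
       m = m1 + m2 \<and> G = (\<lambda>i q. s q * g i q))" for m G
  interpret symbol_family_coinduct v1 v2 I W T
  proof
    fix m G i p assume "T m G"
    then obtain m1 m2 s g where s: "s \<in> symbol_class v1 v2 m1" and g: "symbol_family v1 v2 I W m2 g"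
      and m: "m = m1 + m2" and G: "G = (\<lambda>i q. s q * g i q)"
      unfolding T_def by blast
    show "G i differentiable (at p)" if "i \<in> I"
      unfolding G using symbol_class_diff[OF s] symbol_family_diff[OF g that] by (rule differentiable_mult)
    show "G i (x + l, k) = G i (x, k)" if "i \<in> I" "l \<in> lattice v1 v2" for x l k
      unfolding G using symbol_class_periodic[OF s that(2)] symbol_family_periodic[OF g that] by simp
    obtain C where C: "C \<ge> 0" "\<And>x k. norm (s (x, k)) \<le> C * (1 + norm k) powr m1"
      using symbol_class_bound[OF s] by blast
    obtain D where D: "\<forall>i\<in>I. \<forall>x k. norm (g i (x, k)) \<le> D * W i * (1 + norm k) powr m2"
      using symbol_family_bound[OF g] by blast
    show "\<exists>C. \<forall>i\<in>I. \<forall>x k. norm (G i (x, k)) \<le> C * W i * (1 + norm k) powr m"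
    proof (intro exI[of _ "C * D"] ballI allI)
      fix i x and k :: "real^2" assume i: "i \<in> I"
      have "norm (G i (x, k)) \<le> norm (s (x, k)) * norm (g i (x, k))"
        unfolding G by (rule norm_mult_ineq)
      also have "\<dots> \<le> (C * (1 + norm k) powr m1) * (D * W i * (1 + norm k) powr m2)"
        using C D i by (intro mult_mono) auto
      finally show "norm (G i (x, k)) \<le> C * D * W i * (1 + norm k) powr m"
        by (simp add: m powr_add mult_ac)
    qed
    fix b :: "phase" assume b: "b \<in> Basis"
    show "family_span I T (m - order_drop b) (\<lambda>i. dderiv b (G i))"
    proof (rule family_span.cong[OF family_span.add[OF family_span.base family_span.base]])
      show "T (m - order_drop b) (\<lambda>i q. s q * dderiv b (g i) q)"
        unfolding T_def by (intro exI conjI, rule s, rule symbol_family_dderiv[OF g b]) (auto simp: m)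
      show "T (m - order_drop b) (\<lambda>i q. dderiv b s q * g i q)"
        unfolding T_def by (intro exI conjI, rule symbol_class_dderiv[OF s b], rule g) (auto simp: m)
      show "dderiv b (G i) q = s q * dderiv b (g i) q + dderiv b s q * g i q" if "i \<in> I" for i q
        unfolding G by (rule dderiv_mult[OF symbol_class_diff[OF s] symbol_family_diff[OF g that]])
    qed
  qed
  have "T m (\<lambda>i q. s q * g i q)" unfolding T_def using assms by blast
  then show ?thesis by (rule symbol_family)
qed

lemma symbol_class_mult:
  fixes s :: "phase \<Rightarrow> 'b::{banach, real_normed_algebra}"
  assumes "s \<in> symbol_class v1 v2 m1" "t \<in> symbol_class v1 v2 m2" "m = m1 + m2"
  shows "(\<lambda>q. s q * t q) \<in> symbol_class v1 v2 m"
  unfolding symbol_class_iff_family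
  by (rule symbol_family_mult[OF assms(1) assms(2)[unfolded symbol_class_iff_family] _ assms(3)]) simp

text \<open>The coinduction for single symbols. A derivative may be a sum of two members, the shape
  that the Leibniz rule produces; where one member is enough, the other is zero.\<close>

locale symbol_class_coinduct =
  fixes v1 v2 :: "real^2" and T :: "real \<Rightarrow> (phase \<Rightarrow> 'b::banach) \<Rightarrow> bool"
  assumes sdiff: "T m s \<Longrightarrow> s differentiable (at p)"
    and speriodic: "T m s \<Longrightarrow> l \<in> lattice v1 v2 \<Longrightarrow> s (x + l, k) = s (x, k)"
    and sbound: "T m s \<Longrightarrow> \<exists>C. \<forall>x k. norm (s (x, k)) \<le> C * (1 + norm k) powr m"
    and sstep: "T m s \<Longrightarrow> b \<in> Basis \<Longrightarrow>
      \<exists>u w. T (m - order_drop b) u \<and> T (m - order_drop b) w \<and> (\<forall>q. dderiv b s q = u q + w q)"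
begin

lemma symbol_class: assumes "T m s" shows "s \<in> symbol_class v1 v2 m"
proof -
  interpret symbol_family_coinduct v1 v2 "{()}" "\<lambda>_. 1" "\<lambda>m g. T m (g ())"
  proof
    fix m and g :: "unit \<Rightarrow> phase \<Rightarrow> 'b" and i :: unit and p assume T: "T m (g ())"
    show "g i differentiable (at p)" using sdiff[OF T] by simp
    show "g i (x + l, k) = g i (x, k)" if "l \<in> lattice v1 v2" for x l k using speriodic[OF T that] by simp
    show "\<exists>C. \<forall>i\<in>{()}. \<forall>x k. norm (g i (x, k)) \<le> C * 1 * (1 + norm k) powr m"
      using sbound[OF T] by simp
    fix b :: "phase" assume "b \<in> Basis"
    then obtain u w where uw: "T (m - order_drop b) u" "T (m - order_drop b) w" "\<And>q. dderiv b (g ()) q = u q + w q"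
      using sstep[OF T] by blast
    show "family_span {()} (\<lambda>m g. T m (g ())) (m - order_drop b) (\<lambda>i. dderiv b (g i))"
      by (rule family_span.cong[OF family_span.add[OF family_span.base[of _ _ "\<lambda>_. u"] family_span.base[of _ _ "\<lambda>_. w"]]])
        (use uw in auto)
  qed
  show ?thesis unfolding symbol_class_iff_family by (rule symbol_family) (rule assms)
qed

end


section \<open>Periodic functions\<close>

locale torus =
  fixes v1 v2 :: "real^2"
  assumes v1_neq_v2: "v1 \<noteq> v2" and independent_v: "independent {v1, v2}"
begin

abbreviation "L \<equiv> lattice v1 v2"
abbreviation "S \<equiv> symbol_class v1 v2"

lemma coordinates: "\<exists>s t. x = s *\<^sub>R v1 + t *\<^sub>R v2"
proof -
  have "span {v1, v2} = UNIV"
    using card_ge_dim_independent[of "{v1, v2}" UNIV] independent_v v1_neq_v2 by auto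
  then have "x \<in> span {v1, v2}" by simp
  then show ?thesis by (auto simp: span_breakdown_eq algebra_simps)
qed

lemma lattice_generators: "v1 \<in> L" "v2 \<in> L"
  unfolding lattice_def
  by (intro CollectI exI[of _ 1] exI[of _ 0], simp) (intro CollectI exI[of _ 0] exI[of _ 1], simp)

lemma fundamental_cell:
  obtains s t l where "s \<in> {0..1}" "t \<in> {0..1}" "l \<in> L" "x = s *\<^sub>R v1 + t *\<^sub>R v2 + l"
proof -
  obtain s t where x: "x = s *\<^sub>R v1 + t *\<^sub>R v2" using coordinates by blast
  show ?thesis
    by (rule that[of "frac s" "frac t" "of_int \<lfloor>s\<rfloor> *\<^sub>R v1 + of_int \<lfloor>t\<rfloor> *\<^sub>R v2"])
      (auto simp: less_imp_le[OF frac_lt_1] lattice_def x, auto simp: frac_def algebra_simps)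
qed

lemma smooth_periodicD:
  assumes "u \<in> smooth_periodic v1 v2"
  shows "smooth_on UNIV u" "\<And>x l. l \<in> L \<Longrightarrow> u (x + l) = u x"
    "continuous_on UNIV u" "\<And>p. u differentiable (at p)"
  using assms smooth_on_continuous smooth_on_differentiable[OF _ UNIV_I] by (auto simp: smooth_periodic_def)

lemma periodic_bounded:
  fixes u :: "real^2 \<Rightarrow> 'b::real_normed_vector"
  assumes "continuous_on UNIV u" "\<And>x l. l \<in> L \<Longrightarrow> u (x + l) = u x"
  shows "\<exists>C\<ge>0. \<forall>x. norm (u x) \<le> C"
proof -
  have "compact ((\<lambda>(s, t). u (s *\<^sub>R v1 + t *\<^sub>R v2)) ` cbox (0, 0) (1, 1))"
    unfolding case_prod_unfold
    by (intro compact_continuous_image continuous_on_compose2[OF assms(1)] continuous_intros) auto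
  then obtain C where C: "\<forall>y\<in>(\<lambda>(s, t). u (s *\<^sub>R v1 + t *\<^sub>R v2)) ` cbox (0, 0) (1, 1). norm y \<le> C"
    using compact_imp_bounded bounded_iff by blast
  have "norm (u x) \<le> \<bar>C\<bar>" for x
  proof -
    obtain s t l where "s \<in> {0..1}" "t \<in> {0..1}" "l \<in> L" and x: "x = s *\<^sub>R v1 + t *\<^sub>R v2 + l"
      by (rule fundamental_cell)
    then have "u x = u (s *\<^sub>R v1 + t *\<^sub>R v2)" "(s, t) \<in> cbox (0, 0) (1::real, 1::real)"
      using assms(2) by (auto simp: cbox_Pair_eq)
    then have "norm (u x) \<le> C" using C by (metis (mono_tags, lifting) case_prod_conv image_eqI)
    then show ?thesis by simp
  qed
  then show ?thesis by (intro exI[of _ "\<bar>C\<bar>"]) auto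
qed

lemma smooth_periodic_dderiv:
  assumes "u \<in> smooth_periodic v1 v2"
  shows "dderiv v u \<in> smooth_periodic v1 v2"
proof -
  have "u (x + l + t *\<^sub>R v) = u (x + t *\<^sub>R v)" if "l \<in> L" for x l t
    using smooth_periodicD(2)[OF assms that, of "x + t *\<^sub>R v"] by (simp add: add_ac)
  then show ?thesis
    using assms by (auto simp: smooth_periodic_def smooth_on_dderiv dderiv_def)
qed

lemma smooth_periodic_const: "(\<lambda>x. c) \<in> smooth_periodic v1 v2"
  unfolding smooth_periodic_def
  by (auto intro!: smooth_on_coinduct[where T = "range (\<lambda>c x. c)"])

lemma smooth_periodic_bounded_linear:
  "bounded_linear B \<Longrightarrow> u \<in> smooth_periodic v1 v2 \<Longrightarrow> (\<lambda>x. B (u x)) \<in> smooth_periodic v1 v2"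
  by (auto simp: smooth_periodic_def smooth_on_bounded_linear)

lemma symbol_of_function:
  fixes f :: "real^2 \<Rightarrow> 'b::banach"
  assumes "f \<in> smooth_periodic v1 v2"
  shows "(\<lambda>q. f (fst q)) \<in> S 0"
proof -
  define T :: "real \<Rightarrow> (phase \<Rightarrow> 'b) \<Rightarrow> bool" where
    "T m s \<longleftrightarrow> (\<exists>f\<in>smooth_periodic v1 v2. s = (\<lambda>q. f (fst q)) \<and> (0 \<le> m \<or> f = (\<lambda>x. 0)))" for m s
  have T0: "T m (\<lambda>q. 0)" for m
    unfolding T_def by (intro bexI[OF _ smooth_periodic_const[of 0]]) auto
  interpret symbol_class_coinduct v1 v2 T
  proof
    fix m s p assume "T m s"
    then obtain f where f: "f \<in> smooth_periodic v1 v2" and s: "s = (\<lambda>q. f (fst q))"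
      and m: "0 \<le> m \<or> f = (\<lambda>x. 0)" unfolding T_def by blast
    show "s differentiable (at p)"
      unfolding s by (rule differentiable_compose[OF smooth_periodicD(4)[OF f]])
        (auto intro!: linear_imp_differentiable linear_fst)
    show "s (x + l, k) = s (x, k)" if "l \<in> L" for x l k
      unfolding s using smooth_periodicD(2)[OF f that] by simp
    obtain C where C: "C \<ge> 0" "\<And>x. norm (f x) \<le> C"
      using periodic_bounded smooth_periodicD(2,3)[OF f] by blast
    show "\<exists>C. \<forall>x k. norm (s (x, k)) \<le> C * (1 + norm k) powr m"
    proof (cases "f = (\<lambda>x. 0)")
      case True
      then show ?thesis by (intro exI[of _ 0]) (simp add: s)
    next
      case False
      then have "1 \<le> (1 + norm k) powr m" for k :: "real^2"
        using m by (intro ge_one_powr_ge_zero) auto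
      then have "C \<le> C * (1 + norm k) powr m" for k :: "real^2"
        using mult_left_mono[OF _ C(1)] by force
      then show ?thesis by (intro exI[of _ C]) (auto simp: s intro: order_trans[OF C(2)])
    qed
    fix b :: "phase" assume "b \<in> Basis"
    have eq: "dderiv b s = (\<lambda>q. dderiv (fst b) f (fst q))"
      by (rule ext) (simp add: dderiv_def s)
    have "T (m - order_drop b) (dderiv b s)"
    proof (cases "fst b = 0")
      case True
      then have "dderiv b s = (\<lambda>q. 0)" unfolding eq
        by (simp add: dderiv_def)
      then show ?thesis using T0 by simp
    next
      case False
      then show ?thesis unfolding T_def eq using m
        by (intro bexI[OF _ smooth_periodic_dderiv[OF f, of "fst b"]]) (auto simp: order_drop_def)
    qed
    then show "\<exists>u w. T (m - order_drop b) u \<and> T (m - order_drop b) w \<and> (\<forall>q. dderiv b s q = u q + w q)"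
      using T0 by (intro exI[of _ "dderiv b s"] exI[of _ "\<lambda>q. 0"]) auto
  qed
  have "T 0 (\<lambda>q. f (fst q))" unfolding T_def using assms by blast
  then show ?thesis by (rule symbol_class)
qed

lemma symbol_const: "(\<lambda>q. c :: 'b::banach) \<in> S 0"
  using symbol_of_function[OF smooth_periodic_const[of c]] by simp

lemma symbol_cmult: "s \<in> S m \<Longrightarrow> (\<lambda>q. c * s q :: complex) \<in> S m"
  by (rule symbol_class_mult[OF symbol_const]) auto

lemma symbol_function_mult:
  fixes f :: "real^2 \<Rightarrow> complex"
  shows "f \<in> smooth_periodic v1 v2 \<Longrightarrow> s \<in> S m \<Longrightarrow> (\<lambda>q. f (fst q) * s q) \<in> S m"
  by (rule symbol_class_mult[OF symbol_of_function]) auto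

lemma symbol_coordinate: "(\<lambda>q. complex_of_real (snd q $ i)) \<in> S 1"
proof -
  \<comment> \<open>The coordinate has order 1, its derivatives are constants of order at least 0,
    and theirs are zero, which is allowed in every order.\<close>
  define T :: "real \<Rightarrow> (phase \<Rightarrow> complex) \<Rightarrow> bool" where
    "T m s \<longleftrightarrow> (\<exists>c. s = (\<lambda>q. c) \<and> (0 \<le> m \<or> c = 0)) \<or> m = 1 \<and> s = (\<lambda>q. complex_of_real (snd q $ i))" for m s
  have bl: "bounded_linear (\<lambda>q::phase. complex_of_real (snd q $ i))"
    by (intro bounded_linear_compose[OF bounded_linear_of_real]
        bounded_linear_compose[OF bounded_linear_vec_nth] bounded_linear_snd)
  interpret symbol_class_coinduct v1 v2 T
  proof
    fix m s p assume T: "T m s"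
    show "s differentiable (at p)"
      using T bounded_linear_imp_differentiable[OF bl] unfolding T_def by auto
    show "s (x + l, k) = s (x, k)" for x l k
      using T unfolding T_def by auto
    show "\<exists>C. \<forall>x k. norm (s (x, k)) \<le> C * (1 + norm k) powr m"
      using T unfolding T_def
    proof (elim disjE exE conjE)
      fix c :: complex assume s: "s = (\<lambda>q. c)" and "0 \<le> m"
      then have "1 \<le> (1 + norm k) powr m" for k :: "real^2"
        by (intro ge_one_powr_ge_zero) auto
      then show ?thesis by (intro exI[of _ "norm c"]) (simp add: s mult_le_cancel_left1)
    next
      assume "m = 1" and s: "s = (\<lambda>q. complex_of_real (snd q $ i))"
      have "\<bar>k $ i\<bar> \<le> 1 + norm k" for k :: "real^2"
        using component_le_norm_cart[of k i] by simp
      then show ?thesis by (intro exI[of _ 1]) (simp add: s \<open>m = 1\<close>)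
    qed (auto intro: exI[of _ 0])
    fix b :: "phase" assume b: "b \<in> Basis"
    have "\<exists>c. dderiv b s = (\<lambda>q. c) \<and> (0 \<le> m - order_drop b \<or> c = 0)"
      using T unfolding T_def
    proof (elim disjE exE conjE)
      assume "m = 1" and s: "s = (\<lambda>q. complex_of_real (snd q $ i))"
      have "dderiv b s = (\<lambda>q. complex_of_real (snd b $ i))"
        unfolding s by (rule ext) (rule dderiv_eq[OF bounded_linear_imp_has_derivative[OF bl]])
      then show ?thesis using \<open>m = 1\<close> by (auto simp: order_drop_def)
    qed (auto intro!: ext)
    then obtain c where "dderiv b s = (\<lambda>q. c)" "0 \<le> m - order_drop b \<or> c = 0" by blast
    then show "\<exists>u w. T (m - order_drop b) u \<and> T (m - order_drop b) w \<and> (\<forall>q. dderiv b s q = u q + w q)"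
      by (intro exI[of _ "dderiv b s"] exI[of _ "\<lambda>q. 0"]) (auto simp: T_def)
  qed
  show ?thesis by (rule symbol_class[of 1]) (simp add: T_def)
qed


section \<open>Real powers of positive elliptic symbols\<close>

text \<open>Members of the class are \<open>t * Y powr r\<close> with \<open>t\<close> of order
  \<open>m - \<mu> * r\<close>. Differentiating the power replaces \<open>r\<close> by
  \<open>r - 1\<close> and multiplies \<open>t\<close> by a derivative of \<open>Y\<close>, whose
  order compensates the lowered exponent.\<close>

lemma symbol_powr:
  fixes Y :: "phase \<Rightarrow> real"
  assumes Y: "(\<lambda>q. complex_of_real (Y q)) \<in> S \<mu>" and "c > 0"
    and lower: "\<And>x k. c * (1 + norm k) powr \<mu> \<le> Y (x, k)"
  shows "(\<lambda>q. complex_of_real (Y q powr r)) \<in> S (\<mu> * r)"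
proof -
  define T :: "real \<Rightarrow> (phase \<Rightarrow> complex) \<Rightarrow> bool" where
    "T m s \<longleftrightarrow> (\<exists>r t. t \<in> S (m - \<mu> * r) \<and> s = (\<lambda>q. t q * complex_of_real (Y q powr r)))" for m s
  have pos: "Y q > 0" for q
  proof -
    have "0 < c * (1 + norm (snd q)) powr \<mu>"
      using \<open>c > 0\<close> norm_ge_zero[of "snd q"] by (intro mult_pos_pos) (auto simp: add_nonneg_eq_0_iff)
    then show ?thesis using lower[of "snd q" "fst q"] by simp
  qed
  have Re_of: "Y = (\<lambda>q. Re (complex_of_real (Y q)))" by simp
  have Ydiff: "Y differentiable (at p)" for p
    by (subst Re_of) (rule differentiable_bounded_linear[OF bounded_linear_Re symbol_class_diff[OF Y]])
  have dY: "dderiv b (\<lambda>q. complex_of_real (Y q)) p = complex_of_real (dderiv b Y p)" for b p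
    by (rule dderiv_bounded_linear[OF bounded_linear_of_real Ydiff])
  have Yder: "((\<lambda>q. complex_of_real (Y q powr r)) has_derivative
      (\<lambda>h. complex_of_real (r * Y p powr (r - 1) * dderiv h Y p))) (at p)" for r p
  proof (rule has_derivative_of_real)
    have "((\<lambda>y. y powr r) has_derivative (\<lambda>h. r * Y p powr (r - 1) * h)) (at (Y p))"
      using has_real_derivative_powr[OF pos] unfolding has_field_derivative_def .
    from has_derivative_compose[OF has_derivative_dderiv[OF Ydiff] this]
    show "((\<lambda>q. Y q powr r) has_derivative (\<lambda>h. r * Y p powr (r - 1) * dderiv h Y p)) (at p)" .
  qed
  obtain C where C: "C \<ge> 0" "\<And>x k. norm (complex_of_real (Y (x, k))) \<le> C * (1 + norm k) powr \<mu>"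
    using symbol_class_bound[OF Y] by blast
  have Ybound: "\<exists>D\<ge>0. \<forall>x k. Y (x, k) powr r \<le> D * (1 + norm k) powr (\<mu> * r)" for r
  proof -
    have up: "Y (x, k) \<le> (C + 1) * (1 + norm k) powr \<mu>" for x k
      using C(2)[of x k] pos[of "(x, k)"] powr_ge_zero[of "1 + norm k" \<mu>]
      by (simp add: algebra_simps del: powr_ge_zero)
    \<comment> \<open>A nonnegative exponent uses the upper bound on \<open>Y\<close>, a negative
      one the lower bound; the constant is the sum of both.\<close>
    have "Y (x, k) powr r \<le> ((C + 1) powr r + c powr r) * (1 + norm k) powr (\<mu> * r)" for x k
    proof (cases "r \<ge> 0")
      case True
      have "Y (x, k) powr r \<le> ((C + 1) * (1 + norm k) powr \<mu>) powr r"
        using True pos[of "(x, k)"] up by (intro powr_mono2) (auto intro: less_imp_le)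
      also have "\<dots> = (C + 1) powr r * (1 + norm k) powr (\<mu> * r)"
        using C(1) by (simp add: powr_mult powr_powr)
      finally show ?thesis by (simp add: distrib_right add_increasing2)
    next
      case False
      have "Y (x, k) powr r \<le> (c * (1 + norm k) powr \<mu>) powr r"
        using False \<open>c > 0\<close> lower by (intro powr_mono2') (auto simp: add_nonneg_eq_0_iff)
      also have "\<dots> = c powr r * (1 + norm k) powr (\<mu> * r)"
        using \<open>c > 0\<close> by (simp add: powr_mult powr_powr)
      finally show ?thesis by (simp add: distrib_right add_increasing)
    qed
    then show ?thesis by (intro exI[of _ "(C + 1) powr r + c powr r"]) auto
  qed
  interpret symbol_class_coinduct v1 v2 T
  proof
    fix m s p assume "T m s"
    then obtain r t where t: "t \<in> S (m - \<mu> * r)" and s: "s = (\<lambda>q. t q * complex_of_real (Y q powr r))"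
      unfolding T_def by blast
    have pdiff: "(\<lambda>q. complex_of_real (Y q powr r)) differentiable (at p)" for p
      using Yder unfolding differentiable_def by blast
    show "s differentiable (at p)"
      unfolding s using symbol_class_diff[OF t] pdiff by (rule differentiable_mult)
    have "complex_of_real (Y (x + l, k)) = complex_of_real (Y (x, k))" if "l \<in> L" for x l k
      using symbol_class_periodic[OF Y that] .
    then show "s (x + l, k) = s (x, k)" if "l \<in> L" for x l k
      unfolding s using symbol_class_periodic[OF t that] that by simp
    obtain C where C: "C \<ge> 0" "\<And>x k. norm (t (x, k)) \<le> C * (1 + norm k) powr (m - \<mu> * r)"
      using symbol_class_bound[OF t] by blast
    obtain D where D: "D \<ge> 0" "\<forall>x k. Y (x, k) powr r \<le> D * (1 + norm k) powr (\<mu> * r)"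
      using Ybound by blast
    show "\<exists>C. \<forall>x k. norm (s (x, k)) \<le> C * (1 + norm k) powr m"
    proof (intro exI[of _ "C * D"] allI)
      fix x and k :: "real^2"
      have "norm (s (x, k)) = norm (t (x, k)) * Y (x, k) powr r"
        by (simp add: s norm_mult)
      also have "\<dots> \<le> (C * (1 + norm k) powr (m - \<mu> * r)) * (D * (1 + norm k) powr (\<mu> * r))"
        using C D by (intro mult_mono) auto
      also have "\<dots> = C * D * (1 + norm k) powr m"
        by (simp add: powr_add[symmetric] mult_ac)
      finally show "norm (s (x, k)) \<le> C * D * (1 + norm k) powr m" .
    qed
    fix b :: "phase" assume b: "b \<in> Basis"
    show "\<exists>u w. T (m - order_drop b) u \<and> T (m - order_drop b) w \<and> (\<forall>q. dderiv b s q = u q + w q)"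
    proof (intro exI conjI allI)
      show "T (m - order_drop b) (\<lambda>q. dderiv b t q * complex_of_real (Y q powr r))"
        unfolding T_def using symbol_class_dderiv[OF t b]
        by (intro exI[of _ r] exI[of _ "dderiv b t"]) (simp add: algebra_simps)
      show "T (m - order_drop b) (\<lambda>q. (complex_of_real r * t q * dderiv b (\<lambda>q. complex_of_real (Y q)) q)
          * complex_of_real (Y q powr (r - 1)))"
        unfolding T_def
        by (intro exI[of _ "r - 1"] exI conjI, rule symbol_class_mult[OF symbol_cmult[OF t] symbol_class_dderiv[OF Y b]])
          (simp_all add: algebra_simps)
      show "dderiv b s q = dderiv b t q * complex_of_real (Y q powr r) +
          (complex_of_real r * t q * dderiv b (\<lambda>q. complex_of_real (Y q)) q)
          * complex_of_real (Y q powr (r - 1))" for q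
        unfolding s dY
        by (subst dderiv_mult[OF symbol_class_diff[OF t] pdiff])
          (simp add: dderiv_eq[OF Yder])
    qed
  qed
  show ?thesis
  proof (rule symbol_class)
    show "T (\<mu> * r) (\<lambda>q. complex_of_real (Y q powr r))"
      unfolding T_def
      by (intro exI[of _ r] exI[of _ "\<lambda>q. 1"]) (simp add: symbol_const)
  qed
qed

end


section \<open>Cut-off functions\<close>

text \<open>\<open>flat 0\<close> is the classical smooth function \<open>exp (- 1 / t)\<close>; the
  powers of \<open>1 / t\<close> make the family closed under differentiation up to linear
  combinations.\<close>

definition flat :: "nat \<Rightarrow> real \<Rightarrow> real" where
  "flat n t = (if t > 0 then (1 / t) ^ n * exp (- (1 / t)) else 0)"

text \<open>A single term of the exponential series is at most the whole.\<close>

lemma power_mult_exp_minus_le: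
  fixes x :: real
  assumes "0 \<le> x"
  shows "x ^ n * exp (- x) \<le> fact n"
proof -
  have "x ^ n / fact n \<le> exp x"
    using sum_le_suminf[OF summable_exp_generic[of x], of "{n}"] assms
    by (simp add: exp_def divide_inverse mult.commute)
  then show ?thesis by (simp add: exp_minus field_simps)
qed

lemma flat_nonneg: "0 \<le> flat n t"
  by (simp add: flat_def)

lemma flat_le: "flat n t \<le> fact n"
  using power_mult_exp_minus_le[of "1 / t" n] by (auto simp: flat_def)

lemma flat_le_square: "flat n t \<le> fact (n + 2) * t\<^sup>2"
proof (cases "t > 0")
  case True
  have "flat n t = ((1 / t) ^ (n + 2) * exp (- (1 / t))) * t\<^sup>2"
    using True by (simp add: flat_def power2_eq_square)
  also have "\<dots> \<le> fact (n + 2) * t\<^sup>2"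
    using True by (intro mult_right_mono power_mult_exp_minus_le) auto
  finally show ?thesis .
qed (simp add: flat_def)

text \<open>Away from 0 this is calculus on a half-line. At 0 the quadratic bound
  \<open>flat_le_square\<close> forces the difference quotient to 0.\<close>

lemma DERIV_flat: "(flat n has_real_derivative (flat (n + 2) t - real n * flat (n + 1) t)) (at t)"
proof -
  consider "t > 0" | "t = 0" | "t < 0" by linarith
  then show ?thesis
  proof cases
    case 1
    have "((\<lambda>t. (1 / t) ^ n * exp (- (1 / t))) has_real_derivative
        (flat (n + 2) t - real n * flat (n + 1) t)) (at t)"
      using 1 by (auto intro!: derivative_eq_intros simp: flat_def field_simps power2_eq_square)
        (cases n; simp add: field_simps)+
    then show ?thesis
      by (rule has_field_derivative_transform_within_open[where S = "{0<..}"])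
        (use 1 in \<open>auto simp: flat_def\<close>)
  next
    case 2
    have "((\<lambda>h. flat n h / h) \<longlongrightarrow> 0) (at 0)"
    proof (rule Lim_null_comparison)
      show "\<forall>\<^sub>F h in at 0. norm (flat n h / h) \<le> fact (n + 2) * \<bar>h\<bar>"
      proof (intro always_eventually allI)
        fix h :: real
        have "norm (flat n h / h) = flat n h / \<bar>h\<bar>" using flat_nonneg by simp
        also have "\<dots> \<le> fact (n + 2) * h\<^sup>2 / \<bar>h\<bar>"
          by (intro divide_right_mono flat_le_square) auto
        also have "\<dots> = fact (n + 2) * \<bar>h\<bar>"
          by (simp add: power2_eq_square abs_if)
        finally show "norm (flat n h / h) \<le> fact (n + 2) * \<bar>h\<bar>" .
      qed
      have "((\<lambda>h. fact (n + 2) * \<bar>h\<bar>) \<longlongrightarrow> fact (n + 2) * \<bar>0\<bar>) (at (0::real))"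
        by (intro tendsto_intros)
      then show "((\<lambda>h. fact (n + 2) * \<bar>h\<bar>) \<longlongrightarrow> (0::real)) (at 0)" by simp
    qed
    then show ?thesis
      unfolding has_field_derivative_iff using 2 by (simp add: flat_def)
  next
    case 3
    have "((\<lambda>t. 0) has_real_derivative (flat (n + 2) t - real n * flat (n + 1) t)) (at t)"
      using 3 by (simp add: flat_def)
    then show ?thesis
      by (rule has_field_derivative_transform_within_open[where S = "{..<0}"])
        (use 3 in \<open>auto simp: flat_def\<close>)
  qed
qed

text \<open>The squared norm keeps the function smooth at \<open>k = 0\<close>. It vanishes where
  \<open>\<epsilon> |k|\<close> is at least 1 but has no plateau; its value at \<open>k = 0\<close>
  is \<open>flat n 1\<close>, whence the normalisation by \<open>flat 0 1\<close> below.\<close>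

definition flat_ball :: "nat \<Rightarrow> real \<Rightarrow> phase \<Rightarrow> real" where
  "flat_ball n \<epsilon> q = flat n (1 - \<epsilon>\<^sup>2 * (norm (snd q))\<^sup>2)"

lemma flat_ball_has_derivative:
  "(flat_ball n \<epsilon> has_derivative
     (\<lambda>b. (flat_ball (n + 2) \<epsilon> p - real n * flat_ball (n + 1) \<epsilon> p) *
            (- (2 * \<epsilon>\<^sup>2) * (snd p \<bullet> snd b)))) (at p)"
proof -
  have 1: "((\<lambda>q::phase. 1 - \<epsilon>\<^sup>2 * (norm (snd q))\<^sup>2) has_derivative
      (\<lambda>b. - (2 * \<epsilon>\<^sup>2) * (snd p \<bullet> snd b))) (at p)"
    unfolding power2_norm_eq_inner
    by (auto intro!: derivative_eq_intros simp: inner_commute)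
  have 2: "(flat n has_derivative (\<lambda>h. (flat_ball (n + 2) \<epsilon> p - real n * flat_ball (n + 1) \<epsilon> p) * h))
      (at (1 - \<epsilon>\<^sup>2 * (norm (snd p))\<^sup>2))"
    using DERIV_flat unfolding has_field_derivative_def flat_ball_def .
  show ?thesis
    using has_derivative_compose[OF 1 2] by (simp add: flat_ball_def[abs_def])
qed

lemma flat_ball_nonneg: "0 \<le> flat_ball n \<epsilon> q"
  and flat_ball_le: "flat_ball n \<epsilon> q \<le> fact n"
  and flat_ball_support: "0 \<le> \<epsilon> \<Longrightarrow> 1 \<le> \<epsilon> * norm k \<Longrightarrow> flat_ball n \<epsilon> (x, k) = 0"
proof -
  show "0 \<le> flat_ball n \<epsilon> q" "flat_ball n \<epsilon> q \<le> fact n"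
    by (simp_all add: flat_ball_def flat_nonneg flat_le)
  assume "0 \<le> \<epsilon>" "1 \<le> \<epsilon> * norm k"
  then have "1 \<le> (\<epsilon> * norm k)\<^sup>2" by simp
  then show "flat_ball n \<epsilon> (x, k) = 0"
    by (simp add: flat_ball_def flat_def power_mult_distrib)
qed

text \<open>The substitute for a plateau: the normalised complement vanishes at \<open>k = 0\<close>
  and is Lipschitz in \<open>\<epsilon> |k|\<close>, so a factor \<open>\<epsilon>\<close> is bought
  with one factor \<open>|k|\<close>.\<close>

lemma flat_ball_zero_near: "\<exists>C\<ge>0. \<forall>\<epsilon> x k. 0 \<le> \<epsilon> \<longrightarrow> \<bar>1 - flat_ball 0 \<epsilon> (x, k) / flat 0 1\<bar> \<le> C * (\<epsilon> * norm k)"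
proof -
  have f1: "flat 0 1 > 0" by (simp add: flat_def)
  \<comment> \<open>The derivative of \<open>flat 0\<close> is \<open>flat 2\<close>, bounded by
    \<open>fact 2 = 2\<close>.\<close>
  have lip: "\<bar>flat 0 1 - flat 0 t\<bar> \<le> 2 * \<bar>1 - t\<bar>" for t
  proof -
    have "norm (flat 0 1 - flat 0 t) \<le> 2 * norm (1 - t)"
    proof (rule field_differentiable_bound[of UNIV])
      show "(flat 0 has_field_derivative flat 2 z) (at z within UNIV)" for z
        using DERIV_flat[of 0 z] by (simp add: numeral_2_eq_2)
      show "norm (flat 2 z) \<le> 2" for z
        using flat_le[of 2 z] flat_nonneg[of 2 z] by simp
    qed auto
    then show ?thesis by simp
  qed
  have le1: "\<bar>flat 0 1 - flat 0 t\<bar> \<le> 2" for t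
    using flat_le[of 0 1] flat_le[of 0 t] flat_nonneg[of 0 1] flat_nonneg[of 0 t] by simp
  have "\<bar>1 - flat_ball 0 \<epsilon> (x, k) / flat 0 1\<bar> \<le> (2 / flat 0 1) * (\<epsilon> * norm k)"
    if \<epsilon>: "0 \<le> \<epsilon>" for \<epsilon> and x k :: "real^2"
  proof -
    define r where "r = \<epsilon> * norm k"
    have r0: "r \<ge> 0" using \<epsilon> by (simp add: r_def)
    have "\<bar>flat 0 1 - flat 0 (1 - r\<^sup>2)\<bar> \<le> 2 * r"
    proof (cases "r \<le> 1")
      case True
      then have "r\<^sup>2 \<le> r" using r0 by (simp add: power2_eq_square mult_left_le)
      then show ?thesis using lip[of "1 - r\<^sup>2"] by simp
    next
      case False
      then show ?thesis using le1[of "1 - r\<^sup>2"] by simp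
    qed
    then have "\<bar>flat 0 1 - flat 0 (1 - r\<^sup>2)\<bar> / flat 0 1 \<le> 2 * r / flat 0 1"
      using f1 by (intro divide_right_mono) auto
    moreover have "1 - flat_ball 0 \<epsilon> (x, k) / flat 0 1 = (flat 0 1 - flat 0 (1 - r\<^sup>2)) / flat 0 1"
      using f1 by (simp add: flat_ball_def r_def power_mult_distrib field_simps)
    ultimately show ?thesis using f1 by (simp add: r_def)
  qed
  then show ?thesis using f1 by (intro exI[of _ "2 / flat 0 1"]) auto
qed

lemma one_plus_powr_mono:
  "m \<le> m' \<Longrightarrow> (1 + norm k) powr m \<le> (1 + norm k) powr m'"
  by (rule powr_mono) auto

lemma symbol_family_member:
  assumes g: "symbol_family v1 v2 I W m g" and i: "i \<in> I"
  shows "g i \<in> symbol_class v1 v2 m"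
  unfolding symbol_class_def
proof (intro CollectI conjI allI ballI)
  fix b1 b2 a1 a2
  obtain C where "\<forall>i\<in>I. \<forall>x k. norm (sym_deriv b1 b2 a1 a2 (g i) (x, k))
      \<le> C * W i * (1 + norm k) powr (m - real (a1 + a2))"
    using g unfolding symbol_family_def by blast
  then show "\<exists>C. \<forall>x k. norm (sym_deriv b1 b2 a1 a2 (g i) (x, k))
      \<le> C * (1 + norm k) powr (m - real (a1 + a2))"
    using i by (intro exI[of _ "C * W i"]) auto
qed (use symbol_family_smooth[OF g i] symbol_family_periodic[OF g i] in auto)

context torus
begin

text \<open>Multiplication by \<open>\<epsilon> ^ p\<close> times a function supported in \<open>\<epsilon> \<bar>k\<bar> \<le> 1\<close> lowers the order by \<open>p\<close>,
  uniformly in \<open>\<epsilon>\<close>.\<close>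

definition cutoff_term :: "real \<Rightarrow> (real \<Rightarrow> phase \<Rightarrow> complex) \<Rightarrow> bool" where
  "cutoff_term m g \<longleftrightarrow> (\<exists>n p m' t. t \<in> S m' \<and> m' - real p \<le> m \<and>
     g = (\<lambda>\<epsilon> q. complex_of_real (\<epsilon> ^ Suc p * flat_ball n \<epsilon> q) * t q))"

text \<open>The order bound \<open>m' + 1 \<le> m\<close> pays for the factor \<open>|k|\<close> in
  \<open>flat_ball_zero_near\<close>.\<close>

definition complement_term :: "real \<Rightarrow> (real \<Rightarrow> phase \<Rightarrow> complex) \<Rightarrow> bool" where
  "complement_term m g \<longleftrightarrow> (\<exists>m' t. t \<in> S m' \<and> m' + 1 \<le> m \<and>
     g = (\<lambda>\<epsilon> q. complex_of_real (1 - flat_ball 0 \<epsilon> q / flat 0 1) * t q))"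

text \<open>On the support \<open>\<epsilon> (1 + |k|) \<le> 2\<close>, so
  \<open>\<epsilon> ^ p\<close> is at most \<open>2 ^ p\<close> times \<open>(1 + |k|)\<close> to
  the power \<open>- p\<close>. The one factor left over from \<open>\<epsilon> ^ Suc p\<close> is
  the weight.\<close>

lemma cutoff_term_bound:
  assumes "cutoff_term m g"
  shows "\<exists>C. \<forall>\<epsilon>\<in>{0<..1}. \<forall>x k. norm (g \<epsilon> (x, k)) \<le> C * \<epsilon> * (1 + norm k) powr m"
proof -
  obtain n p m' t where t: "t \<in> S m'" and m: "m' - real p \<le> m"
    and g: "g = (\<lambda>\<epsilon> q. complex_of_real (\<epsilon> ^ Suc p * flat_ball n \<epsilon> q) * t q)"
    using assms unfolding cutoff_term_def by blast
  obtain C where C: "C \<ge> 0" "\<And>x k. norm (t (x, k)) \<le> C * (1 + norm k) powr m'"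
    using symbol_class_bound[OF t] by blast
  have "norm (g \<epsilon> (x, k)) \<le> (2 ^ p * fact n * C) * \<epsilon> * (1 + norm k) powr m"
    if \<epsilon>: "\<epsilon> \<in> {0<..1}" for \<epsilon> x and k :: "real^2"
  proof (cases "1 \<le> \<epsilon> * norm k")
    case True
    then have "g \<epsilon> (x, k) = 0" using \<epsilon> by (simp add: g flat_ball_support)
    then show ?thesis using \<epsilon> C(1) by simp
  next
    case False
    have "\<epsilon> * (1 + norm k) \<le> 2" using False \<epsilon> by (simp add: algebra_simps)
    then have "(\<epsilon> * (1 + norm k)) ^ p \<le> 2 ^ p" using \<epsilon> by (intro power_mono) auto
    then have "\<epsilon> ^ p * (1 + norm k) ^ p \<le> 2 ^ p" by (simp only: power_mult_distrib)
    then have "\<epsilon> ^ p \<le> 2 ^ p * (1 + norm k) powr (- real p)"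
      by (simp add: powr_minus powr_realpow add_pos_nonneg field_simps)
    then have "\<epsilon> ^ p * (C * (1 + norm k) powr m') \<le> 2 ^ p * (1 + norm k) powr (- real p) * (C * (1 + norm k) powr m')"
      using C(1) by (intro mult_right_mono) auto
    also have "\<dots> = 2 ^ p * C * (1 + norm k) powr (m' - real p)"
      by (simp add: powr_diff powr_minus divide_inverse)
    also have "\<dots> \<le> 2 ^ p * C * (1 + norm k) powr m"
      using C(1) m by (intro mult_left_mono one_plus_powr_mono) auto
    finally have 1: "\<epsilon> ^ p * (C * (1 + norm k) powr m') \<le> 2 ^ p * C * (1 + norm k) powr m" .
    have "norm (g \<epsilon> (x, k)) = \<epsilon> * flat_ball n \<epsilon> (x, k) * (\<epsilon> ^ p * norm (t (x, k)))"
      using \<epsilon> flat_ball_nonneg by (simp add: g norm_mult norm_power mult_ac)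
    also have "\<dots> \<le> \<epsilon> * fact n * (\<epsilon> ^ p * (C * (1 + norm k) powr m'))"
      using \<epsilon> C flat_ball_nonneg flat_ball_le by (intro mult_mono) auto
    also have "\<dots> \<le> \<epsilon> * fact n * (2 ^ p * C * (1 + norm k) powr m)"
      using \<epsilon> 1 by (intro mult_left_mono) auto
    finally show ?thesis by (simp add: mult_ac)
  qed
  then show ?thesis by blast
qed

lemma complement_term_bound:
  assumes "complement_term m g"
  shows "\<exists>C. \<forall>\<epsilon>\<in>{0<..1}. \<forall>x k. norm (g \<epsilon> (x, k)) \<le> C * \<epsilon> * (1 + norm k) powr m"
proof -
  obtain m' t where t: "t \<in> S m'" and m: "m' + 1 \<le> m"
    and g: "g = (\<lambda>\<epsilon> q. complex_of_real (1 - flat_ball 0 \<epsilon> q / flat 0 1) * t q)"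
    using assms unfolding complement_term_def by blast
  obtain C where C: "C \<ge> 0" "\<And>x k. norm (t (x, k)) \<le> C * (1 + norm k) powr m'"
    using symbol_class_bound[OF t] by blast
  obtain D where D: "D \<ge> 0"
    "\<And>\<epsilon> x k. 0 \<le> \<epsilon> \<Longrightarrow> \<bar>1 - flat_ball 0 \<epsilon> (x, k) / flat 0 1\<bar> \<le> D * (\<epsilon> * norm k)"
    using flat_ball_zero_near by blast
  have "norm (g \<epsilon> (x, k)) \<le> (C * D) * \<epsilon> * (1 + norm k) powr m"
    if \<epsilon>: "\<epsilon> \<in> {0<..1}" for \<epsilon> x and k :: "real^2"
  proof -
    have "D * (\<epsilon> * norm k) \<le> D * \<epsilon> * (1 + norm k) powr 1"
      using D(1) \<epsilon> by (simp add: mult.assoc mult_left_mono)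
    then have 1: "\<bar>1 - flat_ball 0 \<epsilon> (x, k) / flat 0 1\<bar> \<le> D * \<epsilon> * (1 + norm k) powr 1"
      using D(2)[of \<epsilon> x k] \<epsilon> by simp
    have "norm (g \<epsilon> (x, k)) = \<bar>1 - flat_ball 0 \<epsilon> (x, k) / flat 0 1\<bar> * norm (t (x, k))"
      unfolding g norm_mult norm_of_real by simp
    also have "\<dots> \<le> (D * \<epsilon> * (1 + norm k) powr 1) * (C * (1 + norm k) powr m')"
      using 1 C D(1) \<epsilon> by (intro mult_mono) auto
    also have "\<dots> = C * D * \<epsilon> * (1 + norm k) powr (m' + 1)"
      by (simp add: powr_add mult_ac)
    also have "\<dots> \<le> C * D * \<epsilon> * (1 + norm k) powr m"
      using C(1) D(1) \<epsilon> m by (intro mult_left_mono one_plus_powr_mono) auto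
    finally show ?thesis .
  qed
  then show ?thesis by blast
qed

text \<open>The affine form \<open>c + d * flat_ball\<close> covers both kinds of terms:
  \<open>c = 0\<close> with a power of \<open>\<epsilon>\<close> for the cut-off,
  \<open>c = 1\<close> with \<open>d = - 1 / flat 0 1\<close> for the complement. The symbol
  \<open>t'\<close> is \<open>- 2 (k . b) t\<close>, from the derivative of the squared
  norm.\<close>

lemma dderiv_flat_ball_mult:
  assumes t: "t \<in> S m'" and b: "b \<in> Basis"
  obtains t' where "t' \<in> S (m' + 1)" "snd b = 0 \<longrightarrow> t' = (\<lambda>q. 0)"
    "\<And>n \<epsilon> c d q. dderiv b (\<lambda>q. complex_of_real (c + d * flat_ball n \<epsilon> q) * t q) q =
        complex_of_real (c + d * flat_ball n \<epsilon> q) * dderiv b t q +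
        (complex_of_real (d * \<epsilon>\<^sup>2 * flat_ball (n + 2) \<epsilon> q) * t' q
         - of_nat n * (complex_of_real (d * \<epsilon>\<^sup>2 * flat_ball (n + 1) \<epsilon> q) * t' q))"
    "\<And>n \<epsilon> c d p. (\<lambda>q. complex_of_real (c + d * flat_ball n \<epsilon> q) * t q) differentiable (at p)"
proof -
  define t' where "t' q = -2 * (\<Sum>i\<in>UNIV. complex_of_real (snd b $ i) * (complex_of_real (snd q $ i) * t q))" for q
  have t': "t' \<in> S (m' + 1)"
    unfolding t'_def
    by (intro symbol_cmult symbol_class_sum symbol_class_mult[OF symbol_coordinate t]) simp
  have inner: "t' q = -2 * complex_of_real (snd q \<bullet> snd b) * t q" for q
    by (simp add: t'_def inner_vec_def sum_distrib_right sum_distrib_left mult_ac)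
  have der: "((\<lambda>q. complex_of_real (c + d * flat_ball n \<epsilon> q)) has_derivative
     (\<lambda>b. complex_of_real (0 + d * ((flat_ball (n + 2) \<epsilon> p - real n * flat_ball (n + 1) \<epsilon> p) *
            (- (2 * \<epsilon>\<^sup>2) * (snd p \<bullet> snd b)))))) (at p)" for n \<epsilon> c d p
    by (intro has_derivative_of_real has_derivative_add has_derivative_const has_derivative_mult_right
        flat_ball_has_derivative)
  have diff: "(\<lambda>q. complex_of_real (c + d * flat_ball n \<epsilon> q)) differentiable (at p)" for n \<epsilon> c d p
    using der unfolding differentiable_def by blast
  show ?thesis
  proof (rule that[OF t'])
    show "snd b = 0 \<longrightarrow> t' = (\<lambda>q. 0)" by (auto simp: inner)
    show "(\<lambda>q. complex_of_real (c + d * flat_ball n \<epsilon> q) * t q) differentiable (at p)" for n \<epsilon> c d p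
      by (rule differentiable_mult[OF diff symbol_class_diff[OF t]])
    show "dderiv b (\<lambda>q. complex_of_real (c + d * flat_ball n \<epsilon> q) * t q) q =
        complex_of_real (c + d * flat_ball n \<epsilon> q) * dderiv b t q +
        (complex_of_real (d * \<epsilon>\<^sup>2 * flat_ball (n + 2) \<epsilon> q) * t' q
         - of_nat n * (complex_of_real (d * \<epsilon>\<^sup>2 * flat_ball (n + 1) \<epsilon> q) * t' q))" for n \<epsilon> c d q
      by (subst dderiv_mult[OF diff symbol_class_diff[OF t]], subst dderiv_eq[OF der])
        (simp add: inner algebra_simps)
  qed
qed

text \<open>Both kinds are treated together because differentiating a complement term produces a
  cut-off term.\<close>

lemma complement_family:
  shows "complement_term m g \<Longrightarrow> symbol_family v1 v2 {0<..1} (\<lambda>\<epsilon>. \<epsilon>) m g"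
    and "cutoff_term m g \<Longrightarrow> symbol_family v1 v2 {0<..1} (\<lambda>\<epsilon>. \<epsilon>) m g"
proof -
  define T where "T m g \<longleftrightarrow> cutoff_term m g \<or> complement_term m g" for m g
  have form: "\<exists>n c d m' t. t \<in> S m' \<and> g = (\<lambda>\<epsilon> q. complex_of_real (c \<epsilon> + d \<epsilon> * flat_ball n \<epsilon> q) * t q)"
    if "T m g" for m g
    using that unfolding T_def cutoff_term_def complement_term_def
  proof (elim disjE exE conjE)
    fix n p m' t assume "t \<in> S m'" "g = (\<lambda>\<epsilon> q. complex_of_real (\<epsilon> ^ Suc p * flat_ball n \<epsilon> q) * t q)"
    then show ?thesis
      by (intro exI[of _ n] exI[of _ "\<lambda>\<epsilon>. 0"] exI[of _ "\<lambda>\<epsilon>. \<epsilon> ^ Suc p"] exI[of _ m'] exI[of _ t]) simp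
  next
    fix m' t assume "t \<in> S m'" "g = (\<lambda>\<epsilon> q. complex_of_real (1 - flat_ball 0 \<epsilon> q / flat 0 1) * t q)"
    then show ?thesis
      by (intro exI[of _ 0] exI[of _ "\<lambda>\<epsilon>. 1"] exI[of _ "\<lambda>\<epsilon>. - 1 / flat 0 1"] exI[of _ m'] exI[of _ t]) simp
  qed
  interpret symbol_family_coinduct v1 v2 "{0<..1}" "\<lambda>\<epsilon>. \<epsilon>" T
  proof
    fix m g \<epsilon> p assume T: "T m g"
    obtain n c d m' t where t: "t \<in> S m'"
      and g: "g = (\<lambda>\<epsilon> q. complex_of_real (c \<epsilon> + d \<epsilon> * flat_ball n \<epsilon> q) * t q)"
      using form[OF T] by blast
    show "g \<epsilon> differentiable (at p)"
      unfolding g by (rule dderiv_flat_ball_mult[OF t]) (auto simp: Basis_phase_space)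
    show "g \<epsilon> (x + l, k) = g \<epsilon> (x, k)" if "l \<in> L" for x l k
      unfolding g using symbol_class_periodic[OF t that] by (simp add: flat_ball_def)
  next
    fix m g assume "T m g"
    then show "\<exists>C. \<forall>\<epsilon>\<in>{0<..1}. \<forall>x k. norm (g \<epsilon> (x, k)) \<le> C * \<epsilon> * (1 + norm k) powr m"
      using cutoff_term_bound complement_term_bound unfolding T_def by blast
  next
    fix m g and b :: "phase" assume "T m g" and b: "b \<in> Basis"
    then consider (cut) n p m' t where "t \<in> S m'" "m' - real p \<le> m"
        "g = (\<lambda>\<epsilon> q. complex_of_real (\<epsilon> ^ Suc p * flat_ball n \<epsilon> q) * t q)"
      | (compl) m' t where "t \<in> S m'" "m' + 1 \<le> m"
        "g = (\<lambda>\<epsilon> q. complex_of_real (1 - flat_ball 0 \<epsilon> q / flat 0 1) * t q)"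
      unfolding T_def cutoff_term_def complement_term_def by (elim disjE exE conjE) 
    then show "family_span {0<..1} T (m - order_drop b) (\<lambda>\<epsilon>. dderiv b (g \<epsilon>))"
    proof cases
      case cut
      obtain t' where t': "t' \<in> S (m' + 1)" "snd b = 0 \<longrightarrow> t' = (\<lambda>q. 0)"
        and eq: "\<And>n \<epsilon> c d q. dderiv b (\<lambda>q. complex_of_real (c + d * flat_ball n \<epsilon> q) * t q) q =
        complex_of_real (c + d * flat_ball n \<epsilon> q) * dderiv b t q +
        (complex_of_real (d * \<epsilon>\<^sup>2 * flat_ball (n + 2) \<epsilon> q) * t' q
         - of_nat n * (complex_of_real (d * \<epsilon>\<^sup>2 * flat_ball (n + 1) \<epsilon> q) * t' q))"
        by (rule dderiv_flat_ball_mult[OF cut(1) b]) blast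
      have 1: "T (m - order_drop b) (\<lambda>\<epsilon> q. complex_of_real (\<epsilon> ^ Suc p * flat_ball n \<epsilon> q) * dderiv b t q)"
        unfolding T_def cutoff_term_def
        using symbol_class_dderiv[OF cut(1) b] cut(2)
        by (intro disjI1 exI[of _ n] exI[of _ p] exI[of _ "m' - order_drop b"] exI[of _ "dderiv b t"]) auto
      \<comment> \<open>The factor \<open>\<epsilon>^2\<close> raises \<open>p\<close> by 2 while
        \<open>t'\<close> has one order more than \<open>t\<close>: a net gain of one order, enough
        for either kind of direction.\<close>
      have 2: "T (m - order_drop b) (\<lambda>\<epsilon> q. complex_of_real (\<epsilon> ^ Suc (p + 2) * flat_ball j \<epsilon> q) * t' q)" for j
        unfolding T_def cutoff_term_def
        using t'(1) cut(2)
        by (intro disjI1 exI[of _ j] exI[of _ "p + 2"] exI[of _ "m' + 1"] exI[of _ t']) (auto simp: order_drop_def)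
      show ?thesis
      proof (rule family_span.cong)
        show "family_span {0<..1} T (m - order_drop b) (\<lambda>\<epsilon> q.
            complex_of_real (\<epsilon> ^ Suc p * flat_ball n \<epsilon> q) * dderiv b t q +
            (complex_of_real (\<epsilon> ^ Suc (p + 2) * flat_ball (n + 2) \<epsilon> q) * t' q
             + (- real n) *\<^sub>R (complex_of_real (\<epsilon> ^ Suc (p + 2) * flat_ball (n + 1) \<epsilon> q) * t' q)))"
          by (intro family_span.add family_span.scale family_span.base 1 2)
        show "dderiv b (g \<epsilon>) q = complex_of_real (\<epsilon> ^ Suc p * flat_ball n \<epsilon> q) * dderiv b t q +
            (complex_of_real (\<epsilon> ^ Suc (p + 2) * flat_ball (n + 2) \<epsilon> q) * t' q
             + (- real n) *\<^sub>R (complex_of_real (\<epsilon> ^ Suc (p + 2) * flat_ball (n + 1) \<epsilon> q) * t' q))" for \<epsilon> q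
          using eq[of 0 "\<epsilon> ^ Suc p" n \<epsilon> q]
          by (simp add: cut(3) scaleR_conv_of_real power_add power2_eq_square mult_ac)
      qed
    next
      case compl
      obtain t' where t': "t' \<in> S (m' + 1)" "snd b = 0 \<longrightarrow> t' = (\<lambda>q. 0)"
        and eq: "\<And>n \<epsilon> c d q. dderiv b (\<lambda>q. complex_of_real (c + d * flat_ball n \<epsilon> q) * t q) q =
        complex_of_real (c + d * flat_ball n \<epsilon> q) * dderiv b t q +
        (complex_of_real (d * \<epsilon>\<^sup>2 * flat_ball (n + 2) \<epsilon> q) * t' q
         - of_nat n * (complex_of_real (d * \<epsilon>\<^sup>2 * flat_ball (n + 1) \<epsilon> q) * t' q))"
        by (rule dderiv_flat_ball_mult[OF compl(1) b]) blast
      have 1: "T (m - order_drop b) (\<lambda>\<epsilon> q. complex_of_real (1 - flat_ball 0 \<epsilon> q / flat 0 1) * dderiv b t q)"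
        unfolding T_def complement_term_def
        using symbol_class_dderiv[OF compl(1) b] compl(2)
        by (intro disjI2 exI[of _ "m' - order_drop b"] exI[of _ "dderiv b t"]) auto
      \<comment> \<open>Of \<open>\<epsilon>^2\<close> one factor is the weight, so
        \<open>p = 1\<close>; this offsets the extra order of \<open>t'\<close> and leaves order
        \<open>m'\<close>, at most \<open>m - 1\<close>.\<close>
      have 2: "T (m - order_drop b) (\<lambda>\<epsilon> q. complex_of_real (\<epsilon> ^ Suc 1 * flat_ball 2 \<epsilon> q) * t' q)"
        unfolding T_def cutoff_term_def
        using t'(1) compl(2)
        by (intro disjI1 exI[of _ 2] exI[of _ 1] exI[of _ "m' + 1"] exI[of _ t']) (auto simp: order_drop_def)
      show ?thesis
      proof (rule family_span.cong)
        show "family_span {0<..1} T (m - order_drop b) (\<lambda>\<epsilon> q.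
            complex_of_real (1 - flat_ball 0 \<epsilon> q / flat 0 1) * dderiv b t q +
            (- 1 / flat 0 1) *\<^sub>R (complex_of_real (\<epsilon> ^ Suc 1 * flat_ball 2 \<epsilon> q) * t' q))"
          by (intro family_span.add family_span.scale family_span.base 1 2)
        show "dderiv b (g \<epsilon>) q = complex_of_real (1 - flat_ball 0 \<epsilon> q / flat 0 1) * dderiv b t q +
            (- 1 / flat 0 1) *\<^sub>R (complex_of_real (\<epsilon> ^ Suc 1 * flat_ball 2 \<epsilon> q) * t' q)" for \<epsilon> q
          using eq[of 1 "- 1 / flat 0 1" 0 \<epsilon> q]
          by (simp add: compl(3) scaleR_conv_of_real power2_eq_square numeral_2_eq_2 mult_ac)
      qed
    qed
  qed
  show "complement_term m g \<Longrightarrow> symbol_family v1 v2 {0<..1} (\<lambda>\<epsilon>. \<epsilon>) m g"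
    "cutoff_term m g \<Longrightarrow> symbol_family v1 v2 {0<..1} (\<lambda>\<epsilon>. \<epsilon>) m g"
    by (rule symbol_family; simp add: T_def)+
qed

text \<open>For fixed \<open>\<epsilon>\<close> the powers of \<open>\<epsilon>\<close> are
  constants, so \<open>p\<close> may be taken as large as any target order requires: a symbol of
  bounded support in \<open>k\<close> is smoothing.\<close>

lemma symbol_cutoff:
  assumes t: "t \<in> S m'" and \<epsilon>: "\<epsilon> \<in> {0<..1}"
  shows "(\<lambda>q. complex_of_real (flat_ball n \<epsilon> q) * t q) \<in> S m"
proof -
  obtain p :: nat where p: "m' - real p \<le> m"
    using real_arch_simple[of "m' - m"] by (auto simp: algebra_simps)
  have "cutoff_term m (\<lambda>\<epsilon> q. complex_of_real (\<epsilon> ^ Suc p * flat_ball n \<epsilon> q) * t q)"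
    unfolding cutoff_term_def using t p by blast
  from symbol_family_member[OF complement_family(2)[OF this] \<epsilon>]
  have "(\<lambda>q. complex_of_real (1 / \<epsilon> ^ Suc p) *
      (complex_of_real (\<epsilon> ^ Suc p * flat_ball n \<epsilon> q) * t q)) \<in> S m"
    by (rule symbol_cmult)
  moreover have "complex_of_real (1 / \<epsilon> ^ Suc p) * (complex_of_real (\<epsilon> ^ Suc p * flat_ball n \<epsilon> q) * t q) =
      complex_of_real (flat_ball n \<epsilon> q) * t q" for q
    using \<epsilon> by simp
  ultimately show ?thesis by simp
qed

end


section \<open>Asymptotic summation\<close>

context torus
begin

text \<open>Borel summation: each \<open>D j\<close> is multiplied by a complement at scale
  \<open>\<epsilon> j\<close>, chosen so small that the series converges in every symbol seminorm.
  The multiplication changes \<open>D j\<close> only by a smoothing symbol.\<close>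

theorem asymptotic_sum:
  fixes D :: "nat \<Rightarrow> phase \<Rightarrow> complex"
  assumes D: "\<And>j. D j \<in> S (\<mu> - real j)"
  shows "\<exists>s\<in>S \<mu>. \<forall>J. (\<lambda>q. s q - (\<Sum>j<J. D j q)) \<in> S (\<mu> - real J)"
proof -
  define G where "G j \<epsilon> q = complex_of_real (1 - flat_ball 0 \<epsilon> q / flat 0 1) * D j q" for j \<epsilon> q
  have G: "symbol_family v1 v2 {0<..1} (\<lambda>\<epsilon>. \<epsilon>) (\<mu> - real j + 1) (G j)" for j
    by (rule complement_family(1)) (use D in \<open>auto simp: complement_term_def G_def[abs_def]\<close>)
  \<comment> \<open>Only derivative counts up to \<open>j\<close> are controlled at stage
    \<open>j\<close>, so finitely many constants decide \<open>\<epsilon>\<close>. The order is one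
    too high, the price of smallness.\<close>
  have "\<exists>\<epsilon>\<in>{0<..1}. \<forall>b1\<le>j. \<forall>b2\<le>j. \<forall>a1\<le>j. \<forall>a2\<le>j. \<forall>x k.
      norm (sym_deriv b1 b2 a1 a2 (G j \<epsilon>) (x, k)) \<le> (1/2) ^ j * (1 + norm k) powr (\<mu> - real j + 1 - real (a1 + a2))"
    for j
  proof -
    define K where "K = {..j} \<times> {..j} \<times> {..j} \<times> {..j}"
    have "\<forall>\<beta>\<in>K. \<exists>C. case \<beta> of (b1, b2, a1, a2) \<Rightarrow> \<forall>\<epsilon>\<in>{0<..1}. \<forall>x k.
        norm (sym_deriv b1 b2 a1 a2 (G j \<epsilon>) (x, k)) \<le> C * \<epsilon> * (1 + norm k) powr (\<mu> - real j + 1 - real (a1 + a2))"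
      using G[of j] unfolding symbol_family_def by auto
    then obtain C where C: "\<And>b1 b2 a1 a2 \<epsilon> x k. (b1, b2, a1, a2) \<in> K \<Longrightarrow> \<epsilon> \<in> {0<..1} \<Longrightarrow>
        norm (sym_deriv b1 b2 a1 a2 (G j \<epsilon>) (x, k)) \<le>
        C (b1, b2, a1, a2) * \<epsilon> * (1 + norm k) powr (\<mu> - real j + 1 - real (a1 + a2))"
      by (metis (mono_tags, lifting) case_prod_conv)
    define B where "B = 1 + (\<Sum>\<beta>\<in>K. \<bar>C \<beta>\<bar>)"
    have fin: "finite K" unfolding K_def by simp
    have B: "C \<beta> \<le> B" "B \<ge> 1" if "\<beta> \<in> K" for \<beta>
      using member_le_sum[OF that, of "\<lambda>\<beta>. \<bar>C \<beta>\<bar>"] fin unfolding B_def by (auto intro: sum_nonneg)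
    have B1: "B \<ge> 1" unfolding B_def by (simp add: sum_nonneg)
    define \<epsilon> where "\<epsilon> = (1/2) ^ j / B"
    have pw: "(1/2::real) ^ j \<le> 1" by (rule power_le_one) auto
    have \<epsilon>: "\<epsilon> \<in> {0<..1}" "B * \<epsilon> = (1/2) ^ j"
      using B1 pw by (auto simp: \<epsilon>_def divide_le_eq)
    have "norm (sym_deriv b1 b2 a1 a2 (G j \<epsilon>) (x, k)) \<le> (1/2) ^ j * (1 + norm k) powr (\<mu> - real j + 1 - real (a1 + a2))"
      if "(b1, b2, a1, a2) \<in> K" for b1 b2 a1 a2 x k
    proof -
      have "norm (sym_deriv b1 b2 a1 a2 (G j \<epsilon>) (x, k)) \<le>
        C (b1, b2, a1, a2) * \<epsilon> * (1 + norm k) powr (\<mu> - real j + 1 - real (a1 + a2))"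
        by (rule C[OF that \<epsilon>(1)])
      also have "\<dots> \<le> B * \<epsilon> * (1 + norm k) powr (\<mu> - real j + 1 - real (a1 + a2))"
        using B(1)[OF that] \<epsilon>(1) by (intro mult_right_mono) auto
      finally show ?thesis using \<epsilon>(2) by simp
    qed
    then show ?thesis using \<epsilon>(1) unfolding K_def by blast
  qed
  then obtain \<epsilon> where \<epsilon>: "\<And>j. \<epsilon> j \<in> {0<..1}"
    and est: "\<And>j b1 b2 a1 a2 x k. b1 \<le> j \<Longrightarrow> b2 \<le> j \<Longrightarrow> a1 \<le> j \<Longrightarrow> a2 \<le> j \<Longrightarrow>
      norm (sym_deriv b1 b2 a1 a2 (G j (\<epsilon> j)) (x, k)) \<le> (1/2) ^ j * (1 + norm k) powr (\<mu> - real j + 1 - real (a1 + a2))"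
    by metis
  define E where "E j = G j (\<epsilon> j)" for j
  \<comment> \<open>The difference is a multiple of the cut-off times \<open>D j\<close>, hence
    smoothing; this returns the lost order to each single term.\<close>
  have ED: "(\<lambda>q. E j q - D j q) \<in> S m" for j m
  proof -
    have "(\<lambda>q. complex_of_real (- 1 / flat 0 1) * (complex_of_real (flat_ball 0 (\<epsilon> j) q) * D j q)) \<in> S m"
      by (rule symbol_cmult[OF symbol_cutoff[OF D \<epsilon>]])
    then show ?thesis by (simp add: E_def G_def algebra_simps)
  qed
  have E1: "E j \<in> S (\<mu> - real j + 1)" for j
    unfolding E_def by (rule symbol_family_member[OF G \<epsilon>])
  have E: "E j \<in> S (\<mu> - real j)" for j
    using symbol_class_add[OF ED[of j] D[of j]] by simp
  have tail: "symbol_family v1 v2 {J..} (\<lambda>j. (1/2) ^ j) (\<mu> - real J + 1) E" for J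
    unfolding symbol_family_def
  proof (intro conjI ballI allI)
    show "smooth_on UNIV (E j)" for j by (rule symbol_class_smooth[OF E])
    show "E j (x + l, k) = E j (x, k)" if "l \<in> L" for j x k l
      by (rule symbol_class_periodic[OF E that])
    fix b1 b2 a1 a2 :: nat
    \<comment> \<open>\<open>est\<close> covers term \<open>j\<close> as soon as
      \<open>j \<ge> J'\<close>; the finitely many earlier terms are absorbed in the constant
      \<open>B\<close>.\<close>
    define J' where "J' = b1 + b2 + a1 + a2"
    have "\<forall>j. \<exists>C. \<forall>x k. norm (sym_deriv b1 b2 a1 a2 (E j) (x, k)) \<le> C * (1 + norm k) powr (\<mu> - real j + 1 - real (a1 + a2))"
      using E1 unfolding symbol_class_def by blast
    then obtain C where C: "\<And>j x k. norm (sym_deriv b1 b2 a1 a2 (E j) (x, k)) \<le> C j * (1 + norm k) powr (\<mu> - real j + 1 - real (a1 + a2))"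
      by metis
    define B where "B = 1 + (\<Sum>j<J'. \<bar>C j\<bar> * 2 ^ j)"
    have B1: "B \<ge> 1" unfolding B_def by (simp add: sum_nonneg)
    have "norm (sym_deriv b1 b2 a1 a2 (E j) (x, k)) \<le> B * (1/2) ^ j * (1 + norm k) powr (\<mu> - real j + 1 - real (a1 + a2))"
      for j x k
    proof (cases "j < J'")
      case True
      then have "\<bar>C j\<bar> * 2 ^ j \<le> B"
        using member_le_sum[of j "{..<J'}" "\<lambda>j. \<bar>C j\<bar> * 2 ^ j"] by (simp add: B_def)
      then have "C j * 2 ^ j \<le> B"
        by (rule order_trans[rotated]) (rule mult_right_mono; simp)
      then have "C j \<le> B * (1/2) ^ j"
        by (simp add: power_divide field_simps)
      then show ?thesis by (intro order_trans[OF C] mult_right_mono) auto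
    next
      case False
      then have "norm (sym_deriv b1 b2 a1 a2 (E j) (x, k)) \<le> (1/2) ^ j * (1 + norm k) powr (\<mu> - real j + 1 - real (a1 + a2))"
        unfolding E_def by (intro est) (auto simp: J'_def)
      also have "\<dots> \<le> B * (1/2) ^ j * (1 + norm k) powr (\<mu> - real j + 1 - real (a1 + a2))"
        using B1 by (intro mult_right_mono) auto
      finally show ?thesis .
    qed
    moreover have "B * (1/2) ^ j * (1 + norm k) powr (\<mu> - real j + 1 - real (a1 + a2)) \<le>
        B * (1/2) ^ j * (1 + norm k) powr (\<mu> - real J + 1 - real (a1 + a2))" if "j \<in> {J..}" for j and k :: "real^2"
      using B1 that by (intro mult_left_mono one_plus_powr_mono) auto
    ultimately show "\<exists>C. \<forall>j\<in>{J..}. \<forall>x k. norm (sym_deriv b1 b2 a1 a2 (E j) (x, k))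
        \<le> C * (1/2) ^ j * (1 + norm k) powr (\<mu> - real J + 1 - real (a1 + a2))"
      by (intro exI[of _ B]) (meson order_trans)
  qed
  have "summable (\<lambda>j. norm ((1/2::real) ^ j))" by (simp add: summable_geometric)
  then have "(\<lambda>j. (1/2::real) ^ j) summable_on UNIV" by (rule norm_summable_imp_summable_on)
  then have geo: "(\<lambda>j. (1/2::real) ^ j) summable_on {J..}" for J
    by (rule summable_on_subset_banach) simp
  have sumE: "(\<lambda>j. E j q) summable_on {J..}" for J q
  proof -
    obtain C where "\<forall>j\<in>{J..}. \<forall>x k. norm (E j (x, k)) \<le> C * (1/2) ^ j * (1 + norm k) powr (\<mu> - real J + 1)"
      using symbol_family_bound[OF tail] by blast
    then show ?thesis
      by (cases q) (auto intro!: summable_on_bounded(1)[OF geo, where c = "C * (1 + norm (snd q)) powr (\<mu> - real J + 1)"]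
          simp: mult_ac)
  qed
  have tailS: "(\<lambda>q. \<Sum>\<^sub>\<infinity>j\<in>{J..}. E j q) \<in> S (\<mu> - real J + 1)" for J
    by (rule symbol_family_infsum[OF tail geo]) simp
  define s where "s q = (\<Sum>\<^sub>\<infinity>j\<in>{0..}. E j q)" for q
  have split: "s q = (\<Sum>j<J. E j q) + (\<Sum>\<^sub>\<infinity>j\<in>{J..}. E j q)" for J q
  proof -
    have "{0..} = {..<J} \<union> {J..}" by auto
    then have "s q = infsum (\<lambda>j. E j q) ({..<J} \<union> {J..})" by (simp add: s_def)
    also have "\<dots> = infsum (\<lambda>j. E j q) {..<J} + infsum (\<lambda>j. E j q) {J..}"
      by (rule infsum_Un_disjoint) (auto intro: sumE)
    finally show ?thesis by simp
  qed
  have main: "(\<lambda>q. s q - (\<Sum>j<J. D j q)) \<in> S (\<mu> - real J)" for J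
  proof -
    \<comment> \<open>Tail estimates lose one order, so the tail starts at \<open>Suc J\<close> and
      term \<open>J\<close> is split off, where \<open>E\<close> supplies the sharp order.\<close>
    have "(\<lambda>q. (\<Sum>j<J. E j q - D j q) + (E J q + (\<Sum>\<^sub>\<infinity>j\<in>{Suc J..}. E j q))) \<in> S (\<mu> - real J)"
      using tailS[of "Suc J"]
      by (intro symbol_class_add symbol_class_sum ED E) (simp add: algebra_simps)
    moreover have "(\<Sum>j<J. E j q - D j q) + (E J q + (\<Sum>\<^sub>\<infinity>j\<in>{Suc J..}. E j q)) = s q - (\<Sum>j<J. D j q)" for q
      using split[of q "Suc J"] by (simp add: sum_subtractf)
    ultimately show ?thesis by simp
  qed
  show ?thesis
    using main main[of 0] by (intro bexI[of _ s]) auto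
qed

end


section \<open>Fourier series\<close>

context torus
begin

abbreviation "D \<equiv> dual_lattice v1 v2"
abbreviation "SP \<equiv> smooth_periodic v1 v2"

section \<open>Means over the period cell\<close>

definition mean :: "(real^2 \<Rightarrow> 'b::real_normed_vector) \<Rightarrow> 'b" where
  "mean u = integral (cbox (0, 0) (1::real, 1::real)) (\<lambda>p. u (fst p *\<^sub>R v1 + snd p *\<^sub>R v2))"

definition wave :: "real^2 \<Rightarrow> real^2 \<Rightarrow> complex" where
  "wave k x = exp (\<i> * complex_of_real (k \<bullet> x))"

definition fourier :: "(real^2 \<Rightarrow> complex) \<Rightarrow> real^2 \<Rightarrow> complex" where
  "fourier u k = mean (\<lambda>y. wave (- k) y * u y)"

lemma continuous_cell:
  "continuous_on UNIV u \<Longrightarrow> continuous_on A (\<lambda>p. u (fst p *\<^sub>R v1 + snd p *\<^sub>R v2))"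
  by (rule continuous_on_compose2[of UNIV u]) (auto intro!: continuous_intros)

lemma integrable_cell:
  fixes u :: "real^2 \<Rightarrow> 'b::banach"
  shows "continuous_on UNIV u \<Longrightarrow>
    (\<lambda>p. u (fst p *\<^sub>R v1 + snd p *\<^sub>R v2)) integrable_on (cbox (0, 0) (1::real, 1::real))"
  by (intro integrable_continuous continuous_cell)

lemma mean_add:
  fixes u w :: "real^2 \<Rightarrow> 'b::banach"
  assumes "continuous_on UNIV u" "continuous_on UNIV w"
  shows "mean (\<lambda>y. u y + w y) = mean u + mean w"
  unfolding mean_def by (rule integral_add; rule integrable_cell; fact)

lemma mean_diff:
  fixes u w :: "real^2 \<Rightarrow> 'b::banach"
  assumes "continuous_on UNIV u" "continuous_on UNIV w"
  shows "mean (\<lambda>y. u y - w y) = mean u - mean w"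
  unfolding mean_def by (rule integral_diff; rule integrable_cell; fact)

lemma mean_bounded_linear:
  fixes u :: "real^2 \<Rightarrow> 'b::banach"
  assumes "bounded_linear B" "continuous_on UNIV u"
  shows "mean (\<lambda>y. B (u y)) = B (mean u)"
  unfolding mean_def
  using integral_linear[OF integrable_cell[OF assms(2)] assms(1)] by (simp add: o_def)

lemma mean_cmult:
  fixes u :: "real^2 \<Rightarrow> complex"
  shows "continuous_on UNIV u \<Longrightarrow> mean (\<lambda>y. c * u y) = c * mean u"
  by (rule mean_bounded_linear[OF bounded_linear_mult_right])

lemma mean_const: "mean (\<lambda>y. c :: 'b::banach) = c"
  by (simp add: mean_def content_Pair)

lemma norm_mean_le:
  fixes u :: "real^2 \<Rightarrow> 'b::banach"
  assumes "continuous_on UNIV u" "\<And>x. norm (u x) \<le> C"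
  shows "norm (mean u) \<le> C"
proof -
  have "norm (mean u) \<le> integral (cbox (0, 0) (1::real, 1::real)) (\<lambda>p. C)"
    unfolding mean_def
    by (rule integral_norm_bound_integral) (use assms in \<open>auto intro: integrable_cell\<close>)
  then show ?thesis by (simp add: content_Pair)
qed

text \<open>Partial sums over finite subsets converge uniformly by the Weierstrass test, so
  continuity and integration pass to the limit along this net.\<close>

lemma mean_infsum:
  fixes f :: "'i \<Rightarrow> real^2 \<Rightarrow> 'b::banach"
  assumes cont: "\<And>i. i \<in> A \<Longrightarrow> continuous_on UNIV (f i)"
    and bound: "\<And>i x. i \<in> A \<Longrightarrow> norm (f i x) \<le> M i" and M: "M summable_on A"
  shows "((\<lambda>i. mean (f i)) has_sum mean (\<lambda>x. \<Sum>\<^sub>\<infinity>i\<in>A. f i x)) A"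
    and "continuous_on UNIV (\<lambda>x. \<Sum>\<^sub>\<infinity>i\<in>A. f i x)"
proof -
  have unif: "uniform_limit UNIV (\<lambda>X y. \<Sum>i\<in>X. f i y) (\<lambda>y. \<Sum>\<^sub>\<infinity>i\<in>A. f i y) (finite_subsets_at_top A)"
    by (rule Weierstrass_m_test_general[OF _ M]) (rule bound)
  have ev: "\<forall>\<^sub>F X in finite_subsets_at_top A. finite X \<and> X \<subseteq> A"
    by (simp add: eventually_finite_subsets_at_top_weakI)
  show cont_sum: "continuous_on UNIV (\<lambda>x. \<Sum>\<^sub>\<infinity>i\<in>A. f i x)"
    by (rule uniform_limit_theorem[OF _ unif])
      (use ev in \<open>eventually_elim, auto intro!: continuous_on_sum cont\<close>)+
  \<comment> \<open>Continuity of \<open>f i\<close> is known for \<open>i\<close> in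
    \<open>A\<close> only; resetting the other partial sums to zero makes every member of the net
    continuous.\<close>
  define g where "g X = (if finite X \<and> X \<subseteq> A then (\<lambda>y. \<Sum>i\<in>X. f i y) else (\<lambda>y. 0))" for X
  have gcont: "continuous_on UNIV (g X)" for X
    unfolding g_def by (auto intro!: continuous_on_sum cont)
  define \<phi> :: "real \<times> real \<Rightarrow> real^2" where "\<phi> p = fst p *\<^sub>R v1 + snd p *\<^sub>R v2" for p
  have "uniform_limit (cbox (0, 0) (1, 1)) (\<lambda>X p. g X (\<phi> p)) (\<lambda>p. \<Sum>\<^sub>\<infinity>i\<in>A. f i (\<phi> p)) (finite_subsets_at_top A)"
  proof (rule uniform_limitI)
    fix e :: real assume "e > 0"
    from uniform_limitD[OF unif this] ev
    show "\<forall>\<^sub>F X in finite_subsets_at_top A. \<forall>p\<in>cbox (0, 0) (1, 1). dist (g X (\<phi> p)) (\<Sum>\<^sub>\<infinity>i\<in>A. f i (\<phi> p)) < e"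
      by eventually_elim (auto simp: g_def)
  qed
  then obtain I J where I: "\<And>X. ((\<lambda>p. g X (\<phi> p)) has_integral I X) (cbox (0, 0) (1, 1))"
    and J: "((\<lambda>p. \<Sum>\<^sub>\<infinity>i\<in>A. f i (\<phi> p)) has_integral J) (cbox (0, 0) (1, 1))"
    and lim: "(I \<longlongrightarrow> J) (finite_subsets_at_top A)"
    by (rule uniform_limit_integral_cbox)
      (auto simp: \<phi>_def intro!: continuous_cell gcont)
  have "J = mean (\<lambda>x. \<Sum>\<^sub>\<infinity>i\<in>A. f i x)"
    using J by (simp add: mean_def \<phi>_def integral_unique)
  moreover have "\<forall>\<^sub>F X in finite_subsets_at_top A. I X = (\<Sum>i\<in>X. mean (f i))"
    using ev
  proof eventually_elim
    case (elim X)
    have "I X = integral (cbox (0, 0) (1, 1)) (\<lambda>p. \<Sum>i\<in>X. f i (\<phi> p))"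
      using I[of X] elim by (simp add: g_def integral_unique)
    also have "\<dots> = (\<Sum>i\<in>X. mean (f i))"
      unfolding mean_def \<phi>_def by (rule integral_sum) (use elim in \<open>auto intro!: integrable_cell cont\<close>)
    finally show ?case .
  qed
  ultimately show "((\<lambda>i. mean (f i)) has_sum mean (\<lambda>x. \<Sum>\<^sub>\<infinity>i\<in>A. f i x)) A"
    unfolding has_sum_def using lim by (simp add: filterlim_cong[OF refl refl])
qed

lemma dderiv_linear: "u differentiable (at p) \<Longrightarrow> linear (\<lambda>v. dderiv v u p)"
  using has_derivative_dderiv has_derivative_linear by blast

text \<open>Along a lattice generator the derivative integrates to zero over a full period; a
  general direction is a combination of the two generators.\<close>

lemma mean_dderiv:
  fixes u :: "real^2 \<Rightarrow> complex"
  assumes u: "u \<in> SP"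
  shows "mean (dderiv v u) = 0"
proof -
  note uD = smooth_periodicD[OF u]
  have cont: "continuous_on UNIV (dderiv w u)" for w
    by (rule smooth_periodicD(3)[OF smooth_periodic_dderiv[OF u]])
  have line: "integral (cbox 0 1) (\<lambda>t. dderiv w u (y + t *\<^sub>R w)) = 0" if "w \<in> L" for w y
  proof -
    have "((\<lambda>t. dderiv w u (y + t *\<^sub>R w)) has_integral (u (y + 1 *\<^sub>R w) - u (y + 0 *\<^sub>R w))) {0..1}"
      by (rule fundamental_theorem_of_calculus) (auto intro: has_vector_derivative_dderiv uD(4))
    then show ?thesis using uD(2)[OF that] by (simp add: integral_unique)
  qed
  have c2: "continuous_on (cbox (0, 0) (1, 1)) (\<lambda>p::real \<times> real. dderiv w u (fst p *\<^sub>R v1 + snd p *\<^sub>R v2))" for w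
    by (rule continuous_cell[OF cont])
  have 2: "mean (dderiv v2 u) = 0"
    unfolding mean_def integral_prod_continuous[OF c2] fst_conv snd_conv
    by (simp add: line[OF lattice_generators(2), unfolded cbox_interval] cbox_interval)
  \<comment> \<open>The coordinate along \<open>v1\<close> is the outer variable, so the integrals
    are exchanged before the fundamental theorem applies.\<close>
  have "mean (dderiv v1 u) = integral (cbox 0 1) (\<lambda>s. integral (cbox 0 1) (\<lambda>t. dderiv v1 u (s *\<^sub>R v1 + t *\<^sub>R v2)))"
    unfolding mean_def integral_prod_continuous[OF c2] fst_conv snd_conv ..
  also have "\<dots> = integral (cbox 0 1) (\<lambda>t. integral (cbox 0 1) (\<lambda>s. dderiv v1 u (s *\<^sub>R v1 + t *\<^sub>R v2)))"
    by (rule integral_swap_continuous) (use c2[of v1] in \<open>simp add: case_prod_unfold\<close>)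
  also have "\<dots> = integral (cbox 0 1) (\<lambda>t. integral (cbox 0 1) (\<lambda>s. dderiv v1 u (t *\<^sub>R v2 + s *\<^sub>R v1)))"
    by (simp add: add.commute)
  also have "\<dots> = 0" unfolding line[OF lattice_generators(1)] by simp
  finally have 1: "mean (dderiv v1 u) = 0" .
  obtain a b where v: "v = a *\<^sub>R v1 + b *\<^sub>R v2" using coordinates by blast
  have "dderiv v u = (\<lambda>y. a *\<^sub>R dderiv v1 u y + b *\<^sub>R dderiv v2 u y)"
    by (rule ext) (simp add: v linear_add[OF dderiv_linear[OF uD(4)]] linear_scale[OF dderiv_linear[OF uD(4)]])
  then have "mean (dderiv v u) = mean (\<lambda>y. a *\<^sub>R dderiv v1 u y) + mean (\<lambda>y. b *\<^sub>R dderiv v2 u y)"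
    by (simp add: mean_add continuous_on_scaleR cont)
  also have "\<dots> = 0"
    using 1 2 by (simp add: mean_bounded_linear[OF bounded_linear_scaleR_right cont])
  finally show ?thesis .
qed

section \<open>Plane waves and the dual lattice\<close>

lemma wave_add: "wave (k + l) x = wave k x * wave l x"
  by (simp add: wave_def inner_add_left algebra_simps exp_add)

lemma wave_shift: "wave k (x + y) = wave k x * wave k y"
  by (simp add: wave_def inner_add_right algebra_simps exp_add)

lemma wave_zero [simp]: "wave 0 x = 1"
  by (simp add: wave_def)

lemma wave_cancel: "wave (- k) x * wave k x = 1"
  using wave_add[of "- k" k x] by simp

lemma norm_wave [simp]: "norm (wave k x) = 1"
  by (simp add: wave_def norm_exp_i_times)

lemma wave_has_derivative:
  "(wave k has_derivative (\<lambda>v. \<i> * complex_of_real (k \<bullet> v) * wave k x)) (at x)"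
proof -
  have "((\<lambda>x. \<i> * complex_of_real (k \<bullet> x)) has_derivative (\<lambda>v. \<i> * complex_of_real (k \<bullet> v))) (at x)"
    by (auto intro!: derivative_eq_intros)
  moreover have "(exp has_derivative (\<lambda>h. exp (\<i> * complex_of_real (k \<bullet> x)) * h)) (at (\<i> * complex_of_real (k \<bullet> x)))"
    using DERIV_exp unfolding has_field_derivative_def .
  ultimately show ?thesis
    using has_derivative_compose unfolding wave_def[abs_def] by (fastforce simp: mult_ac)
qed

lemma dderiv_wave: "dderiv v (wave k) x = \<i> * complex_of_real (k \<bullet> v) * wave k x"
  by (rule dderiv_eq[OF wave_has_derivative])

lemma continuous_wave: "continuous_on A (wave k)"
  unfolding wave_def[abs_def] by (intro continuous_intros)

lemma dual_lattice_zero: "0 \<in> D"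
  by (auto simp: dual_lattice_def intro: exI[of _ 0])

lemma dual_lattice_add: assumes "k \<in> D" "l \<in> D" shows "k + l \<in> D"
  unfolding dual_lattice_def
proof (intro CollectI ballI)
  fix y assume "y \<in> L"
  then obtain m n :: int where "k \<bullet> y = 2 * pi * of_int m" "l \<bullet> y = 2 * pi * of_int n"
    using assms unfolding dual_lattice_def by blast
  then show "\<exists>n::int. (k + l) \<bullet> y = 2 * pi * of_int n"
    by (intro exI[of _ "m + n"]) (simp add: inner_add_left algebra_simps)
qed

lemma dual_lattice_uminus: assumes "k \<in> D" shows "- k \<in> D"
  unfolding dual_lattice_def
proof (intro CollectI ballI)
  fix y assume "y \<in> L"
  then obtain m :: int where "k \<bullet> y = 2 * pi * of_int m"
    using assms by (auto simp: dual_lattice_def)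
  then show "\<exists>n::int. (- k) \<bullet> y = 2 * pi * of_int n"
    by (intro exI[of _ "- m"]) simp
qed

lemma dual_lattice_diff: "k \<in> D \<Longrightarrow> l \<in> D \<Longrightarrow> k - l \<in> D"
  using dual_lattice_add[OF _ dual_lattice_uminus] by fastforce

lemma wave_periodic: assumes "k \<in> D" "l \<in> L" shows "wave k (x + l) = wave k x"
proof -
  obtain n :: int where n: "k \<bullet> l = 2 * pi * of_int n" using assms by (auto simp: dual_lattice_def)
  have "wave k l = exp (2 * of_int n * of_real pi * \<i>)"
    unfolding wave_def n by (simp add: mult_ac)
  also have "\<dots> = 1" using exp_integer_2pi[of "real_of_int n"] by simp
  finally show ?thesis by (simp add: wave_shift)
qed

lemma wave_smooth: "smooth_on UNIV (\<lambda>x. c * wave k x)"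
proof (rule smooth_on_coinduct[where T = "range (\<lambda>c x. c * wave k x)"])
  have diff: "wave k differentiable (at x)" for x
    using wave_has_derivative unfolding differentiable_def by blast
  fix f assume "f \<in> range (\<lambda>c x. c * wave k x)"
  then obtain c where f: "f = (\<lambda>x. c * wave k x)" by blast
  show "f differentiable (at p)" for p
    unfolding f by (intro differentiable_mult diff differentiable_const)
  show "\<exists>g\<in>range (\<lambda>c x. c * wave k x). \<forall>p\<in>UNIV. dderiv v f p = g p" for v
    unfolding f
    by (intro bexI[of _ "\<lambda>x. (c * \<i> * complex_of_real (k \<bullet> v)) * wave k x"])
      (auto simp: dderiv_mult diff dderiv_wave)
qed auto

lemma wave_SP: "k \<in> D \<Longrightarrow> wave k \<in> SP"
  using wave_smooth[of 1 k] wave_periodic by (simp add: smooth_periodic_def)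

lemma symbol_slice:
  fixes s :: "phase \<Rightarrow> complex"
  assumes "s \<in> S m"
  shows "(\<lambda>x. s (x, k)) \<in> SP"
proof -
  have diff: "(\<lambda>x. s (x, k)) differentiable (at p)" if "s \<in> S m" for s :: "phase \<Rightarrow> complex" and m p
    by (rule differentiable_compose[OF symbol_class_diff[OF that]])
      (auto intro!: derivative_intros simp: differentiable_def)
  have slice: "dderiv v (\<lambda>x. s (x, k)) = (\<lambda>x. dderiv (v, 0) s (x, k))" for v and s :: "phase \<Rightarrow> complex"
    by (rule ext) (simp add: dderiv_def)
  have "smooth_on UNIV (\<lambda>x. s (x, k))"
  proof (rule smooth_on_UNIV_Basis_coinduct[where T = "{\<lambda>x. s (x, k) | s. s \<in> S m}"])
    fix f :: "real^2 \<Rightarrow> complex" and b :: "real^2" assume "f \<in> {\<lambda>x. s (x, k) | s. s \<in> S m}" and b: "b \<in> Basis"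
    then obtain s where s: "s \<in> S m" and f: "f = (\<lambda>x. s (x, k))" by blast
    have b': "(b, 0 :: real^2) \<in> Basis" using b by (simp add: Basis_prod_def)
    have "order_drop (b, 0) = 0" using b by (auto simp: order_drop_def)
    then have "dderiv (b, 0) s \<in> S m" using symbol_class_dderiv[OF s b'] by simp
    then show "dderiv b f \<in> {\<lambda>x. s (x, k) | s. s \<in> S m}"
      unfolding f slice by blast
  qed (use assms diff in auto)
  then show ?thesis
    using symbol_class_periodic[OF assms] by (simp add: smooth_periodic_def)
qed

lemma SP_add: "u \<in> SP \<Longrightarrow> w \<in> SP \<Longrightarrow> (\<lambda>x. u x + w x) \<in> SP"
  by (auto simp: smooth_periodic_def smooth_on_add)

lemma SP_mult:
  fixes u w :: "real^2 \<Rightarrow> complex"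
  assumes "u \<in> SP" "w \<in> SP"
  shows "(\<lambda>x. u x * w x) \<in> SP"
  using symbol_slice[OF symbol_class_mult[OF assms[THEN symbol_of_function] refl]] by simp

lemma SP_cmult:
  fixes u :: "real^2 \<Rightarrow> complex"
  shows "u \<in> SP \<Longrightarrow> (\<lambda>x. c * u x) \<in> SP"
  by (rule SP_mult[OF smooth_periodic_const])

lemma SP_diff:
  fixes u w :: "real^2 \<Rightarrow> complex"
  assumes "u \<in> SP" "w \<in> SP"
  shows "(\<lambda>x. u x - w x) \<in> SP"
  using SP_add[OF assms(1) SP_cmult[OF assms(2), of "- 1"]] by simp

section \<open>Fourier coefficients and their decay\<close>

lemma fourier_integrand_cont: "continuous_on UNIV u \<Longrightarrow> continuous_on UNIV (\<lambda>y. wave (- k) y * u y)"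
  by (intro continuous_intros continuous_wave)

lemma fourier_add:
  "continuous_on UNIV u \<Longrightarrow> continuous_on UNIV w \<Longrightarrow> fourier (\<lambda>x. u x + w x) k = fourier u k + fourier w k"
  unfolding fourier_def by (simp add: distrib_left mean_add fourier_integrand_cont)

lemma fourier_diff:
  "continuous_on UNIV u \<Longrightarrow> continuous_on UNIV w \<Longrightarrow> fourier (\<lambda>x. u x - w x) k = fourier u k - fourier w k"
  unfolding fourier_def by (simp add: right_diff_distrib mean_diff fourier_integrand_cont)

lemma fourier_cmult: "continuous_on UNIV u \<Longrightarrow> fourier (\<lambda>x. c * u x) k = c * fourier u k"
  unfolding fourier_def using mean_cmult[OF fourier_integrand_cont, of u c k] by (simp add: mult_ac)

lemma fourier_zero [simp]: "fourier (\<lambda>x. 0) k = 0"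
  by (simp add: fourier_def mean_const)

lemma fourier_bound:
  assumes "continuous_on UNIV u" "\<And>x. norm (u x) \<le> C"
  shows "norm (fourier u k) \<le> C"
  unfolding fourier_def by (rule norm_mean_le[OF fourier_integrand_cont[OF assms(1)]]) (simp add: norm_mult assms(2))

text \<open>Integration by parts: the product of \<open>u\<close> with a periodic wave has a
  derivative of mean zero.\<close>

lemma fourier_dderiv:
  assumes u: "u \<in> SP" and k: "k \<in> D"
  shows "fourier (dderiv v u) k = \<i> * complex_of_real (k \<bullet> v) * fourier u k"
proof -
  have e: "wave (- k) \<in> SP" by (rule wave_SP[OF dual_lattice_uminus[OF k]])
  note eD = smooth_periodicD[OF e] and uD = smooth_periodicD[OF u]
  have du: "continuous_on UNIV (dderiv v u)"
    by (rule smooth_periodicD(3)[OF smooth_periodic_dderiv[OF u]])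
  have "dderiv v (\<lambda>y. wave (- k) y * u y) =
      (\<lambda>y. wave (- k) y * dderiv v u y + - (\<i> * complex_of_real (k \<bullet> v)) * (wave (- k) y * u y))"
    by (rule ext) (simp add: dderiv_mult eD(4) uD(4) dderiv_wave)
  then have "0 = mean (\<lambda>y. wave (- k) y * dderiv v u y + - (\<i> * complex_of_real (k \<bullet> v)) * (wave (- k) y * u y))"
    using mean_dderiv[OF SP_mult[OF e u], of v] by simp
  also have "\<dots> = fourier (dderiv v u) k + mean (\<lambda>y. - (\<i> * complex_of_real (k \<bullet> v)) * (wave (- k) y * u y))"
    unfolding fourier_def
    by (rule mean_add[OF fourier_integrand_cont[OF du]])
      (intro continuous_on_mult_left fourier_integrand_cont uD(3))
  also have "\<dots> = fourier (dderiv v u) k - \<i> * complex_of_real (k \<bullet> v) * fourier u k"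
    unfolding fourier_def by (subst mean_cmult[OF fourier_integrand_cont[OF uD(3)]]) simp
  finally show ?thesis by simp
qed

text \<open>For \<open>d = j - k\<close> nonzero, the derivative of \<open>wave d\<close> along
  \<open>d\<close> is \<open>i |d|^2 wave d\<close>; its mean is zero, hence so is that of
  \<open>wave d\<close>.\<close>

lemma fourier_wave: assumes "j \<in> D" "k \<in> D" shows "fourier (wave j) k = (if j = k then 1 else 0)"
proof (cases "j = k")
  case True
  then show ?thesis by (simp add: fourier_def wave_cancel mean_const)
next
  case False
  define d where "d = j - k"
  have d: "d \<in> D" unfolding d_def by (rule dual_lattice_diff[OF assms])
  have "dderiv d (wave d) = (\<lambda>x. \<i> * complex_of_real (d \<bullet> d) * wave d x)"
    by (rule ext) (rule dderiv_wave)
  then have "0 = \<i> * complex_of_real (d \<bullet> d) * mean (wave d)"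
    using mean_dderiv[OF wave_SP[OF d], of d] mean_cmult[OF continuous_wave] by simp
  then have "mean (wave d) = 0" using False by (simp add: d_def)
  moreover have "fourier (wave j) k = mean (wave d)"
    unfolding fourier_def d_def wave_add[symmetric] by simp
  ultimately show ?thesis using False by simp
qed

text \<open>The operator \<open>1 - \<Delta>\<close>. Its multiplier \<open>1 + |k|^2\<close> has no
  zero, so decay at \<open>k = 0\<close> needs no separate case.\<close>

definition bessel :: "(real^2 \<Rightarrow> complex) \<Rightarrow> real^2 \<Rightarrow> complex" where
  "bessel u x = u x - (\<Sum>i\<in>UNIV. dderiv (axis i 1) (dderiv (axis i 1) u) x)"

lemma bessel_SP: "u \<in> SP \<Longrightarrow> bessel u \<in> SP"
  unfolding bessel_def[abs_def] sum_2 by (intro SP_diff SP_add smooth_periodic_dderiv)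

lemma fourier_bessel:
  assumes u: "u \<in> SP" and k: "k \<in> D"
  shows "fourier (bessel u) k = complex_of_real (1 + (norm k)\<^sup>2) * fourier u k"
proof -
  note dd = smooth_periodic_dderiv[OF smooth_periodic_dderiv[OF u]]
  have "fourier (bessel u) k = fourier u k - (fourier (dderiv (axis 1 1) (dderiv (axis 1 1) u)) k
      + fourier (dderiv (axis 2 1) (dderiv (axis 2 1) u)) k)"
    unfolding bessel_def[abs_def] sum_2
    by (simp add: fourier_diff fourier_add smooth_periodicD(3)[OF u] smooth_periodicD(3)[OF dd] continuous_on_add)
  moreover have norm_k: "(norm k)\<^sup>2 = (k $ 1)\<^sup>2 + (k $ 2)\<^sup>2"
    unfolding power2_norm_eq_inner by (simp add: inner_vec_def sum_2 power2_eq_square)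
  ultimately show ?thesis
    unfolding norm_k fourier_dderiv[OF smooth_periodic_dderiv[OF u] k] fourier_dderiv[OF u k]
    by (simp add: inner_axis algebra_simps power2_eq_square)
qed

lemma bessel_funpow_SP: "u \<in> SP \<Longrightarrow> (bessel ^^ n) u \<in> SP"
  by (induction n) (auto intro: bessel_SP)

lemma fourier_bessel_funpow:
  assumes "u \<in> SP" "k \<in> D"
  shows "fourier ((bessel ^^ n) u) k = complex_of_real ((1 + (norm k)\<^sup>2) ^ n) * fourier u k"
  by (induction n) (auto simp: fourier_bessel[OF bessel_funpow_SP[OF assms(1)] assms(2)])

text \<open>The constant is a bound on the Bessel iterate itself, so estimates stay uniform when
  \<open>u\<close> depends on a parameter such as the momentum of a symbol or
  \<open>w\<close>.\<close>

lemma fourier_decay_explicit: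
  assumes u: "u \<in> SP" and k: "k \<in> D" and C: "\<And>x. norm ((bessel ^^ n) u x) \<le> C"
  shows "norm (fourier u k) \<le> C / (1 + (norm k)\<^sup>2) ^ n"
proof -
  have "norm (fourier ((bessel ^^ n) u) k) \<le> C"
    by (rule fourier_bound[OF smooth_periodicD(3)[OF bessel_funpow_SP[OF u]] C])
  then have "(1 + (norm k)\<^sup>2) ^ n * norm (fourier u k) \<le> C"
    unfolding fourier_bessel_funpow[OF u k] norm_mult norm_of_real by simp
  then show ?thesis by (simp add: pos_le_divide_eq add_pos_nonneg mult.commute)
qed

lemma fourier_decay:
  assumes u: "u \<in> SP"
  obtains C where "C \<ge> 0" "\<And>k. k \<in> D \<Longrightarrow> norm (fourier u k) \<le> C / (1 + (norm k)\<^sup>2) ^ n"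
proof -
  note b = smooth_periodicD[OF bessel_funpow_SP[OF u, of n]]
  obtain C where "C \<ge> 0" "\<And>x. norm ((bessel ^^ n) u x) \<le> C"
    using periodic_bounded[OF b(3,2)] by blast
  then show ?thesis using that fourier_decay_explicit[OF u] by blast
qed

text \<open>Decay of order 4 is comfortably summable over a planar lattice; the square allows
  comparison with a product of two one-dimensional weights.\<close>

definition decay_weight :: "real^2 \<Rightarrow> real" where
  "decay_weight k = 1 / (1 + (norm k)\<^sup>2)\<^sup>2"

lemma decay_weight_nonneg: "0 \<le> decay_weight k"
  by (simp add: decay_weight_def)

lemma inverse_one_plus_square_summable: "(\<lambda>n::int. 1 / (1 + (real_of_int n)\<^sup>2)) summable_on UNIV"
proof -
  have "summable (\<lambda>n. inverse ((real n)\<^sup>2))" using inverse_power_summable[of 2] by simp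
  then have "summable (\<lambda>n. 1 / (1 + (real n)\<^sup>2))"
  proof (rule summable_comparison_test'[where N = 1])
    fix n :: nat assume "1 \<le> n"
    then have "inverse (1 + (real n)\<^sup>2) \<le> inverse ((real n)\<^sup>2)"
      by (intro le_imp_inverse_le) auto
    then show "norm (1 / (1 + (real n)\<^sup>2)) \<le> inverse ((real n)\<^sup>2)"
      by (simp add: inverse_eq_divide)
  qed
  then have nat: "(\<lambda>n::nat. 1 / (1 + (real n)\<^sup>2)) summable_on UNIV"
    by (intro norm_summable_imp_summable_on) simp
  have "(\<lambda>n::int. 1 / (1 + (real_of_int n)\<^sup>2)) summable_on range int"
    using nat by (subst summable_on_reindex) (auto simp: o_def)
  moreover have "(\<lambda>n::int. 1 / (1 + (real_of_int n)\<^sup>2)) summable_on range (\<lambda>n. - int n)"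
    using nat by (subst summable_on_reindex) (auto simp: o_def inj_on_def)
  ultimately have "(\<lambda>n::int. 1 / (1 + (real_of_int n)\<^sup>2)) summable_on (range int \<union> range (\<lambda>n. - int n))"
    by (rule summable_on_union)
  moreover have "range int \<union> range (\<lambda>n. - int n) = UNIV"
  proof -
    have "n \<in> range int \<union> range (\<lambda>n. - int n)" for n
      by (cases n rule: int_cases2) auto
    then show ?thesis by auto
  qed
  ultimately show ?thesis by simp
qed

text \<open>The products of \<open>k\<close> with \<open>v1\<close> and \<open>v2\<close>, divided
  by \<open>2 pi\<close>, are integers that determine \<open>k\<close>. By Cauchy-Schwarz one plus
  the square of either is at most \<open>A (1 + |k|^2)\<close>, so the weight is dominated by a
  product of two summable integer weights.\<close>

lemma decay_weight_summable: "decay_weight summable_on D"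
proof -
  have "\<exists>p. k \<bullet> v1 = 2 * pi * of_int (fst p) \<and> k \<bullet> v2 = 2 * pi * of_int (snd p)" if "k \<in> D" for k
  proof -
    obtain m n :: int where "k \<bullet> v1 = 2 * pi * of_int m" "k \<bullet> v2 = 2 * pi * of_int n"
      using \<open>k \<in> D\<close> lattice_generators unfolding dual_lattice_def by blast
    then show ?thesis by (intro exI[of _ "(m, n)"]) auto
  qed
  then obtain f :: "real^2 \<Rightarrow> int \<times> int" where
    f: "\<And>k. k \<in> D \<Longrightarrow> k \<bullet> v1 = 2 * pi * of_int (fst (f k))"
      "\<And>k. k \<in> D \<Longrightarrow> k \<bullet> v2 = 2 * pi * of_int (snd (f k))"
    by metis
  have inj: "inj_on f D"
  proof (rule inj_onI)
    fix k l assume "k \<in> D" "l \<in> D" "f k = f l"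
    then have "(k - l) \<bullet> v1 = 0" "(k - l) \<bullet> v2 = 0" using f by (auto simp: inner_diff_left)
    moreover obtain s t where "k - l = s *\<^sub>R v1 + t *\<^sub>R v2" using coordinates by blast
    ultimately have "(k - l) \<bullet> (k - l) = 0" by (simp add: inner_add_right)
    then show "k = l" by simp
  qed
  define h :: "int \<Rightarrow> real" where "h n = 1 / (1 + (real_of_int n)\<^sup>2)" for n
  have h: "h summable_on UNIV" unfolding h_def by (rule inverse_one_plus_square_summable)
  have "(\<lambda>p. h (fst p) * h (snd p)) summable_on (UNIV \<times> UNIV)"
  proof (rule summable_on_SigmaI)
    show "((\<lambda>n. h (fst (m, n)) * h (snd (m, n))) has_sum (h m * infsum h UNIV)) UNIV" for m
      using h by (auto intro: has_sum_cmult_right)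
    show "(\<lambda>m. h m * infsum h UNIV) summable_on UNIV"
      by (rule summable_on_cmult_left[OF h])
  qed (auto simp: h_def)
  then have "(\<lambda>p. h (fst p) * h (snd p)) summable_on f ` D"
    by (rule summable_on_subset_banach) auto
  then have hf: "(\<lambda>k. h (fst (f k)) * h (snd (f k))) summable_on D"
    using summable_on_reindex[OF inj, of "\<lambda>p. h (fst p) * h (snd p)"] by (simp add: o_def)
  define A where "A = 1 + (norm v1)\<^sup>2 + (norm v2)\<^sup>2"
  have A: "A \<ge> 1" by (simp add: A_def)
  have one: "1 + (real_of_int m)\<^sup>2 \<le> A * (1 + (norm k)\<^sup>2)"
    if "k \<bullet> v = 2 * pi * of_int m" "(norm v)\<^sup>2 \<le> A - 1" for k v :: "real^2" and m
  proof -
    have "\<bar>real_of_int m\<bar> \<le> 2 * pi * \<bar>real_of_int m\<bar>"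
      using pi_gt3 by (intro mult_le_cancel_right1[THEN iffD2]) auto
    also have "\<dots> = \<bar>k \<bullet> v\<bar>" using that(1) by (simp add: abs_mult)
    also have "\<dots> \<le> norm k * norm v" by (rule Cauchy_Schwarz_ineq2)
    finally have "(real_of_int m)\<^sup>2 \<le> (norm k * norm v)\<^sup>2"
      by (metis abs_ge_zero power2_abs power_mono)
    also have "\<dots> \<le> (norm k)\<^sup>2 * (A - 1)"
      using that(2) by (simp add: power_mult_distrib mult_left_mono)
    finally have "1 + (real_of_int m)\<^sup>2 \<le> 1 + (norm k)\<^sup>2 * (A - 1)" by simp
    also have "\<dots> \<le> A * (1 + (norm k)\<^sup>2)"
      using A zero_le_power2[of "norm k"] by (simp add: algebra_simps add_increasing2)
    finally show ?thesis .
  qed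
  have "decay_weight k \<le> A\<^sup>2 * (h (fst (f k)) * h (snd (f k)))" if "k \<in> D" for k
  proof -
    define a b where "a = 1 + (real_of_int (fst (f k)))\<^sup>2" and "b = 1 + (real_of_int (snd (f k)))\<^sup>2"
    have ab: "a \<le> A * (1 + (norm k)\<^sup>2)" "b \<le> A * (1 + (norm k)\<^sup>2)" "a > 0" "b > 0"
      unfolding a_def b_def using one[OF f(1)[OF that]] one[OF f(2)[OF that]]
      by (auto simp: A_def add_pos_nonneg)
    then have "a * b \<le> (A * (1 + (norm k)\<^sup>2)) * (A * (1 + (norm k)\<^sup>2))"
      by (intro mult_mono) auto
    then have "a * b \<le> A\<^sup>2 * (1 + (norm k)\<^sup>2)\<^sup>2"
      by (simp add: power2_eq_square mult_ac)
    then have "1 / (1 + (norm k)\<^sup>2)\<^sup>2 \<le> A\<^sup>2 / (a * b)"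
      using ab by (simp add: divide_simps add_nonneg_eq_0_iff mult_ac)
    then show ?thesis by (simp add: decay_weight_def h_def a_def b_def)
  qed
  then show ?thesis
    using summable_on_bounded(1)[OF hf, where f = decay_weight and c = "A\<^sup>2"] by (simp add: decay_weight_nonneg)
qed

end

text \<open>Near \<open>p0\<close> there is a box on which \<open>\<kappa>\<close> exceeds some
  \<open>q'\<close> and \<open>H\<close> some positive \<open>\<eta>\<close>; where \<open>H\<close>
  may be negative, \<open>\<kappa>\<close> stays below some \<open>q < q'\<close>. The gain of order
  \<open>q' ^ n\<close> eventually beats the loss of order \<open>q ^ n\<close>.\<close>

lemma integral_peak:
  fixes H \<kappa> :: "'a::euclidean_space \<Rightarrow> real"
  assumes H: "continuous_on (cbox a b) H" and \<kappa>: "continuous_on (cbox a b) \<kappa>"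
    and p0: "p0 \<in> box a b" and H0: "H p0 > 0" and \<kappa>0: "\<kappa> p0 = 1"
    and nonneg: "\<And>p. p \<in> cbox a b \<Longrightarrow> 0 \<le> \<kappa> p"
    and less: "\<And>p. p \<in> cbox a b \<Longrightarrow> p \<noteq> p0 \<Longrightarrow> \<kappa> p < 1"
  shows "\<exists>n. integral (cbox a b) (\<lambda>p. H p * \<kappa> p ^ n) > 0"
proof -
  define \<eta> where "\<eta> = H p0 / 2"
  have \<eta>: "\<eta> > 0" "\<eta> < H p0" using H0 by (auto simp: \<eta>_def)
  have sub: "box a b \<subseteq> cbox a b" by (rule box_subset_cbox)
  have opn: "open {p \<in> box a b. c < f p}" if "continuous_on (cbox a b) f" for f :: "'a \<Rightarrow> real" and c
  proof -
    have "continuous_on (box a b) f" using that sub continuous_on_subset by blast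
    then have "open (box a b \<inter> f -` {c<..})" by (intro continuous_open_preimage) auto
    moreover have "box a b \<inter> f -` {c<..} = {p \<in> box a b. c < f p}" by auto
    ultimately show ?thesis by simp
  qed
  define U where "U = {p \<in> box a b. \<eta> < H p}"
  have U: "open U" "p0 \<in> U" "U \<subseteq> box a b"
    using opn[OF H] p0 \<eta> by (auto simp: U_def)
  have "\<exists>q. 0 < q \<and> q < 1 \<and> (\<forall>p\<in>cbox a b - U. \<kappa> p \<le> q)"
  proof (cases "cbox a b - U = {}")
    case True
    then show ?thesis by (intro exI[of _ "1/2"]) auto
  next
    case False
    have "compact (cbox a b - U)" by (intro compact_diff compact_cbox U(1))
    moreover have "continuous_on (cbox a b - U) \<kappa>" using \<kappa> continuous_on_subset by blast
    ultimately obtain p1 where p1: "p1 \<in> cbox a b - U" "\<forall>p\<in>cbox a b - U. \<kappa> p \<le> \<kappa> p1"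
      using continuous_attains_sup False by blast
    then have "p1 \<noteq> p0" using U(2) by auto
    then have "\<kappa> p1 < 1" using less p1(1) by blast
    then show ?thesis using p1(2) by (intro exI[of _ "max (1/2) (\<kappa> p1)"]) (auto simp: le_max_iff_disj)
  qed
  then obtain q where q: "0 < q" "q < 1" "\<And>p. p \<in> cbox a b - U \<Longrightarrow> \<kappa> p \<le> q" by blast
  define q' where "q' = (1 + q) / 2"
  have q': "q < q'" "q' < 1" "0 < q'" using q by (auto simp: q'_def)
  define V where "V = U \<inter> {p \<in> box a b. q' < \<kappa> p}"
  have "open V" "p0 \<in> V" using U p0 q' \<kappa>0 opn[OF \<kappa>] by (auto simp: V_def)
  then obtain c d where cd: "cbox c d \<subseteq> V" "\<forall>i\<in>Basis. c \<bullet> i < d \<bullet> i"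
    by (rule open_contains_cbox)
  have cdab: "cbox c d \<subseteq> cbox a b" using cd(1) sub by (auto simp: V_def)
  have vol: "measure lborel (cbox c d) > 0" using cd(2) by (rule content_pos_lt)
  obtain B where B: "\<And>p. p \<in> cbox a b \<Longrightarrow> \<bar>H p\<bar> \<le> B"
    using compact_imp_bounded[OF compact_continuous_image[OF H compact_cbox]]
    unfolding bounded_iff by auto
  have B0: "B \<ge> 0" using B[of p0] p0 sub by (meson abs_ge_zero order_trans subsetD)
  have "(\<lambda>n. (q / q') ^ n) \<longlonglongrightarrow> 0"
    using q q' by (intro LIMSEQ_power_zero) auto
  then have "(\<lambda>n. (q / q') ^ n * (B * measure lborel (cbox a b))) \<longlonglongrightarrow> 0"
    by (rule tendsto_mult_left_zero)
  then have "\<forall>\<^sub>F n in sequentially. (q / q') ^ n * (B * measure lborel (cbox a b)) < \<eta> * measure lborel (cbox c d)"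
    by (rule order_tendstoD) (use \<eta> vol in auto)
  then obtain n where "(q / q') ^ n * (B * measure lborel (cbox a b)) < \<eta> * measure lborel (cbox c d)"
    using eventually_happens by force
  then have n: "q ^ n * (B * measure lborel (cbox a b)) < \<eta> * q' ^ n * measure lborel (cbox c d)"
    using q' by (simp add: power_divide field_simps)
  have 1: "((\<lambda>p. if p \<in> cbox c d then \<eta> * q' ^ n else 0) has_integral (measure lborel (cbox c d) *\<^sub>R (\<eta> * q' ^ n))) (cbox a b)"
    by (rule has_integral_restrict_closed_subinterval[OF has_integral_const cdab])
  have 2: "((\<lambda>p. B * q ^ n) has_integral (measure lborel (cbox a b) *\<^sub>R (B * q ^ n))) (cbox a b)"
    by (rule has_integral_const)
  have 3: "((\<lambda>p. H p * \<kappa> p ^ n) has_integral integral (cbox a b) (\<lambda>p. H p * \<kappa> p ^ n)) (cbox a b)"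
    by (intro integrable_integral integrable_continuous continuous_intros H \<kappa>)
  have "measure lborel (cbox c d) *\<^sub>R (\<eta> * q' ^ n) - measure lborel (cbox a b) *\<^sub>R (B * q ^ n)
      \<le> integral (cbox a b) (\<lambda>p. H p * \<kappa> p ^ n)"
  proof (rule has_integral_le[OF has_integral_diff[OF 1 2] 3])
    fix p assume p: "p \<in> cbox a b"
    show "(if p \<in> cbox c d then \<eta> * q' ^ n else 0) - B * q ^ n \<le> H p * \<kappa> p ^ n"
    proof (cases "p \<in> U")
      case True
      have "(if p \<in> cbox c d then \<eta> * q' ^ n else 0) \<le> \<eta> * \<kappa> p ^ n"
      proof (cases "p \<in> cbox c d")
        case True
        then have "q' \<le> \<kappa> p" using cd(1) by (force simp: V_def)
        then have "q' ^ n \<le> \<kappa> p ^ n" using q' by (intro power_mono) auto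
        then show ?thesis using True \<eta> by simp
      qed (use \<eta> nonneg[OF p] in simp)
      also have "\<dots> \<le> H p * \<kappa> p ^ n"
        using True nonneg[OF p] by (intro mult_right_mono) (auto simp: U_def)
      finally show ?thesis using B0 q by (simp add: diff_le_eq add_increasing2)
    next
      case False
      then have "p \<notin> cbox c d" using cd(1) by (auto simp: V_def)
      moreover have "\<bar>H p * \<kappa> p ^ n\<bar> \<le> B * q ^ n"
        using B[OF p] B0 nonneg[OF p] q(3)[of p] p False
        unfolding abs_mult by (intro mult_mono) (auto simp: power_mono)
      ultimately show ?thesis by auto
    qed
  qed
  moreover have "measure lborel (cbox c d) *\<^sub>R (\<eta> * q' ^ n) - measure lborel (cbox a b) *\<^sub>R (B * q ^ n) > 0"
    using n by (simp add: mult_ac)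
  ultimately show ?thesis by (intro exI[of _ n]) linarith
qed

context torus
begin

section \<open>Uniqueness and inversion of Fourier series\<close>

lemma v_nonzero: "v1 \<noteq> 0" "v2 \<noteq> 0"
  using independent_v dependent_zero by blast+

text \<open>Each dual vector is the other generator turned by a right angle and rescaled. The
  pairing divided by is nonzero, since only the zero vector is orthogonal to both
  generators.\<close>

lemma dual_basis:
  obtains w1 w2 where "w1 \<in> D" "w2 \<in> D" "w1 \<bullet> v1 = 2 * pi" "w1 \<bullet> v2 = 0" "w2 \<bullet> v1 = 0" "w2 \<bullet> v2 = 2 * pi"
proof -
  define perp :: "real^2 \<Rightarrow> real^2" where "perp b = vector [b $ 2, - b $ 1]" for b
  have perp: "perp b \<bullet> b = 0" for b
    by (simp add: perp_def inner_vec_def sum_2)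
  have perp0: "b = 0" if "perp b = 0" for b
    using that by (simp add: perp_def vec_eq_iff forall_2)
  have ne: "perp v2 \<bullet> v1 \<noteq> 0" "perp v1 \<bullet> v2 \<noteq> 0"
  proof -
    have "c = 0" if "c \<bullet> v1 = 0" "c \<bullet> v2 = 0" for c
    proof -
      obtain s t where "c = s *\<^sub>R v1 + t *\<^sub>R v2" using coordinates by blast
      then have "c \<bullet> c = s * (c \<bullet> v1) + t * (c \<bullet> v2)"
        by (metis inner_add_right inner_scaleR_right)
      then show ?thesis using that by simp
    qed
    then show "perp v2 \<bullet> v1 \<noteq> 0" "perp v1 \<bullet> v2 \<noteq> 0"
      using perp perp0 v_nonzero by blast+
  qed
  have D: "w \<in> D" if "w \<bullet> v1 = 2 * pi * of_int i" "w \<bullet> v2 = 2 * pi * of_int j" for w and i j :: int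
    unfolding dual_lattice_def lattice_def
  proof (intro CollectI ballI)
    fix l assume "l \<in> {of_int m *\<^sub>R v1 + of_int n *\<^sub>R v2 | m n :: int. True}"
    then obtain m n :: int where "l = of_int m *\<^sub>R v1 + of_int n *\<^sub>R v2" by blast
    then show "\<exists>n::int. w \<bullet> l = 2 * pi * of_int n"
      using that by (intro exI[of _ "m * i + n * j"]) (simp add: inner_add_right algebra_simps)
  qed
  define w1 where "w1 = (2 * pi / (perp v2 \<bullet> v1)) *\<^sub>R perp v2"
  define w2 where "w2 = (2 * pi / (perp v1 \<bullet> v2)) *\<^sub>R perp v1"
  have w: "w1 \<bullet> v1 = 2 * pi" "w1 \<bullet> v2 = 0" "w2 \<bullet> v1 = 0" "w2 \<bullet> v2 = 2 * pi"
    using ne perp by (auto simp: w1_def w2_def)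
  show ?thesis
    by (rule that[OF _ _ w]) (use w D[of w1 1 0] D[of w2 0 1] in auto)
qed

lemma cos_wave: "complex_of_real (cos (w \<bullet> (y - x))) = (wave (- w) x * wave w y + wave w x * wave (- w) y) / 2"
proof -
  have "complex_of_real (cos (w \<bullet> (y - x))) = cos (complex_of_real (w \<bullet> (y - x)))"
    by (simp add: cos_of_real)
  also have "\<dots> = (exp (\<i> * complex_of_real (w \<bullet> (y - x))) + exp (- \<i> * complex_of_real (w \<bullet> (y - x)))) / 2"
    by (simp add: cos_exp_eq)
  also have "\<dots> = (wave (- w) x * wave w y + wave w x * wave (- w) y) / 2"
    by (simp add: wave_def exp_add[symmetric] inner_diff_right algebra_simps)
  finally show ?thesis .
qed

text \<open>Following Rudin, \<open>g\<close> is tested against the trigonometric polynomials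
  \<open>((1 + cos) / 2) ^ n\<close>, which concentrate at a single point of the cell.\<close>

lemma fourier_unique:
  assumes g: "continuous_on UNIV g" and per: "\<And>x l. l \<in> L \<Longrightarrow> g (x + l) = g x"
    and zero: "\<And>k. k \<in> D \<Longrightarrow> fourier g k = 0"
  shows "g x = 0"
proof -
  obtain w1 w2 where w: "w1 \<in> D" "w2 \<in> D" "w1 \<bullet> v1 = 2 * pi" "w1 \<bullet> v2 = 0" "w2 \<bullet> v1 = 0" "w2 \<bullet> v2 = 2 * pi"
    by (rule dual_basis)
  define \<phi> where "\<phi> p = fst p *\<^sub>R v1 + snd p *\<^sub>R v2" for p :: "real \<times> real"
  have inner: "w1 \<bullet> (\<phi> p - \<phi> p') = 2 * pi * (fst p - fst p')" "w2 \<bullet> (\<phi> p - \<phi> p') = 2 * pi * (snd p - snd p')" for p p'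
    using w by (auto simp: \<phi>_def inner_diff_right inner_add_right algebra_simps)
  have "g (\<phi> p0) = 0" if p0: "p0 \<in> box (0, 0) (1, 1)" for p0
  proof (rule ccontr)
    assume ne: "g (\<phi> p0) \<noteq> 0"
    \<comment> \<open>\<open>Q f\<close> says that \<open>g * f\<close> has no Fourier coefficients.
      Multiplying \<open>f\<close> by a factor \<open>(1 + cos) / 2\<close> only shifts frequencies
      within the dual lattice, so the property survives.\<close>
    define Q where "Q f \<longleftrightarrow> continuous_on UNIV f \<and> (\<forall>k\<in>D. mean (\<lambda>y. wave k y * (g y * f y)) = 0)" for f
    have Q_step: "Q (\<lambda>y. complex_of_real ((1 + cos (w \<bullet> (y - x))) / 2) * f y)" if "Q f" "w \<in> D" for f w x
      unfolding Q_def
    proof (intro conjI ballI)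
      have f: "continuous_on UNIV f" "\<And>k. k \<in> D \<Longrightarrow> mean (\<lambda>y. wave k y * (g y * f y)) = 0"
        using that by (auto simp: Q_def)
      show "continuous_on UNIV (\<lambda>y. complex_of_real ((1 + cos (w \<bullet> (y - x))) / 2) * f y)"
        by (intro continuous_intros f(1)) auto
      fix k assume k: "k \<in> D"
      have c: "continuous_on UNIV (\<lambda>y. wave j y * (g y * f y))" for j
        by (intro continuous_intros continuous_wave g f(1))
      have lin: "mean (\<lambda>y. a1 * f1 y + (a2 * f2 y + a3 * f3 y)) = a1 * mean f1 + (a2 * mean f2 + a3 * mean f3)"
        if "continuous_on UNIV f1" "continuous_on UNIV f2" "continuous_on UNIV f3"
        for a1 a2 a3 and f1 f2 f3 :: "real^2 \<Rightarrow> complex"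
        using that by (simp add: mean_add mean_cmult continuous_on_add continuous_on_mult_left)
      have eq: "wave k y * (g y * (complex_of_real ((1 + cos (w \<bullet> (y - x))) / 2) * f y)) =
        1/2 * (wave k y * (g y * f y)) + (wave (- w) x / 4 * (wave (k + w) y * (g y * f y)) +
             wave w x / 4 * (wave (k + (- w)) y * (g y * f y)))" for y
        unfolding wave_add
        by (simp only: of_real_divide of_real_add of_real_1 of_real_numeral cos_wave, simp add: field_simps)
      show "mean (\<lambda>y. wave k y * (g y * (complex_of_real ((1 + cos (w \<bullet> (y - x))) / 2) * f y))) = 0"
        unfolding eq lin[OF c c c]
        using f(2)[OF k] f(2)[OF dual_lattice_add[OF k that(2)]]
          f(2)[OF dual_lattice_add[OF k dual_lattice_uminus[OF that(2)]]]
        by simp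
    qed
    define K where "K y = (1 + cos (w1 \<bullet> (y - \<phi> p0))) / 2 * ((1 + cos (w2 \<bullet> (y - \<phi> p0))) / 2)" for y
    have QK: "Q (\<lambda>y. complex_of_real (K y ^ n))" for n
    proof (induction n)
      case 0
      have "(\<lambda>y. wave k y * g y) = (\<lambda>y. wave (- (- k)) y * g y)" for k by simp
      then have "mean (\<lambda>y. wave k y * g y) = fourier g (- k)" for k unfolding fourier_def by simp
      then show ?case using zero dual_lattice_uminus by (auto simp: Q_def)
    next
      case (Suc n)
      from Q_step[OF Q_step[OF Suc w(2)] w(1)] show ?case
        by (simp add: K_def mult.assoc)
    qed
    \<comment> \<open>Dividing by the value at the peak makes the real part equal to 1
      there.\<close>
    define H where "H y = Re (g y / g (\<phi> p0))" for y
    have Hc: "continuous_on UNIV H" unfolding H_def by (intro continuous_intros g) (use ne in auto)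
    have Kc: "continuous_on UNIV K" unfolding K_def by (intro continuous_intros) auto
    have zero: "mean (\<lambda>y. H y * K y ^ n) = 0" for n
    proof -
      have "mean (\<lambda>y. g y * complex_of_real (K y ^ n)) = 0"
        using QK[of n] dual_lattice_zero unfolding Q_def by force
      moreover have "continuous_on UNIV (\<lambda>y. g y * complex_of_real (K y ^ n))"
        by (intro continuous_intros g Kc)
      moreover have "bounded_linear (\<lambda>z. Re (z / g (\<phi> p0)))"
        by (intro bounded_linear_compose[OF bounded_linear_Re] bounded_linear_divide)
      ultimately have "mean (\<lambda>y. Re (g y * complex_of_real (K y ^ n) / g (\<phi> p0))) = 0"
        using mean_bounded_linear by fastforce
      moreover have "Re (g y * complex_of_real (K y ^ n) / g (\<phi> p0)) = H y * K y ^ n" for y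
      proof -
        have "g y * complex_of_real (K y ^ n) / g (\<phi> p0) = g y / g (\<phi> p0) * complex_of_real (K y ^ n)" by simp
        then show ?thesis unfolding H_def by (simp only: Re_complex_of_real times_complex.sel Im_complex_of_real mult_zero_right diff_zero)
      qed
      ultimately show ?thesis by simp
    qed
    have "\<exists>n. integral (cbox (0, 0) (1, 1)) (\<lambda>p. H (\<phi> p) * K (\<phi> p) ^ n) > 0"
    proof (rule integral_peak[OF _ _ p0])
      show "continuous_on (cbox (0, 0) (1, 1)) (\<lambda>p. H (\<phi> p))" "continuous_on (cbox (0, 0) (1, 1)) (\<lambda>p. K (\<phi> p))"
        unfolding \<phi>_def by (intro continuous_cell Hc Kc)+
      show "0 < H (\<phi> p0)" "K (\<phi> p0) = 1" using ne by (auto simp: H_def K_def)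
      have half: "0 \<le> (1 + cos r) / 2" "(1 + cos r) / 2 \<le> 1" for r :: real
      proof -
        have "0 \<le> 1 + cos r" "1 + cos r \<le> 2"
          using cos_ge_minus_one[of r] cos_le_one[of r] by linarith+
        then show "0 \<le> (1 + cos r) / 2" "(1 + cos r) / 2 \<le> 1" by auto
      qed
      show "0 \<le> K (\<phi> p)" for p unfolding K_def using half by (intro mult_nonneg_nonneg) auto
      fix p :: "real \<times> real" assume p: "p \<in> cbox (0, 0) (1, 1)" "p \<noteq> p0"
      \<comment> \<open>As \<open>p0\<close> is interior, coordinate differences stay strictly
        between -1 and 1, so the only point of the closed cell where both cosines are 1 is
        \<open>p0\<close>.\<close>
      have int: "r = 0" if cr: "cos (2 * pi * r) = 1" and r1: "\<bar>r\<bar> < 1" for r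
      proof -
        obtain n :: int where "2 * pi * r = of_int n * 2 * pi" using cr cos_one_2pi_int by blast
        then have "r = of_int n" by simp
        with r1 have "\<bar>n\<bar> < 1" by linarith
        then show ?thesis using \<open>r = of_int n\<close> by simp
      qed
      have bds: "fst p \<in> {0..1}" "snd p \<in> {0..1}" "fst p0 \<in> {0<..<1}" "snd p0 \<in> {0<..<1}"
        using p(1) p0 by (cases p; cases p0; force simp: mem_box Basis_prod_def)+
      then have lt: "\<bar>fst p - fst p0\<bar> < 1" "\<bar>snd p - snd p0\<bar> < 1" by auto
      define A B where "A = (1 + cos (2 * pi * (fst p - fst p0))) / 2"
        and "B = (1 + cos (2 * pi * (snd p - snd p0))) / 2"
      have K: "K (\<phi> p) = A * B" unfolding K_def inner A_def B_def ..
      have AB: "0 \<le> A" "A \<le> 1" "0 \<le> B" "B \<le> 1" unfolding A_def B_def using half by auto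
      have "A \<noteq> 1 \<or> B \<noteq> 1"
      proof (rule ccontr)
        assume "\<not> (A \<noteq> 1 \<or> B \<noteq> 1)"
        then have "cos (2 * pi * (fst p - fst p0)) = 1" "cos (2 * pi * (snd p - snd p0)) = 1"
          by (auto simp: A_def B_def)
        from int[OF this(1) lt(1)] int[OF this(2) lt(2)]
        have "fst p - fst p0 = 0" "snd p - snd p0 = 0" .
        then show False using p(2) by (auto simp: prod_eq_iff)
      qed
      moreover have "A * B \<le> A" "A * B \<le> B" using AB by (auto simp: mult_left_le mult_left_le_one_le)
      ultimately show "K (\<phi> p) < 1" unfolding K using AB by linarith
    qed
    then show False using zero unfolding mean_def \<phi>_def by (metis less_irrefl)
  qed
  \<comment> \<open>Boundary points of the cell are reached by closure.\<close>
  moreover have "closed {p. g (\<phi> p) = 0}"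
  proof -
    have "continuous_on UNIV (\<lambda>p. g (\<phi> p))" unfolding \<phi>_def by (rule continuous_cell[OF g])
    then show ?thesis by (intro closed_Collect_eq) auto
  qed
  ultimately have "closure (box (0, 0) (1, 1)) \<subseteq> {p. g (\<phi> p) = 0}"
    by (intro closure_minimal) auto
  moreover have "box (0::real, 0::real) (1, 1) \<noteq> {}"
    by (auto simp: box_ne_empty Basis_prod_def)
  ultimately have cell: "p \<in> cbox (0, 0) (1, 1) \<Longrightarrow> g (\<phi> p) = 0" for p by auto
  obtain s t l where "s \<in> {0..1}" "t \<in> {0..1}" "l \<in> L" "x = s *\<^sub>R v1 + t *\<^sub>R v2 + l"
    by (rule fundamental_cell)
  then show ?thesis using cell[of "(s, t)"] per by (auto simp: \<phi>_def cbox_Pair_eq)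
qed

lemma one_plus_norm_le: "1 + norm k \<le> 2 * (1 + (norm k)\<^sup>2)"
proof -
  have "0 \<le> (norm k - 1)\<^sup>2" by simp
  then have "2 * norm k \<le> (norm k)\<^sup>2 + 1" by (simp add: power2_eq_square algebra_simps)
  then show ?thesis using zero_le_power2[of "norm k"] unfolding distrib_left by linarith
qed

text \<open>Any polynomial growth is traded for enough powers of \<open>1 + |k|^2\<close>: with
  \<open>r \<le> p\<close>, the power \<open>p\<close> absorbs the growth and two more leave the
  weight.\<close>

lemma weight_absorb:
  obtains N :: nat and C :: real where "C \<ge> 0"
    "\<And>k. (1 + norm k) powr r / (1 + (norm k)\<^sup>2) ^ N \<le> C * decay_weight k"
proof -
  obtain p :: nat where p: "r \<le> real p" using real_arch_simple by blast
  have "(1 + norm k) powr r / (1 + (norm k)\<^sup>2) ^ (p + 2) \<le> 2 ^ p * decay_weight k" for k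
  proof -
    have pos: "0 < 1 + (norm k)\<^sup>2" by (simp add: add_pos_nonneg)
    have "(1 + norm k) powr r \<le> (1 + norm k) powr (real p)"
      using p by (intro one_plus_powr_mono)
    also have "\<dots> = (1 + norm k) ^ p" by (simp add: powr_realpow add_pos_nonneg)
    also have "\<dots> \<le> (2 * (1 + (norm k)\<^sup>2)) ^ p"
      by (intro power_mono one_plus_norm_le) auto
    finally have "(1 + norm k) powr r / (1 + (norm k)\<^sup>2) ^ (p + 2) \<le> (2 * (1 + (norm k)\<^sup>2)) ^ p / (1 + (norm k)\<^sup>2) ^ (p + 2)"
      using pos by (intro divide_right_mono) auto
    also have "\<dots> = 2 ^ p * decay_weight k"
    proof -
      have "(2 * A) ^ p / A ^ (p + 2) = 2 ^ p * (1 / A\<^sup>2)" if "A > 0" for A :: real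
        using that by (simp add: power_mult_distrib power_add power2_eq_square)
      from this[OF pos] show ?thesis by (simp add: decay_weight_def)
    qed
    finally show ?thesis .
  qed
  then show ?thesis by (intro that[of "2 ^ p" "p + 2"]) auto
qed

lemma fourier_weight:
  assumes "u \<in> SP"
  obtains C where "C \<ge> 0" "\<And>k. k \<in> D \<Longrightarrow> (1 + norm k) powr r * norm (fourier u k) \<le> C * decay_weight k"
proof -
  obtain N :: nat and B where B: "B \<ge> 0" "\<And>k. (1 + norm k) powr r / (1 + (norm k)\<^sup>2) ^ N \<le> B * decay_weight k"
    using weight_absorb[where r = r] by metis
  obtain C where C: "C \<ge> 0" "\<And>k. k \<in> D \<Longrightarrow> norm (fourier u k) \<le> C / (1 + (norm k)\<^sup>2) ^ N"
    using fourier_decay[OF assms, where n = N] by metis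
  have "(1 + norm k) powr r * norm (fourier u k) \<le> C * B * decay_weight k" if "k \<in> D" for k
  proof -
    have "(1 + norm k) powr r * norm (fourier u k) \<le> (1 + norm k) powr r * (C / (1 + (norm k)\<^sup>2) ^ N)"
      using C(2)[OF that] by (intro mult_left_mono) auto
    also have "\<dots> = C * ((1 + norm k) powr r / (1 + (norm k)\<^sup>2) ^ N)" by simp
    also have "\<dots> \<le> C * (B * decay_weight k)" using B(2) C(1) by (intro mult_left_mono) auto
    finally show ?thesis by simp
  qed
  then show ?thesis using B(1) C(1) by (intro that[of "C * B"]) auto
qed

text \<open>The Fourier series converges uniformly to a continuous periodic function with the same
  coefficients as \<open>u\<close>; \<open>fourier_unique\<close> applied to the difference
  identifies the two.\<close>

theorem fourier_inversion:
  assumes u: "u \<in> SP"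
  shows "((\<lambda>k. fourier u k * wave k x) has_sum u x) D"
proof -
  obtain C where C: "C \<ge> 0" "\<And>k. k \<in> D \<Longrightarrow> (1 + norm k) powr 0 * norm (fourier u k) \<le> C * decay_weight k"
    using fourier_weight[OF u, where r = 0] by metis
  have pow: "(1 + norm k) powr 0 = 1" for k :: "real^2"
    by (simp add: add_nonneg_eq_0_iff)
  have bd: "norm (fourier u k * wave k y) \<le> C * decay_weight k" if "k \<in> D" for k y
    using C(2)[OF that] unfolding pow by (simp add: norm_mult)
  have CW: "(\<lambda>k. C * decay_weight k) summable_on D" by (rule summable_on_cmult_right[OF decay_weight_summable])
  define v where "v y = (\<Sum>\<^sub>\<infinity>k\<in>D. fourier u k * wave k y)" for y
  have vc: "continuous_on UNIV v"
    unfolding v_def by (rule mean_infsum(2)[OF _ bd CW]) (intro continuous_intros continuous_wave)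
  have fcv: "fourier v j = fourier u j" if j: "j \<in> D" for j
  proof -
    have A: "((\<lambda>k. mean (\<lambda>y. wave (- j) y * (fourier u k * wave k y))) has_sum
        mean (\<lambda>y. \<Sum>\<^sub>\<infinity>k\<in>D. wave (- j) y * (fourier u k * wave k y))) D"
      by (rule mean_infsum(1)[OF _ _ CW]) (use bd in \<open>auto simp: norm_mult intro!: continuous_intros continuous_wave\<close>)
    have eq: "mean (\<lambda>y. wave (- j) y * (fourier u k * wave k y)) = (if k = j then fourier u k else 0)" if "k \<in> D" for k
    proof -
      have "mean (\<lambda>y. wave (- j) y * (fourier u k * wave k y)) = fourier (\<lambda>y. fourier u k * wave k y) j" by (simp add: fourier_def)
      also have "\<dots> = fourier u k * fourier (wave k) j" by (rule fourier_cmult[OF continuous_wave])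
      finally show ?thesis using fourier_wave[OF that j] by simp
    qed
    have "((\<lambda>k. if k = j then fourier u k else 0) has_sum
        mean (\<lambda>y. \<Sum>\<^sub>\<infinity>k\<in>D. wave (- j) y * (fourier u k * wave k y))) D"
      by (rule has_sum_cong[THEN iffD1, rotated, OF A]) (rule eq)
    moreover have "((\<lambda>k. if k = j then fourier u k else 0) has_sum fourier u j) D"
      using has_sum_finite_neutralI[of "{j}" D "\<lambda>k. if k = j then fourier u k else 0" "fourier u j"] j by auto
    ultimately have "mean (\<lambda>y. \<Sum>\<^sub>\<infinity>k\<in>D. wave (- j) y * (fourier u k * wave k y)) = fourier u j"
      using has_sum_unique by blast
    moreover have "(\<Sum>\<^sub>\<infinity>k\<in>D. wave (- j) y * (fourier u k * wave k y)) = wave (- j) y * v y" for y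
      unfolding v_def by (rule infsum_cmult_right')
    ultimately show ?thesis by (simp add: fourier_def)
  qed
  have per: "v (y + l) = v y" if "l \<in> L" for y l
    unfolding v_def by (intro infsum_cong) (simp add: wave_periodic that)
  have "u x - v x = 0"
  proof (rule fourier_unique[where g = "\<lambda>x. u x - v x"])
    show "continuous_on UNIV (\<lambda>x. u x - v x)" by (intro continuous_intros smooth_periodicD(3)[OF u] vc)
    show "u (x + l) - v (x + l) = u x - v x" if "l \<in> L" for x l
      using smooth_periodicD(2)[OF u that] per[OF that] by simp
    show "fourier (\<lambda>x. u x - v x) k = 0" if "k \<in> D" for k
      using fcv[OF that] by (simp add: fourier_diff smooth_periodicD(3)[OF u] vc)
  qed
  moreover have "(\<lambda>k. fourier u k * wave k x) summable_on D"
    by (rule summable_on_bounded(1)[OF decay_weight_summable bd])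
  ultimately show ?thesis by (simp add: has_sum_iff v_def)
qed

end


section \<open>Composition of symbols\<close>

context torus
begin

section \<open>Fourier coefficients of symbols in the position variable\<close>

definition hat :: "(phase \<Rightarrow> complex) \<Rightarrow> real^2 \<Rightarrow> real^2 \<Rightarrow> complex" where
  "hat t l k = fourier (\<lambda>y. t (y, k)) l"

text \<open>The second variable is left general so that the definition serves symbols as well as
  functions on the strip.\<close>

definition bessel_symbol :: "((real^2) \<times> 'c::real_normed_vector \<Rightarrow> complex) \<Rightarrow> (real^2) \<times> 'c \<Rightarrow> complex" where
  "bessel_symbol t q = t q - (\<Sum>i\<in>UNIV. dderiv (axis i 1, 0) (dderiv (axis i 1, 0) t) q)"

lemma Basis_axis: "(axis i 1, 0) \<in> (Basis :: phase set)"
  "(0, axis i 1) \<in> (Basis :: phase set)"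
  by (auto simp: Basis_prod_def Basis_vec_def)

lemma bessel_symbol:
  assumes "t \<in> S m"
  shows "bessel_symbol t \<in> S m"
proof -
  have "dderiv (axis i 1, 0) (dderiv (axis i 1, 0) t) \<in> S m" for i
    using symbol_class_dderiv[OF symbol_class_dderiv[OF assms Basis_axis(1)] Basis_axis(1), of i i] by simp
  then show ?thesis
    unfolding bessel_symbol_def[abs_def]
    by (intro symbol_class_diff_closed assms symbol_class_sum)
qed

lemma dderiv_slice: "dderiv v (\<lambda>y. t (y, k)) = (\<lambda>y. dderiv (v, 0) t (y, k))"
  by (rule ext) (simp add: dderiv_def)

lemma bessel_funpow_slice: "(bessel ^^ n) (\<lambda>y. t (y, k)) = (\<lambda>y. (bessel_symbol ^^ n) t (y, k))"
proof (induction n)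
  case (Suc n)
  have "bessel (\<lambda>y. s (y, k)) = (\<lambda>y. bessel_symbol s (y, k))" for s
    by (rule ext) (simp add: bessel_def bessel_symbol_def dderiv_slice)
  then show ?case using Suc by simp
qed simp

text \<open>Position derivatives do not raise the order, so the Bessel iterates of \<open>t\<close>
  have order \<open>m\<close> too; this gives decay in \<open>l\<close> and growth in
  \<open>k\<close> at the same time.\<close>

lemma hat_decay:
  assumes t: "t \<in> S m"
  obtains C where "C \<ge> 0"
    "\<And>l k. l \<in> D \<Longrightarrow> norm (hat t l k) \<le> C * (1 + norm k) powr m / (1 + (norm l)\<^sup>2) ^ n"
proof -
  have "(bessel_symbol ^^ n) t \<in> S m" by (induction n) (auto simp: t intro: bessel_symbol)
  then obtain C where C: "C \<ge> 0" "\<And>x k. norm ((bessel_symbol ^^ n) t (x, k)) \<le> C * (1 + norm k) powr m"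
    using symbol_class_bound by blast
  have "norm (hat t l k) \<le> C * (1 + norm k) powr m / (1 + (norm l)\<^sup>2) ^ n" if "l \<in> D" for l k
    unfolding hat_def
    by (rule fourier_decay_explicit[OF symbol_slice[OF t] that]) (simp add: bessel_funpow_slice C(2))
  then show ?thesis using that C(1) by blast
qed

text \<open>Differentiation under the integral over the cell; the momentum \<open>k\<close> is a
  real variable here, not a lattice point.\<close>

lemma hat_has_derivative:
  assumes t: "t \<in> S m"
  shows "(hat t l has_derivative (\<lambda>h. hat (dderiv (0, h) t) l k)) (at k)"
proof -
  define \<phi> where "\<phi> p = fst p *\<^sub>R v1 + snd p *\<^sub>R v2" for p :: "real \<times> real"
  have cphi: "continuous_on A \<phi>" for A unfolding \<phi>_def by (intro continuous_intros)
  define f where "f k p = wave (- l) (\<phi> p) * t (\<phi> p, k)" for k p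
  have der: "(f k' p) = wave (- l) (\<phi> p) * t (\<phi> p, k')" for k' p by (simp add: f_def)
  have t_der: "((\<lambda>k. t (y, k)) has_derivative (\<lambda>h. dderiv (0, h) t (y, k))) (at k)" for y k
  proof -
    have "((\<lambda>k. (y, k)) has_derivative (\<lambda>h. (0, h))) (at k)"
      by (auto intro!: derivative_eq_intros)
    from has_derivative_compose[OF this has_derivative_dderiv[OF symbol_class_diff[OF t]]]
    show ?thesis .
  qed
  have f_der: "((\<lambda>k. f k p) has_derivative (\<lambda>h. wave (- l) (\<phi> p) * dderiv (0, h) t (\<phi> p, k))) (at k)" for p k
    unfolding f_def by (intro has_derivative_mult_right t_der)
  \<comment> \<open>The derivative is packed as a bounded linear map because
    \<open>leibniz_rule\<close> integrates it as one object.\<close>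
  define f' where "f' k p = Blinfun (\<lambda>h. wave (- l) (\<phi> p) * dderiv (0, h) t (\<phi> p, k))" for k p
  have f': "blinfun_apply (f' k p) = (\<lambda>h. wave (- l) (\<phi> p) * dderiv (0, h) t (\<phi> p, k))" for k p
    unfolding f'_def by (rule bounded_linear_Blinfun_apply[OF has_derivative_bounded_linear[OF f_der]])
  have cont: "continuous_on A (\<lambda>q. wave (- l) (\<phi> (g q)) * s (\<phi> (g q), h q))"
    if "continuous_on UNIV s" "continuous_on A g" "continuous_on A h" for s g h and A :: "'x::topological_space set"
    by (intro continuous_intros continuous_on_compose2[OF continuous_wave[of UNIV]]
        continuous_on_compose2[OF that(1)] continuous_on_compose2[OF cphi[of UNIV]] that(2,3)) auto
  have smooth: "continuous_on UNIV (dderiv v t)" for v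
    by (rule smooth_on_continuous[OF smooth_on_dderiv[OF symbol_class_smooth[OF t]]])
  have c': "continuous_on (UNIV \<times> cbox (0, 0) (1, 1)) (\<lambda>(k, p). f' k p)"
    unfolding case_prod_unfold
    by (rule continuous_on_blinfun_componentwise, unfold f', rule cont[of _ _ snd fst])
      (auto intro!: smooth continuous_intros)
  have "((\<lambda>k. integral (cbox (0, 0) (1, 1)) (f k)) has_derivative
      blinfun_apply (integral (cbox (0, 0) (1, 1)) (f' k))) (at k within UNIV)"
  proof (rule leibniz_rule[OF _ _ c'])
    show "f k integrable_on cbox (0, 0) (1, 1)" for k
      unfolding f_def[abs_def]
      by (rule integrable_continuous, rule cont[of _ _ "\<lambda>p. p" "\<lambda>p. k"])
        (auto intro: symbol_class_continuous[OF t])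
    show "((\<lambda>k. f k p) has_derivative blinfun_apply (f' k p)) (at k within UNIV)" for k p
      unfolding f' using f_der by simp
  qed auto
  moreover have eq': "blinfun_apply (integral (cbox (0, 0) (1, 1)) (f' k)) h = hat (dderiv (0, h) t) l k" for h
  proof -
    have "f' k integrable_on cbox (0, 0) (1, 1)"
      by (intro integrable_continuous continuous_on_compose2[OF c', of _ "\<lambda>p. (k, p)", simplified])
        (auto intro!: continuous_intros)
    from integral_linear[OF this bounded_linear_blinfun_apply[OF bounded_linear_ident]]
    have "blinfun_apply (integral (cbox (0, 0) (1, 1)) (f' k)) h =
        integral (cbox (0, 0) (1, 1)) (\<lambda>p. f' k p h)"
      using integral_linear[OF \<open>f' k integrable_on _\<close> blinfun.bounded_linear_left[of h]] by (simp add: o_def)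
    then show ?thesis by (simp add: f' hat_def fourier_def mean_def \<phi>_def)
  qed
  moreover have "(\<lambda>k. integral (cbox (0, 0) (1, 1)) (f k)) = hat t l"
    by (rule ext) (simp add: f_def[abs_def] hat_def fourier_def mean_def \<phi>_def)
  moreover have "blinfun_apply (integral (cbox (0, 0) (1, 1)) (f' k)) = (\<lambda>h. hat (dderiv (0, h) t) l k)"
    by (rule ext) (rule eq')
  ultimately show ?thesis by simp
qed

lemma hat_dderiv_position:
  assumes "t \<in> S m" "l \<in> D"
  shows "hat (dderiv (v, 0) t) l k = \<i> * complex_of_real (l \<bullet> v) * hat t l k"
  unfolding hat_def dderiv_slice[symmetric] by (rule fourier_dderiv[OF symbol_slice[OF assms(1)] assms(2)])

text \<open>For \<open>\<sigma> = 0\<close> the sum over \<open>l\<close> is the composed symbol; for \<open>\<sigma> = 1\<close> it is the composed symbol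
  minus the product. Both are derivations in each variable, so coinduction reduces their symbol
  estimates to order zero.\<close>

definition comp_term :: "real \<Rightarrow> (phase \<Rightarrow> complex) \<Rightarrow> (phase \<Rightarrow> complex) \<Rightarrow>
    real^2 \<Rightarrow> phase \<Rightarrow> complex" where
  "comp_term \<sigma> s t l q = (s (fst q, snd q + l) - \<sigma> *\<^sub>R s q) * (hat t l (snd q) * wave l (fst q))"

definition sharp :: "(phase \<Rightarrow> complex) \<Rightarrow> (phase \<Rightarrow> complex) \<Rightarrow>
    phase \<Rightarrow> complex" where
  "sharp s t q = (\<Sum>\<^sub>\<infinity>l\<in>D. comp_term 0 s t l q)"

text \<open>A position derivative falling on \<open>wave l\<close> brings down
  \<open>i (l . v)\<close>, exactly the factor by which the coefficient of the position derivative
  of \<open>t\<close> differs from \<open>hat t\<close>; a momentum derivative passes under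
  \<open>hat\<close>. Thus no third term appears.\<close>

lemma comp_term_dderiv:
  assumes s: "s \<in> S m" and t: "t \<in> S m'" and l: "l \<in> D"
  shows "comp_term \<sigma> s t l differentiable (at q)"
    "dderiv b (comp_term \<sigma> s t l) q = comp_term \<sigma> (dderiv b s) t l q + comp_term \<sigma> s (dderiv b t) l q"
proof -
  have 1: "((\<lambda>q. s (fst q, snd q + l) - \<sigma> *\<^sub>R s q) has_derivative
      (\<lambda>b. dderiv b s (fst q, snd q + l) - \<sigma> *\<^sub>R dderiv b s q)) (at q)"
  proof (intro has_derivative_diff has_derivative_scaleR_right has_derivative_dderiv symbol_class_diff[OF s])
    have "((\<lambda>q. (fst q, snd q + l)) has_derivative (\<lambda>b. (fst b, snd b))) (at q)"
      by (auto intro!: derivative_eq_intros)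
    from has_derivative_compose[OF this has_derivative_dderiv[OF symbol_class_diff[OF s]]]
    show "((\<lambda>q. s (fst q, snd q + l)) has_derivative (\<lambda>b. dderiv b s (fst q, snd q + l))) (at q)" by simp
  qed
  have fst_der: "(fst has_derivative fst) (at q)" and snd_der: "(snd has_derivative snd) (at q)"
    for q :: "phase"
    by (auto intro!: derivative_eq_intros)
  have 2: "((\<lambda>q. hat t l (snd q) * wave l (fst q)) has_derivative
      (\<lambda>b. hat t l (snd q) * (\<i> * complex_of_real (l \<bullet> fst b) * wave l (fst q)) +
           hat (dderiv (0, snd b) t) l (snd q) * wave l (fst q))) (at q)"
    by (rule has_derivative_mult[OF has_derivative_compose[OF snd_der hat_has_derivative[OF t]]
          has_derivative_compose[OF fst_der wave_has_derivative]])
  have sum: "dderiv b t = (\<lambda>p. dderiv (fst b, 0) t p + dderiv (0, snd b) t p)"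
  proof
    fix p
    have "linear (\<lambda>v. dderiv v t p)"
      using has_derivative_dderiv[OF symbol_class_diff[OF t]] has_derivative_linear by blast
    from linear_add[OF this, of "(fst b, 0)" "(0, snd b)"]
    show "dderiv b t p = dderiv (fst b, 0) t p + dderiv (0, snd b) t p" by simp
  qed
  have cont: "continuous_on UNIV (\<lambda>y. dderiv v t (y, k))" for v k
    by (intro continuous_on_compose2[OF smooth_on_continuous[OF smooth_on_dderiv[OF symbol_class_smooth[OF t]]]]
        continuous_intros) auto
  have "hat (dderiv b t) l k = hat (dderiv (fst b, 0) t) l k + hat (dderiv (0, snd b) t) l k" for k
    unfolding hat_def by (subst sum) (rule fourier_add[OF cont cont])
  then have hat_b: "hat (dderiv b t) l k = \<i> * complex_of_real (l \<bullet> fst b) * hat t l k + hat (dderiv (0, snd b) t) l k" for k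
    by (simp add: hat_dderiv_position[OF t l])
  note der = has_derivative_mult[OF 1 2]
  show "comp_term \<sigma> s t l differentiable (at q)"
    unfolding comp_term_def[abs_def] using der unfolding differentiable_def by blast
  show "dderiv b (comp_term \<sigma> s t l) q = comp_term \<sigma> (dderiv b s) t l q + comp_term \<sigma> s (dderiv b t) l q"
    unfolding comp_term_def[abs_def] dderiv_eq[OF der] hat_b by (simp add: algebra_simps)
qed

text \<open>Peetre's inequality. For negative \<open>m\<close> the triangle inequality is used with
  \<open>k\<close> and \<open>k + l\<close> exchanged.\<close>

lemma peetre: "(1 + norm (k + l)) powr m \<le> (1 + norm k) powr m * (1 + norm l) powr \<bar>m\<bar>"
proof (cases "m \<ge> 0")
  case True
  have "1 + norm (k + l) \<le> (1 + norm k) * (1 + norm l)"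
    using norm_triangle_ineq[of k l] mult_nonneg_nonneg[OF norm_ge_zero[of k] norm_ge_zero[of l]]
    unfolding distrib_left distrib_right mult_1_left mult_1_right by linarith
  then have "(1 + norm (k + l)) powr m \<le> ((1 + norm k) * (1 + norm l)) powr m"
    using True by (intro powr_mono2) auto
  then show ?thesis using True by (simp add: powr_mult)
next
  case False
  have "1 + norm k \<le> (1 + norm (k + l)) * (1 + norm l)"
    using norm_triangle_ineq4[of "k + l" l] mult_nonneg_nonneg[OF norm_ge_zero[of "k + l"] norm_ge_zero[of l]]
    unfolding distrib_left distrib_right mult_1_left mult_1_right add_diff_cancel_right' by linarith
  then have "((1 + norm (k + l)) * (1 + norm l)) powr m \<le> (1 + norm k) powr m"
    using False by (intro powr_mono2') (auto simp: add_pos_nonneg)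
  then have "(1 + norm (k + l)) powr m * (1 + norm l) powr m * (1 + norm l) powr \<bar>m\<bar> \<le> (1 + norm k) powr m * (1 + norm l) powr \<bar>m\<bar>"
    by (intro mult_right_mono) (auto simp: powr_mult)
  moreover have "(1 + norm l) powr m * (1 + norm l) powr \<bar>m\<bar> = 1"
    using False by (simp add: powr_add[symmetric] add_nonneg_eq_0_iff)
  ultimately show ?thesis by (simp add: mult.assoc)
qed

text \<open>For \<open>\<sigma> = 1\<close> the mean value inequality along the segment from
  \<open>k\<close> to \<open>k + l\<close> gains one order, and Peetre's inequality moves the
  estimate back to \<open>k\<close>. The additional 1 in the exponent of \<open>1 + |l|\<close> is
  the length of the segment.\<close>

lemma symbol_increment:
  fixes s :: "phase \<Rightarrow> complex"
  assumes s: "s \<in> S m" and \<sigma>: "\<sigma> = 0 \<or> \<sigma> = 1"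
  obtains C r where "C \<ge> 0"
    "\<And>x k l. norm (s (x, k + l) - \<sigma> *\<^sub>R s (x, k)) \<le> C * (1 + norm k) powr (m - \<sigma>) * (1 + norm l) powr r"
  using \<sigma>
proof
  assume 0: "\<sigma> = 0"
  obtain C where C: "C \<ge> 0" "\<And>x k. norm (s (x, k)) \<le> C * (1 + norm k) powr m"
    using symbol_class_bound[OF s] by blast
  have "norm (s (x, k + l)) \<le> C * (1 + norm k) powr m * (1 + norm l) powr \<bar>m\<bar>" for x k l
    using C(2)[of x "k + l"] mult_left_mono[OF peetre[of k l m] C(1)] by (simp add: mult.assoc)
  then show ?thesis using that[of C "\<bar>m\<bar>"] C(1) 0 by simp
next
  assume 1: "\<sigma> = 1"
  have "\<forall>i. \<exists>C. C \<ge> 0 \<and> (\<forall>x k. norm (dderiv (0, axis i 1) s (x, k)) \<le> C * (1 + norm k) powr (m - 1))"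
    using symbol_class_bound[OF symbol_class_dderiv[OF s Basis_axis(2)]] by (metis order_drop_Basis(2))
  then obtain C where C: "\<And>i. C i \<ge> 0"
    "\<And>i x k. norm (dderiv (0, axis i 1) s (x, k)) \<le> C i * (1 + norm k) powr (m - 1)" by metis
  define B where "B = C 1 + C 2"
  have B: "B \<ge> 0" using C(1) by (simp add: B_def)
  have der: "((\<lambda>k. s (x, k)) has_derivative (\<lambda>h. dderiv (0, h) s (x, k))) (at k within A)" for x k A
  proof -
    have "((\<lambda>k. (x, k)) has_derivative (\<lambda>h. (0, h))) (at k within A)"
      by (auto intro!: derivative_eq_intros)
    from has_derivative_compose[OF this has_derivative_dderiv[OF symbol_class_diff[OF s]]]
    show ?thesis .
  qed
  have on: "norm (dderiv (0, h) s (x, k)) \<le> B * (1 + norm k) powr (m - 1) * norm h" for h x k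
  proof -
    have "linear (\<lambda>h. dderiv (0, h) s (x, k))" using has_derivative_linear[OF der] .
    then have "dderiv (0, h) s (x, k) = (\<Sum>i\<in>UNIV. (h $ i) *\<^sub>R dderiv (0, axis i 1) s (x, k))"
      using linear_sum[of "\<lambda>h. dderiv (0, h) s (x, k)" "\<lambda>i. (h $ i) *\<^sub>R axis i 1" UNIV]
        linear_scale[of "\<lambda>h. dderiv (0, h) s (x, k)"] basis_expansion[of h]
      by (simp add: scalar_mult_eq_scaleR)
    also have "norm \<dots> \<le> (\<Sum>i\<in>UNIV. norm h * (C i * (1 + norm k) powr (m - 1)))"
      by (rule sum_norm_le) (auto intro!: mult_mono C simp: component_le_norm_cart)
    also have "\<dots> = B * (1 + norm k) powr (m - 1) * norm h"
      by (simp add: sum_2 B_def algebra_simps)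
    finally show ?thesis .
  qed
  have "norm (s (x, k + l) - s (x, k)) \<le> B * (1 + norm k) powr (m - 1) * (1 + norm l) powr (\<bar>m - 1\<bar> + 1)" for x k l
  proof -
    define M where "M = B * ((1 + norm k) powr (m - 1) * (1 + norm l) powr \<bar>m - 1\<bar>)"
    have "norm (s (x, k + l) - s (x, k)) \<le> M * norm (k + l - k)"
    proof (rule differentiable_bound[OF convex_closed_segment[of k "k + l"] der])
      fix z assume "z \<in> closed_segment k (k + l)"
      then obtain u where u: "0 \<le> u" "u \<le> 1" "z = k + u *\<^sub>R l"
        by (auto simp: in_segment algebra_simps)
      have "(1 + norm z) powr (m - 1) \<le> (1 + norm k) powr (m - 1) * (1 + norm (u *\<^sub>R l)) powr \<bar>m - 1\<bar>"
        unfolding u(3) by (rule peetre)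
      also have "\<dots> \<le> (1 + norm k) powr (m - 1) * (1 + norm l) powr \<bar>m - 1\<bar>"
        using u(1,2) by (intro mult_left_mono powr_mono2) (auto simp: mult_left_le_one_le)
      finally have "B * (1 + norm z) powr (m - 1) \<le> M" unfolding M_def using B by (intro mult_left_mono)
      then show "onorm (\<lambda>h. dderiv (0, h) s (x, z)) \<le> M"
        using on by (intro onorm_le order_trans[OF on] mult_right_mono) auto
    qed auto
    also have "\<dots> \<le> M * (1 + norm l) powr 1"
      using B by (intro mult_left_mono) (auto simp: M_def)
    also have "\<dots> = B * (1 + norm k) powr (m - 1) * (1 + norm l) powr (\<bar>m - 1\<bar> + 1)"
      by (simp add: M_def powr_add mult_ac)
    finally show ?thesis .
  qed
  then show ?thesis using that[of B "\<bar>m - 1\<bar> + 1"] B 1 by simp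
qed

text \<open>In order zero the shift costs only polynomial growth in \<open>l\<close>, absorbed by
  the rapid decay of \<open>hat t\<close>; what is left is the summable weight. The class lets
  symbols and orders vary so that the Leibniz terms remain in it.\<close>

lemma comp_term_family:
  assumes s: "s \<in> S m" and t: "t \<in> S m'" and \<sigma>: "\<sigma> = 0 \<or> \<sigma> = 1"
  shows "symbol_family v1 v2 D decay_weight (m + m' - \<sigma>) (comp_term \<sigma> s t)"
proof -
  define T where "T r g \<longleftrightarrow> (\<exists>m m' s t. s \<in> S m \<and> t \<in> S m' \<and> r = m + m' - \<sigma> \<and> g = comp_term \<sigma> s t)" for r g
  interpret symbol_family_coinduct v1 v2 D decay_weight T
  proof
    fix r g l q assume "T r g"
    then obtain m m' s t where s: "s \<in> S m" and t: "t \<in> S m'" and r: "r = m + m' - \<sigma>" and g: "g = comp_term \<sigma> s t"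
      unfolding T_def by blast
    show "g l differentiable (at q)" if "l \<in> D"
      unfolding g by (rule comp_term_dderiv(1)[OF s t that])
    show "g l (x + y, k) = g l (x, k)" if "l \<in> D" "y \<in> L" for x y k
      unfolding g comp_term_def
      using symbol_class_periodic[OF s that(2)] wave_periodic[OF that] by simp
    obtain C e where C: "C \<ge> 0" "\<And>x k l. norm (s (x, k + l) - \<sigma> *\<^sub>R s (x, k)) \<le> C * (1 + norm k) powr (m - \<sigma>) * (1 + norm l) powr e"
      using symbol_increment[OF s \<sigma>] by metis
    obtain N :: nat and B where B: "B \<ge> 0" "\<And>k. (1 + norm k) powr e / (1 + (norm k)\<^sup>2) ^ N \<le> B * decay_weight k"
      using weight_absorb[where r = e] by metis
    obtain E where E: "E \<ge> 0" "\<And>l k. l \<in> D \<Longrightarrow> norm (hat t l k) \<le> E * (1 + norm k) powr m' / (1 + (norm l)\<^sup>2) ^ N"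
      using hat_decay[OF t, where n = N] by metis
    have "norm (g l (x, k)) \<le> (C * E * B) * decay_weight l * (1 + norm k) powr r" if "l \<in> D" for l x k
    proof -
      have "norm (g l (x, k)) = norm (s (x, k + l) - \<sigma> *\<^sub>R s (x, k)) * norm (hat t l k)"
        by (simp add: g comp_term_def norm_mult)
      also have "\<dots> \<le> (C * (1 + norm k) powr (m - \<sigma>) * (1 + norm l) powr e) *
          (E * (1 + norm k) powr m' / (1 + (norm l)\<^sup>2) ^ N)"
        using C E(2)[OF that] by (intro mult_mono) auto
      also have "\<dots> = C * E * (1 + norm k) powr r * ((1 + norm l) powr e / (1 + (norm l)\<^sup>2) ^ N)"
        by (simp add: r powr_add powr_diff mult_ac)
      also have "\<dots> \<le> C * E * (1 + norm k) powr r * (B * decay_weight l)"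
        using B(2) C(1) E(1) by (intro mult_left_mono) auto
      finally show ?thesis by (simp add: mult_ac)
    qed
    then show "\<exists>C. \<forall>l\<in>D. \<forall>x k. norm (g l (x, k)) \<le> C * decay_weight l * (1 + norm k) powr r" by blast
    fix b :: "phase" assume b: "b \<in> Basis"
    show "family_span D T (r - order_drop b) (\<lambda>l. dderiv b (g l))"
    proof (rule family_span.cong[OF family_span.add[OF family_span.base family_span.base]])
      show "T (r - order_drop b) (comp_term \<sigma> (dderiv b s) t)"
        unfolding T_def using symbol_class_dderiv[OF s b] t r
        by (intro exI[of _ "m - order_drop b"] exI[of _ m'] exI[of _ "dderiv b s"] exI[of _ t]) auto
      show "T (r - order_drop b) (comp_term \<sigma> s (dderiv b t))"
        unfolding T_def using symbol_class_dderiv[OF t b] s r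
        by (intro exI[of _ m] exI[of _ "m' - order_drop b"] exI[of _ s] exI[of _ "dderiv b t"]) auto
      show "dderiv b (g l) q = comp_term \<sigma> (dderiv b s) t l q + comp_term \<sigma> s (dderiv b t) l q" if "l \<in> D" for l q
        unfolding g by (rule comp_term_dderiv(2)[OF s t that])
    qed
  qed
  have "T (m + m' - \<sigma>) (comp_term \<sigma> s t)" unfolding T_def using s t by blast
  then show ?thesis by (rule symbol_family)
qed

lemma comp_term_bound:
  assumes s: "s \<in> S m" and t: "t \<in> S m'"
  obtains C where "C \<ge> 0"
    "\<And>l x k. l \<in> D \<Longrightarrow> norm (comp_term 0 s t l (x, k)) \<le> C * decay_weight l * (1 + norm k) powr (m + m')"
proof -
  obtain C where C: "\<forall>l\<in>D. \<forall>x k. norm (comp_term 0 s t l (x, k)) \<le> C * decay_weight l * (1 + norm k) powr (m + m' - 0)"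
    using symbol_family_bound[OF comp_term_family[OF s t]] by blast
  have "norm (comp_term 0 s t l (x, k)) \<le> \<bar>C\<bar> * decay_weight l * (1 + norm k) powr (m + m')" if "l \<in> D" for l x k
  proof -
    have "norm (comp_term 0 s t l (x, k)) \<le> C * decay_weight l * (1 + norm k) powr (m + m')" using C that by simp
    also have "\<dots> \<le> \<bar>C\<bar> * decay_weight l * (1 + norm k) powr (m + m')"
      using decay_weight_nonneg by (intro mult_right_mono) auto
    finally show ?thesis .
  qed
  then show ?thesis by (intro that[of "\<bar>C\<bar>"]) auto
qed

lemma comp_term_summable:
  assumes "s \<in> S m" "t \<in> S m'"
  shows "(\<lambda>l. comp_term 0 s t l q) summable_on D"
proof -
  obtain C where "C \<ge> 0" and
    C: "\<And>l x k. l \<in> D \<Longrightarrow> norm (comp_term 0 s t l (x, k)) \<le> C * decay_weight l * (1 + norm k) powr (m + m')"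
    using comp_term_bound[OF assms] by metis
  show ?thesis
  proof (rule summable_on_bounded(1)[OF decay_weight_summable])
    show "norm (comp_term 0 s t l q) \<le> (C * (1 + norm (snd q)) powr (m + m')) * decay_weight l" if "l \<in> D" for l
      using C[OF that, of "fst q" "snd q"] by (simp add: mult_ac)
  qed
qed

theorem sharp_symbol:
  assumes "s \<in> S m" "t \<in> S m'" "r = m + m'"
  shows "sharp s t \<in> S r"
  using symbol_family_infsum[OF comp_term_family[OF assms(1,2)] decay_weight_summable decay_weight_nonneg, of 0] assms(3)
  unfolding sharp_def[abs_def] by simp

text \<open>By Fourier inversion the product is the same series with \<open>s\<close> taken at
  \<open>k\<close> instead of \<open>k + l\<close>; the termwise differences are the family with
  \<open>\<sigma> = 1\<close>, one order lower.\<close>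

theorem sharp_minus_product:
  assumes s: "s \<in> S m" and t: "t \<in> S m'" and r: "r = m + m' - 1"
  shows "(\<lambda>q. sharp s t q - s q * t q) \<in> S r"
proof -
  have "(\<Sum>\<^sub>\<infinity>l\<in>D. comp_term 1 s t l q) = sharp s t q - s q * t q" for q
  proof -
    have "((\<lambda>l. s q * (hat t l (snd q) * wave l (fst q))) has_sum s q * t (fst q, snd q)) D"
      unfolding hat_def by (intro has_sum_cmult_right fourier_inversion symbol_slice[OF t])
    then have "((\<lambda>l. comp_term 0 s t l q + - (s q * (hat t l (snd q) * wave l (fst q)))) has_sum
        sharp s t q + - (s q * t q)) D"
      unfolding sharp_def
      by (intro has_sum_add has_sum_infsum comp_term_summable[OF s t] has_sum_uminusI) simp
    then show ?thesis by (intro infsumI) (simp add: comp_term_def algebra_simps)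
  qed
  then show ?thesis
    using symbol_family_infsum[OF comp_term_family[OF s t] decay_weight_summable decay_weight_nonneg, of 1] r by simp
qed

section \<open>Operators with scalar symbols and their composition\<close>

definition scalar_op :: "(phase \<Rightarrow> complex) \<Rightarrow> (real^2 \<Rightarrow> complex) \<Rightarrow> real^2 \<Rightarrow> complex" where
  "scalar_op s u x = (\<Sum>\<^sub>\<infinity>k\<in>D. wave k x * (s (x, k) * fourier u k))"

lemma scalar_op_term_bound:
  assumes s: "s \<in> S m" and u: "u \<in> SP"
  obtains C where "C \<ge> 0" "\<And>k x. k \<in> D \<Longrightarrow> norm (wave k x * (s (x, k) * fourier u k)) \<le> C * decay_weight k"
proof -
  obtain C where C: "C \<ge> 0" "\<And>x k. norm (s (x, k)) \<le> C * (1 + norm k) powr m"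
    using symbol_class_bound[OF s] by blast
  obtain B where B: "B \<ge> 0" "\<And>k. k \<in> D \<Longrightarrow> (1 + norm k) powr m * norm (fourier u k) \<le> B * decay_weight k"
    using fourier_weight[OF u, where r = m] by metis
  have "norm (wave k x * (s (x, k) * fourier u k)) \<le> C * B * decay_weight k" if "k \<in> D" for k x
  proof -
    have "norm (wave k x * (s (x, k) * fourier u k)) = norm (s (x, k)) * norm (fourier u k)" by (simp add: norm_mult)
    also have "\<dots> \<le> (C * (1 + norm k) powr m) * norm (fourier u k)" by (intro mult_right_mono C) auto
    also have "\<dots> \<le> C * (B * decay_weight k)"
      using mult_left_mono[OF B(2)[OF that] C(1)] by (simp add: mult.assoc)
    finally show ?thesis by simp
  qed
  then show ?thesis using B(1) C(1) by (intro that[of "C * B"]) auto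
qed

lemma scalar_op_summable:
  assumes "s \<in> S m" "u \<in> SP"
  shows "(\<lambda>k. wave k x * (s (x, k) * fourier u k)) summable_on D"
proof -
  obtain C where "C \<ge> 0" "\<And>k x. k \<in> D \<Longrightarrow> norm (wave k x * (s (x, k) * fourier u k)) \<le> C * decay_weight k"
    using scalar_op_term_bound[OF assms] by metis
  then show ?thesis by (intro summable_on_bounded(1)[OF decay_weight_summable])
qed

text \<open>The coefficient of \<open>scalar_op t u\<close> at \<open>j\<close> is the sum over
  \<open>k\<close> of \<open>hat t (j - k) k * fourier u k\<close>. This gives an absolutely
  convergent double series; after the substitution \<open>j = k + l\<close> its inner sum is the
  series of \<open>sharp s t\<close>.\<close>

theorem scalar_op_op:
  assumes s: "s \<in> S m" and t: "t \<in> S m'" and u: "u \<in> SP"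
  shows "scalar_op s (scalar_op t u) x = scalar_op (sharp s t) u x"
proof -
  obtain C where C: "C \<ge> 0" "\<And>k x. k \<in> D \<Longrightarrow> norm (wave k x * (t (x, k) * fourier u k)) \<le> C * decay_weight k"
    using scalar_op_term_bound[OF t u] by metis
  have CW: "(\<lambda>k. C * decay_weight k) summable_on D" by (rule summable_on_cmult_right[OF decay_weight_summable])
  have tc: "continuous_on UNIV (\<lambda>y. t (y, k))" for k by (rule smooth_periodicD(3)[OF symbol_slice[OF t]])
  have fourier_op: "fourier (scalar_op t u) j = (\<Sum>\<^sub>\<infinity>k\<in>D. hat t (j - k) k * fourier u k)" if "j \<in> D" for j
  proof -
    have "((\<lambda>k. mean (\<lambda>y. wave (- j) y * (wave k y * (t (y, k) * fourier u k)))) has_sum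
        mean (\<lambda>y. \<Sum>\<^sub>\<infinity>k\<in>D. wave (- j) y * (wave k y * (t (y, k) * fourier u k)))) D"
      by (rule mean_infsum(1)[OF _ _ CW])
        (use C in \<open>auto simp: norm_mult intro!: continuous_intros continuous_wave tc\<close>)
    moreover have "mean (\<lambda>y. wave (- j) y * (wave k y * (t (y, k) * fourier u k))) = hat t (j - k) k * fourier u k" for k
    proof -
      have "wave (- j) y * (wave k y * (t (y, k) * fourier u k)) = fourier u k * (wave (- (j - k)) y * t (y, k))" for y
        using wave_add[of "- j" k y] by (simp add: mult_ac)
      then have "mean (\<lambda>y. wave (- j) y * (wave k y * (t (y, k) * fourier u k))) =
          mean (\<lambda>y. fourier u k * (wave (- (j - k)) y * t (y, k)))"
        by (intro arg_cong[of _ _ mean] ext)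
      also have "\<dots> = fourier u k * mean (\<lambda>y. wave (- (j - k)) y * t (y, k))"
        by (rule mean_cmult[OF fourier_integrand_cont[OF tc]])
      finally show ?thesis by (simp only: hat_def fourier_def mult.commute)
    qed
    moreover have "(\<Sum>\<^sub>\<infinity>k\<in>D. wave (- j) y * (wave k y * (t (y, k) * fourier u k))) = wave (- j) y * scalar_op t u y" for y
      unfolding scalar_op_def by (rule infsum_cmult_right')
    ultimately show ?thesis unfolding fourier_def by (simp add: has_sum_iff)
  qed
  \<comment> \<open>\<open>a\<close> and \<open>A\<close> are the same terms indexed by the shift
    \<open>l\<close> and by the output frequency \<open>j\<close>. Absolute summability is proved
    for \<open>a\<close>, where the weights separate, and carried over to \<open>A\<close>.\<close>
  define a where "a l k = wave k x * (comp_term 0 s t l (x, k) * fourier u k)" for l k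
  define A where "A j k = wave j x * (s (x, j) * (hat t (j - k) k * fourier u k))" for j k
  have Aa: "A (k + l) k = a l k" for k l
    unfolding A_def a_def comp_term_def by (simp add: wave_add algebra_simps)
  obtain E where E: "E \<ge> 0"
    "\<And>l x k. l \<in> D \<Longrightarrow> norm (comp_term 0 s t l (x, k)) \<le> E * decay_weight l * (1 + norm k) powr (m + m')"
    using comp_term_bound[OF s t] by metis
  obtain B where B: "B \<ge> 0" "\<And>k. k \<in> D \<Longrightarrow> (1 + norm k) powr (m + m') * norm (fourier u k) \<le> B * decay_weight k"
    using fourier_weight[OF u, where r = "m + m'"] by metis
  have a_bound: "norm (a l k) \<le> (E * B) * (decay_weight l * decay_weight k)" if "l \<in> D" "k \<in> D" for l k
  proof -
    have "norm (a l k) = norm (comp_term 0 s t l (x, k)) * norm (fourier u k)" by (simp add: a_def norm_mult)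
    also have "\<dots> \<le> (E * decay_weight l * (1 + norm k) powr (m + m')) * norm (fourier u k)"
      by (intro mult_right_mono E(2) that) auto
    also have "\<dots> = E * decay_weight l * ((1 + norm k) powr (m + m') * norm (fourier u k))" by simp
    also have "\<dots> \<le> E * decay_weight l * (B * decay_weight k)"
      using E(1) decay_weight_nonneg by (intro mult_left_mono B(2) that) auto
    finally show ?thesis by (simp add: mult_ac)
  qed
  have "(\<lambda>p. decay_weight (fst p) * decay_weight (snd p)) summable_on D \<times> D"
  proof (rule summable_on_SigmaI)
    show "((\<lambda>k. decay_weight (fst (l, k)) * decay_weight (snd (l, k))) has_sum (decay_weight l * infsum decay_weight D)) D" for l
      using decay_weight_summable by (auto intro: has_sum_cmult_right)
    show "(\<lambda>l. decay_weight l * infsum decay_weight D) summable_on D" by (rule summable_on_cmult_left[OF decay_weight_summable])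
  qed (auto simp: decay_weight_nonneg)
  then have sum_a: "(\<lambda>p. a (fst p) (snd p)) summable_on D \<times> D"
    by (rule summable_on_bounded(1)[where c = "E * B"]) (use a_bound in auto)
  have "bij_betw (\<lambda>p. (snd p + fst p, snd p)) (D \<times> D) (D \<times> D)"
    by (rule bij_betwI[where g = "\<lambda>p. (fst p - snd p, snd p)"]) (auto intro: dual_lattice_add dual_lattice_diff)
  from summable_on_reindex_bij_betw[OF this, of "\<lambda>p. A (fst p) (snd p)"] sum_a
  have sum_A: "(\<lambda>(j, k). A j k) summable_on D \<times> D" by (simp add: Aa case_prod_unfold)
  have "scalar_op s (scalar_op t u) x = (\<Sum>\<^sub>\<infinity>j\<in>D. \<Sum>\<^sub>\<infinity>k\<in>D. A j k)"
    unfolding scalar_op_def[of s]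
    by (rule infsum_cong) (simp add: fourier_op A_def infsum_cmult_right')
  also have "\<dots> = (\<Sum>\<^sub>\<infinity>k\<in>D. \<Sum>\<^sub>\<infinity>j\<in>D. A j k)" by (rule infsum_swap_banach[OF sum_A])
  also have "\<dots> = (\<Sum>\<^sub>\<infinity>k\<in>D. wave k x * (sharp s t (x, k) * fourier u k))"
  proof (rule infsum_cong)
    fix k assume k: "k \<in> D"
    have "bij_betw (\<lambda>l. k + l) D D"
      by (rule bij_betwI[where g = "\<lambda>j. j - k"]) (auto intro: dual_lattice_add dual_lattice_diff k)
    from infsum_reindex_bij_betw[OF this, of "\<lambda>j. A j k"]
    have "(\<Sum>\<^sub>\<infinity>j\<in>D. A j k) = (\<Sum>\<^sub>\<infinity>l\<in>D. a l k)" by (simp add: Aa)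
    also have "\<dots> = wave k x * (sharp s t (x, k) * fourier u k)"
      unfolding a_def sharp_def by (simp add: infsum_cmult_right' infsum_cmult_left')
    finally show "(\<Sum>\<^sub>\<infinity>j\<in>D. A j k) = wave k x * (sharp s t (x, k) * fourier u k)" .
  qed
  finally show ?thesis by (simp add: scalar_op_def)
qed

end


section \<open>The operator Riccati equation\<close>

context torus
begin

lemma sharp_add_left:
  assumes "s \<in> S m" "s' \<in> S m'" "t \<in> S n"
  shows "sharp (\<lambda>q. s q + s' q) t q = sharp s t q + sharp s' t q"
proof -
  have "comp_term 0 (\<lambda>q. s q + s' q) t l q = comp_term 0 s t l q + comp_term 0 s' t l q" for l
    by (simp add: comp_term_def distrib_right)
  then show ?thesis
    unfolding sharp_def
    by (simp add: infsum_add[OF comp_term_summable[OF assms(1,3)] comp_term_summable[OF assms(2,3)]])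
qed

lemma sharp_add_right:
  assumes "s \<in> S m" "t \<in> S n" "t' \<in> S n'"
  shows "sharp s (\<lambda>q. t q + t' q) q = sharp s t q + sharp s t' q"
proof -
  have "hat (\<lambda>q. t q + t' q) l k = hat t l k + hat t' l k" for l k
    unfolding hat_def
    by (rule fourier_add; rule smooth_periodicD(3)[OF symbol_slice]) (rule assms)+
  then have "comp_term 0 s (\<lambda>q. t q + t' q) l q = comp_term 0 s t l q + comp_term 0 s t' l q" for l
    by (simp add: comp_term_def algebra_simps)
  then show ?thesis
    unfolding sharp_def
    by (simp add: infsum_add[OF comp_term_summable[OF assms(1,2)] comp_term_summable[OF assms(1,3)]])
qed

text \<open>\<open>riccati a l1 l0 s\<close> is the symbol of \<open>a M\<^sup>2 + L1 M + L0\<close> when \<open>s\<close> is the symbol of \<open>M\<close>.\<close>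

definition riccati ::
    "(real^2 \<Rightarrow> complex) \<Rightarrow> (3 \<Rightarrow> 3 \<Rightarrow> phase \<Rightarrow> complex) \<Rightarrow>
     (3 \<Rightarrow> 3 \<Rightarrow> phase \<Rightarrow> complex) \<Rightarrow>
     (3 \<Rightarrow> 3 \<Rightarrow> phase \<Rightarrow> complex) \<Rightarrow> 3 \<Rightarrow> 3 \<Rightarrow> phase \<Rightarrow> complex" where
  "riccati a l1 l0 s i j q = l0 i j q + (\<Sum>p\<in>UNIV. sharp (\<lambda>q. a (fst q) * s i p q + l1 i p q) (s p j) q)"

definition delta :: "3 \<Rightarrow> 3 \<Rightarrow> complex" where
  "delta i j = (if i = j then 1 else 0)"

lemma delta_mult: "s \<in> S m \<Longrightarrow> (\<lambda>q. delta i j * s q) \<in> S m"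
  by (rule symbol_cmult)

lemma sum_delta: "(\<Sum>p\<in>UNIV. delta i p * f p) = f i" "(\<Sum>p\<in>UNIV. f p * delta p i) = f i"
  by (simp_all add: delta_def if_distrib if_distribR cong: if_cong)

text \<open>The iteration \<open>s - P s * \<rho>'\<close> resembles Newton's method. Around a
  symbol with principal part \<open>\<mu>\<close> times the identity, the linearised map has
  principal part \<open>(a \<mu> + \<beta>) d + a \<mu> d = \<rho> d\<close>, so one step is
  multiplication by \<open>\<rho>'\<close> and lowers the order of the residual by one.\<close>

theorem riccati_solvable:
  assumes a: "a \<in> SP" and l1: "\<And>i j. l1 i j \<in> S 1" and l0: "\<And>i j. l0 i j \<in> S 2"
    and \<mu>: "\<mu> \<in> S 1" and \<rho>: "\<rho> \<in> S 1" and \<rho>': "\<rho>' \<in> S (- 1)" and \<beta>: "\<beta> \<in> S 1" and \<kappa>: "\<kappa> \<in> S 2"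
    and inv: "\<And>q. \<rho> q * \<rho>' q = 1"
    and l1_principal: "\<And>i j. (\<lambda>q. l1 i j q - delta i j * \<beta> q) \<in> S 0"
    and l0_principal: "\<And>i j. (\<lambda>q. l0 i j q - delta i j * \<kappa> q) \<in> S 1"
    and linear: "\<And>q. \<rho> q = 2 * a (fst q) * \<mu> q + \<beta> q"
    and eikonal: "(\<lambda>q. a (fst q) * \<mu> q * \<mu> q + \<beta> q * \<mu> q + \<kappa> q) \<in> S 1"
  shows "\<exists>s. (\<forall>i j. s i j \<in> S 1) \<and> (\<forall>i j. (\<lambda>q. s i j q - delta i j * \<mu> q) \<in> S 0) \<and>
    (\<forall>i j m. riccati a l1 l0 s i j \<in> S m)"
proof -
  let ?P = "riccati a l1 l0"
  define near where "near s \<longleftrightarrow> (\<forall>i j. (\<lambda>q. s i j q - delta i j * \<mu> q) \<in> S 0)" for s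
  have nearD: "s i j \<in> S 1" "(\<lambda>q. s i j q - delta i j * \<mu> q) \<in> S 0" if "near s" for s i j
  proof -
    show 0: "(\<lambda>q. s i j q - delta i j * \<mu> q) \<in> S 0" using that by (simp add: near_def)
    from symbol_class_add[OF symbol_class_mono[OF 0, of 1] delta_mult[OF \<mu>, of i j]]
    show "s i j \<in> S 1" by simp
  qed
  define X where "X s i p q = a (fst q) * s i p q + l1 i p q" for s i p q
  have X: "X s i p \<in> S 1" if "near s" for s i p
    unfolding X_def by (intro symbol_class_add symbol_function_mult a nearD(1)[OF that] l1)
  have X': "(\<lambda>q. X s i p q - delta i p * (a (fst q) * \<mu> q + \<beta> q)) \<in> S 0" if "near s" for s i p
  proof -
    have "(\<lambda>q. a (fst q) * (s i p q - delta i p * \<mu> q) + (l1 i p q - delta i p * \<beta> q)) \<in> S 0"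
      by (intro symbol_class_add symbol_function_mult a nearD(2)[OF that] l1_principal)
    then show ?thesis by (simp add: X_def algebra_simps)
  qed
  have P: "?P s i j q = l0 i j q + (\<Sum>p\<in>UNIV. sharp (X s i p) (s p j) q)" for s i j q
    by (simp add: riccati_def X_def[abs_def])
  \<comment> \<open>The exact increment of the residual: two linear terms and the quadratic
    one.\<close>
  define R where "R s d i j q = (\<Sum>p\<in>UNIV. sharp (X s i p) (d p j) q +
      (sharp (\<lambda>q. a (fst q) * d i p q) (s p j) q + sharp (\<lambda>q. a (fst q) * d i p q) (d p j) q))" for s d i j q
  have R: "?P (\<lambda>i j q. s i j q + d i j q) i j q = ?P s i j q + R s d i j q"
    if s: "near s" and d: "\<And>i j. d i j \<in> S \<nu>" for s d \<nu> i j q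
  proof -
    have "sharp (X (\<lambda>i j q. s i j q + d i j q) i p) (\<lambda>q. s p j q + d p j q) q =
        sharp (X s i p) (s p j) q + (sharp (X s i p) (d p j) q +
      (sharp (\<lambda>q. a (fst q) * d i p q) (s p j) q + sharp (\<lambda>q. a (fst q) * d i p q) (d p j) q))" for p
    proof -
      have ad: "(\<lambda>q. a (fst q) * d i p q) \<in> S \<nu>" by (rule symbol_function_mult[OF a d])
      have sd: "(\<lambda>q. s p j q + d p j q) \<in> S (max 1 \<nu>)"
        by (intro symbol_class_add symbol_class_mono[OF nearD(1)[OF s]] symbol_class_mono[OF d]) auto
      have "X (\<lambda>i j q. s i j q + d i j q) i p = (\<lambda>q. X s i p q + a (fst q) * d i p q)"
        by (rule ext) (simp add: X_def algebra_simps)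
      then show ?thesis
        by (simp add: sharp_add_left[OF X[OF s] ad sd] sharp_add_right[OF X[OF s] nearD(1)[OF s] d]
            sharp_add_right[OF ad nearD(1)[OF s] d])
    qed
    then show ?thesis by (simp add: P R_def sum.distrib)
  qed
  have R_order: "R s d i j \<in> S (1 + \<nu>)" if s: "near s" and d: "\<And>i j. d i j \<in> S \<nu>" and \<nu>: "\<nu> \<le> 0" for s d \<nu> i j
  proof -
    have ad: "(\<lambda>q. a (fst q) * d i p q) \<in> S \<nu>" for p by (rule symbol_function_mult[OF a d])
    show ?thesis unfolding R_def
      by (intro symbol_class_sum symbol_class_add sharp_symbol[OF X[OF s] d] sharp_symbol[OF ad nearD(1)[OF s]]
          symbol_class_mono[OF sharp_symbol[OF ad d refl]]) (use \<nu> in auto)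
  qed
  have R_principal: "(\<lambda>q. R s d i j q - \<rho> q * d i j q) \<in> S \<nu>"
    if s: "near s" and d: "\<And>i j. d i j \<in> S \<nu>" and \<nu>: "\<nu> \<le> 0" for s d \<nu> i j
  proof -
    have ad: "(\<lambda>q. a (fst q) * d i p q) \<in> S \<nu>" for p by (rule symbol_function_mult[OF a d])
    \<comment> \<open>Each error is isolated: composition against product, subprincipal parts of
      \<open>X s\<close> and \<open>s\<close>, and the quadratic term, whose order
      \<open>2 \<nu>\<close> is at most \<open>\<nu>\<close> for
      \<open>\<nu> \<le> 0\<close>.\<close>
    define Y where "Y p q = (sharp (X s i p) (d p j) q - X s i p q * d p j q)
       + ((X s i p q - delta i p * (a (fst q) * \<mu> q + \<beta> q)) * d p j q
       + ((sharp (\<lambda>q. a (fst q) * d i p q) (s p j) q - a (fst q) * d i p q * s p j q)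
       + ((a (fst q) * d i p q) * (s p j q - delta p j * \<mu> q)
       + sharp (\<lambda>q. a (fst q) * d i p q) (d p j) q)))" for p q
    have Y: "Y p \<in> S \<nu>" for p
      unfolding Y_def
      by (intro symbol_class_add sharp_minus_product[OF X[OF s] d] sharp_minus_product[OF ad nearD(1)[OF s]]
          symbol_class_mult[OF X'[OF s] d] symbol_class_mult[OF ad nearD(2)[OF s]]
          symbol_class_mono[OF sharp_symbol[OF ad d refl]]) (use \<nu> in auto)
    have "(\<Sum>p\<in>UNIV. Y p q) = R s d i j q - \<rho> q * d i j q" for q
    proof -
      have "(\<Sum>p\<in>UNIV. Y p q) = R s d i j q - (\<Sum>p\<in>UNIV. delta i p * ((a (fst q) * \<mu> q + \<beta> q) * d p j q))
          - (\<Sum>p\<in>UNIV. (a (fst q) * d i p q * \<mu> q) * delta p j)"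
        unfolding R_def sum_subtractf[symmetric] Y_def
        by (rule sum.cong) (simp_all add: algebra_simps)
      also have "\<dots> = R s d i j q - \<rho> q * d i j q"
        unfolding sum_delta linear by (simp add: algebra_simps)
      finally show ?thesis .
    qed
    moreover have "(\<lambda>q. \<Sum>p\<in>UNIV. Y p q) \<in> S \<nu>" by (intro symbol_class_sum Y)
    ultimately show ?thesis by simp
  qed
  define s0 where "s0 i j q = delta i j * \<mu> q" for i j q
  define s where "s n = ((\<lambda>s i j q. s i j q - ?P s i j q * \<rho>' q) ^^ n) s0" for n
  have s_Suc: "s (Suc n) = (\<lambda>i j q. s n i j q + - (?P (s n) i j q * \<rho>' q))" for n
    by (simp add: s_def)
  have near0: "near s0" by (simp add: near_def s0_def symbol_class_zero)
  \<comment> \<open>The terms of order 2 form the scalar \<open>eikonal\<close> expression, so the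
    first residual already has order 1 and the first correction order 0.\<close>
  have P0: "?P s0 i j \<in> S 1" for i j
  proof -
    define Y where "Y p q = (sharp (X s0 i p) (s0 p j) q - X s0 i p q * s0 p j q)
       + (X s0 i p q - delta i p * (a (fst q) * \<mu> q + \<beta> q)) * s0 p j q" for p q
    have Y: "Y p \<in> S 1" for p
      unfolding Y_def
      by (intro symbol_class_add sharp_minus_product[OF X[OF near0] nearD(1)[OF near0]]
          symbol_class_mult[OF X'[OF near0] nearD(1)[OF near0]]) auto
    have eq: "?P s0 i j q = (l0 i j q - delta i j * \<kappa> q) + ((\<Sum>p\<in>UNIV. Y p q)
        + delta i j * (a (fst q) * \<mu> q * \<mu> q + \<beta> q * \<mu> q + \<kappa> q))" for q
    proof -
      have "(\<Sum>p\<in>UNIV. Y p q) = (\<Sum>p\<in>UNIV. sharp (X s0 i p) (s0 p j) q)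
          - (\<Sum>p\<in>UNIV. delta i p * ((a (fst q) * \<mu> q + \<beta> q) * (delta p j * \<mu> q)))"
        unfolding sum_subtractf[symmetric] Y_def
        by (rule sum.cong) (simp_all add: algebra_simps s0_def)
      also have "(\<Sum>p\<in>UNIV. delta i p * ((a (fst q) * \<mu> q + \<beta> q) * (delta p j * \<mu> q))) =
          (a (fst q) * \<mu> q + \<beta> q) * (delta i j * \<mu> q)"
        by (rule sum_delta(1))
      finally show ?thesis unfolding P by (simp add: algebra_simps)
    qed
    have "(\<lambda>q. (l0 i j q - delta i j * \<kappa> q) + ((\<Sum>p\<in>UNIV. Y p q)
        + delta i j * (a (fst q) * \<mu> q * \<mu> q + \<beta> q * \<mu> q + \<kappa> q))) \<in> S 1"
      by (intro symbol_class_add l0_principal symbol_class_sum Y delta_mult eikonal)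
    then show ?thesis by (simp add: eq[abs_def, symmetric] eq)
  qed
  have step: "near (s n) \<and> (\<forall>i j. ?P (s n) i j \<in> S (1 - real n))" for n
  proof (induction n)
    case 0
    then show ?case using near0 P0 by (simp add: s_def)
  next
    case (Suc n)
    define d where "d i j q = - (?P (s n) i j q * \<rho>' q)" for i j q
    have d: "d i j \<in> S (- real n)" for i j
      unfolding d_def using Suc by (intro symbol_class_uminus symbol_class_mult[OF _ \<rho>', of _ "1 - real n"]) auto
    have s: "s (Suc n) = (\<lambda>i j q. s n i j q + d i j q)" unfolding s_Suc d_def ..
    have "near (s (Suc n))"
      unfolding near_def
    proof (intro allI)
      fix i j
      have "(\<lambda>q. (s n i j q - delta i j * \<mu> q) + d i j q) \<in> S 0"
        using Suc by (intro symbol_class_add nearD(2) symbol_class_mono[OF d]) auto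
      then show "(\<lambda>q. s (Suc n) i j q - delta i j * \<mu> q) \<in> S 0" by (simp add: s algebra_simps)
    qed
    moreover have "?P (s (Suc n)) i j \<in> S (1 - real (Suc n))" for i j
    proof -
      have "?P (s (Suc n)) i j q = R (s n) d i j q - \<rho> q * d i j q" for q
      proof -
        \<comment> \<open>\<open>\<rho>'\<close> is an exact inverse, so the residual cancels
          completely and only the error of \<open>R_principal\<close> remains.\<close>
        have "\<rho> q * d i j q = - ?P (s n) i j q"
          unfolding d_def using inv[of q] by (simp add: mult.left_commute)
        then show ?thesis using R[OF conjunct1[OF Suc] d] by (simp add: s)
      qed
      then have "?P (s (Suc n)) i j = (\<lambda>q. R (s n) d i j q - \<rho> q * d i j q)" by (rule ext)
      then show ?thesis using R_principal[OF conjunct1[OF Suc] d] by simp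
    qed
    ultimately show ?case by blast
  qed
  define d where "d n i j q = - (?P (s n) i j q * \<rho>' q)" for n i j q
  have d: "d n i j \<in> S (0 - real n)" for n i j
    unfolding d_def using step[of n] by (intro symbol_class_uminus symbol_class_mult[OF _ \<rho>', of _ "1 - real n"]) auto
  have s_sum: "s n i j q = s0 i j q + (\<Sum>r<n. d r i j q)" for n i j q
    by (induction n) (auto simp: s_Suc d_def s_def[of 0])
  define good where "good i j t \<longleftrightarrow> t \<in> S 0 \<and> (\<forall>n. (\<lambda>q. t q - (\<Sum>r<n. d r i j q)) \<in> S (0 - real n))" for i j t
  have "\<exists>t. good i j t" for i j
    using asymptotic_sum[of "\<lambda>r. d r i j" 0, OF d] unfolding good_def by blast
  then obtain t where good: "\<And>i j. good i j (t i j)" by metis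
  have t: "t i j \<in> S 0" "(\<lambda>q. t i j q - (\<Sum>r<n. d r i j q)) \<in> S (0 - real n)" for i j n
    using good[of i j] unfolding good_def by auto
  define \<sigma> where "\<sigma> i j q = s0 i j q + t i j q" for i j q
  have near_\<sigma>: "near \<sigma>" by (simp add: near_def \<sigma>_def s0_def t(1))
  have "?P \<sigma> i j \<in> S m" for i j m
  proof -
    \<comment> \<open>The limit symbol differs from the iterate \<open>s n\<close> by a symbol of
      order \<open>- n\<close>, which moves the residual by order \<open>1 - n\<close>;
      \<open>n\<close> is chosen according to the target order.\<close>
    obtain n :: nat where n: "1 - real n \<le> m" using real_arch_simple[of "1 - m"] by (auto simp: algebra_simps)
    define e where "e i j q = t i j q - (\<Sum>r<n. d r i j q)" for i j q
    have e: "e i j \<in> S (- real n)" for i j unfolding e_def using t(2) by simp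
    have "\<sigma> = (\<lambda>i j q. s n i j q + e i j q)"
      by (intro ext) (simp add: \<sigma>_def e_def s_sum)
    then have "?P \<sigma> i j = (\<lambda>q. ?P (s n) i j q + R (s n) e i j q)"
      using R[OF conjunct1[OF step] e] by (intro ext) simp
    also have "\<dots> \<in> S (1 - real n)"
      using R_order[OF conjunct1[OF step] e] step[of n] by (intro symbol_class_add) auto
    finally show ?thesis using n by (rule symbol_class_mono)
  qed
  then show ?thesis using nearD[OF near_\<sigma>] by blast
qed

end


section \<open>Operators with matrix symbols\<close>

lemma bounded_linear_axis: "bounded_linear (axis i :: 'a::euclidean_space \<Rightarrow> 'a^'n)"
  by (intro linear_conv_bounded_linear[THEN iffD1] linearI) (auto simp: axis_def vec_eq_iff)

lemma vec_axis_sum: "(v :: 'a::euclidean_space^'n) = (\<Sum>i\<in>UNIV. axis i (v $ i))"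
  by (simp add: vec_eq_iff axis_def sum.delta if_distrib cong: if_cong)

lemma has_sum_vec:
  fixes f :: "'i \<Rightarrow> 'a::{comm_monoid_add, topological_space}^'n"
  assumes "\<And>j. ((\<lambda>k. f k $ j) has_sum (a $ j)) A"
  shows "(f has_sum a) A"
  using assms unfolding has_sum_def by (intro vec_tendstoI) simp

lemma has_vector_derivative_vec:
  fixes f :: "real \<Rightarrow> 'a::euclidean_space^'n"
  assumes "\<And>i. ((\<lambda>t. f t $ i) has_vector_derivative (f' $ i)) (at t)"
  shows "(f has_vector_derivative f') (at t)"
proof -
  have "((\<lambda>t. \<Sum>i\<in>UNIV. axis i (f t $ i)) has_vector_derivative (\<Sum>i\<in>UNIV. axis i (f' $ i))) (at t)"
    by (intro has_vector_derivative_sum bounded_linear.has_vector_derivative[OF bounded_linear_axis] assms)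
  then show ?thesis by (simp only: vec_axis_sum[symmetric])
qed

context torus
begin

lemma symbol_class_bounded_linear:
  fixes B :: "'a::banach \<Rightarrow> 'b::banach"
  assumes B: "bounded_linear B" and s: "s \<in> S m"
  shows "(\<lambda>q. B (s q)) \<in> S m"
proof -
  define T where "T m u \<longleftrightarrow> (\<exists>s\<in>S m. u = (\<lambda>q. B (s q)))" for m :: real and u
  interpret symbol_class_coinduct v1 v2 T
  proof
    fix m u p assume "T m u"
    then obtain s where s: "s \<in> S m" and u: "u = (\<lambda>q. B (s q))" unfolding T_def by blast
    show "u differentiable (at p)"
      unfolding u by (rule differentiable_bounded_linear[OF B symbol_class_diff[OF s]])
    show "u (x + l, k) = u (x, k)" if "l \<in> L" for x l k
      unfolding u using symbol_class_periodic[OF s that] by simp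
    obtain C where C: "C \<ge> 0" "\<And>x k. norm (s (x, k)) \<le> C * (1 + norm k) powr m"
      using symbol_class_bound[OF s] by blast
    obtain K where K: "K > 0" "\<And>z. norm (B z) \<le> norm z * K" using bounded_linear.pos_bounded[OF B] by blast
    have "norm (u (x, k)) \<le> C * K * (1 + norm k) powr m" for x k
    proof -
      have "norm (u (x, k)) \<le> norm (s (x, k)) * K" unfolding u by (rule K(2))
      also have "\<dots> \<le> C * (1 + norm k) powr m * K" using K(1) by (intro mult_right_mono C) auto
      finally show ?thesis by (simp add: mult_ac)
    qed
    then show "\<exists>C. \<forall>x k. norm (u (x, k)) \<le> C * (1 + norm k) powr m" by blast
    fix b :: "phase" assume b: "b \<in> Basis"
    \<comment> \<open>The summand \<open>B 0 = 0\<close> only brings the derivative into the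
      two-term shape of the coinduction.\<close>
    have "dderiv b u q = B (dderiv b s q) + B 0" for q
      unfolding u using dderiv_bounded_linear[OF B symbol_class_diff[OF s]] linear_simps(3)[OF B] by simp
    moreover have "T (m - order_drop b) (\<lambda>q. B (dderiv b s q))"
      unfolding T_def by (rule bexI[OF _ symbol_class_dderiv[OF s b]]) simp
    moreover have "T (m - order_drop b) (\<lambda>q. B 0)"
      unfolding T_def by (intro bexI[of _ "\<lambda>q. 0"] symbol_class_zero) simp
    ultimately show "\<exists>v w. T (m - order_drop b) v \<and> T (m - order_drop b) w \<and> (\<forall>q. dderiv b u q = v q + w q)"
      by (intro exI[of _ "\<lambda>q. B (dderiv b s q)"] exI[of _ "\<lambda>q. B 0"]) simp
  qed
  show ?thesis by (rule symbol_class) (use s in \<open>auto simp: T_def\<close>)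
qed

lemma symbol_class_vec:
  fixes s :: "phase \<Rightarrow> 'a::euclidean_space^'n"
  assumes "\<And>j. (\<lambda>q. s q $ j) \<in> S m"
  shows "s \<in> S m"
proof -
  have "(\<lambda>q. \<Sum>j\<in>UNIV. axis j (s q $ j)) \<in> S m"
    by (rule symbol_class_sum, rule symbol_class_bounded_linear[OF bounded_linear_axis assms])
  then show ?thesis by (simp only: vec_axis_sum[symmetric])
qed

definition matsym :: "(3 \<Rightarrow> 3 \<Rightarrow> phase \<Rightarrow> complex) \<Rightarrow> phase \<Rightarrow> complex^3^3" where
  "matsym A q = (\<chi> i j. A i j q)"

lemma matsym_symbol:
  assumes "\<And>i j. A i j \<in> S m"
  shows "matsym A \<in> S m"
proof -
  have "(\<lambda>q. matsym A q $ i $ j) \<in> S m" for i j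
    using assms[of i j] by (simp add: matsym_def eta_contract_eq)
  then show ?thesis by (intro symbol_class_vec)
qed

lemma SP_component: "u \<in> SP \<Longrightarrow> (\<lambda>y. u y $ j) \<in> SP"
  by (rule smooth_periodic_bounded_linear[OF bounded_linear_vec_nth])

lemma SP_vec:
  fixes u :: "real^2 \<Rightarrow> 'a::euclidean_space^'n"
  assumes "\<And>j. (\<lambda>y. u y $ j) \<in> SP"
  shows "u \<in> SP"
proof -
  have "smooth_on UNIV (\<lambda>y. \<Sum>j\<in>UNIV. axis j (u y $ j))"
    by (intro smooth_on_sum smooth_on_bounded_linear[OF open_UNIV bounded_linear_axis] smooth_periodicD(1)[OF assms])
  then have "smooth_on UNIV u" by (simp only: vec_axis_sum[symmetric])
  moreover have "u (x + l) = u x" if "l \<in> L" for x l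
    using smooth_periodicD(2)[OF assms that] by (simp add: vec_eq_iff)
  ultimately show ?thesis by (simp add: smooth_periodic_def)
qed

lemma fourier_coeff_component:
  assumes u: "u \<in> SP"
  shows "fourier_coeff v1 v2 u k $ j = fourier (\<lambda>y. u y $ j) k"
proof -
  have wave: "exp (- \<i> * complex_of_real (k \<bullet> y)) = wave (- k) y" for y
    by (simp add: wave_def)
  have "continuous_on UNIV (\<lambda>y. wave (- k) y * u y $ j)" for j
    by (intro fourier_integrand_cont smooth_periodicD(3)[OF SP_component[OF u]])
  then have "continuous_on UNIV (\<lambda>y. \<chi> j. wave (- k) y * u y $ j)"
    by (intro continuous_on_vec_lambda)
  then have cont: "continuous_on UNIV (\<lambda>y. wave (- k) y *s u y)"
    by (simp add: vector_scalar_mult_def)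
  have "fourier_coeff v1 v2 u k = mean (\<lambda>y. wave (- k) y *s u y)"
    by (simp only: fourier_coeff_def mean_def wave Let_def case_prod_unfold)
  then show ?thesis
    using mean_bounded_linear[OF bounded_linear_vec_nth cont, of j] by (simp add: fourier_def)
qed

lemma scalar_op_has_sum:
  assumes "s \<in> S m" "u \<in> SP"
  shows "((\<lambda>k. wave k x * (s (x, k) * fourier u k)) has_sum scalar_op s u x) D"
  unfolding scalar_op_def by (rule has_sum_infsum[OF scalar_op_summable[OF assms]])

lemma has_sum_sum_finite:
  fixes f :: "'j \<Rightarrow> 'i \<Rightarrow> complex"
  assumes "\<And>j. j \<in> J \<Longrightarrow> (f j has_sum a j) A"
  shows "((\<lambda>k. \<Sum>j\<in>J. f j k) has_sum (\<Sum>j\<in>J. a j)) A"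
  using assms by (induction J rule: infinite_finite_induct) (auto intro: has_sum_add)

text \<open>Reduces statements about vector-valued operators to the scalar calculus, entry by
  entry.\<close>

lemma Op_matsym:
  assumes A: "\<And>i j. A i j \<in> S m" and u: "u \<in> SP"
  shows "Op v1 v2 (matsym A) u x $ i = (\<Sum>j\<in>UNIV. scalar_op (A i j) (\<lambda>y. u y $ j) x)"
proof -
  have "((\<lambda>k. exp (\<i> * complex_of_real (k \<bullet> x)) *s (matsym A (x, k) *v fourier_coeff v1 v2 u k)) has_sum
      (\<chi> i. \<Sum>j\<in>UNIV. scalar_op (A i j) (\<lambda>y. u y $ j) x)) D"
  proof (rule has_sum_vec)
    fix i
    have "((\<lambda>k. \<Sum>j\<in>UNIV. wave k x * (A i j (x, k) * fourier (\<lambda>y. u y $ j) k)) has_sum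
        (\<Sum>j\<in>UNIV. scalar_op (A i j) (\<lambda>y. u y $ j) x)) D"
      by (intro has_sum_sum_finite scalar_op_has_sum[OF A SP_component[OF u]])
    then show "((\<lambda>k. (exp (\<i> * complex_of_real (k \<bullet> x)) *s (matsym A (x, k) *v fourier_coeff v1 v2 u k)) $ i) has_sum
        (\<chi> i. \<Sum>j\<in>UNIV. scalar_op (A i j) (\<lambda>y. u y $ j) x) $ i) D"
      by (simp add: matrix_vector_mult_def matsym_def fourier_coeff_component[OF u] wave_def sum_distrib_left)
  qed
  then have "Op v1 v2 (matsym A) u x = (\<chi> i. \<Sum>j\<in>UNIV. scalar_op (A i j) (\<lambda>y. u y $ j) x)"
    unfolding Op_def by (rule infsumI)
  then show ?thesis by simp
qed

text \<open>A function is a symbol independent of \<open>k\<close>; composing \<open>s\<close> with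
  it and setting \<open>k = 0\<close> gives \<open>scalar_op s u\<close>, so smoothness is inherited
  from \<open>sharp_symbol\<close>.\<close>

lemma scalar_op_SP:
  assumes s: "s \<in> S m" and u: "u \<in> SP"
  shows "scalar_op s u \<in> SP"
proof -
  have "sharp s (\<lambda>q. u (fst q)) \<in> S m"
    by (rule sharp_symbol[OF s symbol_of_function[OF u]]) simp
  moreover have "(\<lambda>x. sharp s (\<lambda>q. u (fst q)) (x, 0)) = scalar_op s u"
    by (rule ext) (simp add: sharp_def scalar_op_def comp_term_def hat_def mult_ac)
  ultimately show ?thesis using symbol_slice by metis
qed

lemma scalar_op_add_symbol:
  assumes "s \<in> S m" "s' \<in> S m'" "u \<in> SP"
  shows "scalar_op (\<lambda>q. s q + s' q) u x = scalar_op s u x + scalar_op s' u x"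
  using has_sum_add[OF scalar_op_has_sum[OF assms(1,3)] scalar_op_has_sum[OF assms(2,3)], of x x]
  unfolding scalar_op_def by (intro infsumI) (simp add: algebra_simps)

lemma scalar_op_sum_symbol:
  assumes "\<And>j. j \<in> J \<Longrightarrow> s j \<in> S m" "u \<in> SP"
  shows "scalar_op (\<lambda>q. \<Sum>j\<in>J. s j q) u x = (\<Sum>j\<in>J. scalar_op (s j) u x)"
  using assms(1)
proof (induction J rule: infinite_finite_induct)
  case (insert j J)
  then show ?case
    using scalar_op_add_symbol[OF _ symbol_class_sum assms(2), of "s j" m J s m] by auto
qed (simp_all add: scalar_op_def)

lemma scalar_op_function_mult: "scalar_op (\<lambda>q. f (fst q) * s q) u x = f x * scalar_op s u x"
proof -
  have "scalar_op (\<lambda>q. f (fst q) * s q) u x = (\<Sum>\<^sub>\<infinity>k\<in>D. f x * (wave k x * (s (x, k) * fourier u k)))"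
    unfolding scalar_op_def by (rule infsum_cong) (simp add: mult_ac)
  also have "\<dots> = f x * scalar_op s u x"
    unfolding scalar_op_def by (rule infsum_cmult_right')
  finally show ?thesis .
qed

lemma scalar_op_add:
  assumes "s \<in> S m" "u \<in> SP" "w \<in> SP"
  shows "scalar_op s (\<lambda>y. u y + w y) x = scalar_op s u x + scalar_op s w x"
  using has_sum_add[OF scalar_op_has_sum[OF assms(1,2)] scalar_op_has_sum[OF assms(1,3)], of x x]
  unfolding scalar_op_def
  by (intro infsumI) (simp add: fourier_add smooth_periodicD(3)[OF assms(2)] smooth_periodicD(3)[OF assms(3)] algebra_simps)

lemma scalar_op_diff:
  assumes "s \<in> S m" "u \<in> SP" "w \<in> SP"
  shows "scalar_op s (\<lambda>y. u y - w y) x = scalar_op s u x - scalar_op s w x"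
  using scalar_op_add[OF assms(1) SP_diff[OF assms(2,3)] assms(3), of x] by simp

lemma scalar_op_one:
  assumes "u \<in> SP"
  shows "scalar_op (\<lambda>q. 1) u x = u x"
  unfolding scalar_op_def using infsumI[OF fourier_inversion[OF assms]] by (simp add: mult.commute)

lemma scalar_op_coordinate:
  assumes "u \<in> SP"
  shows "scalar_op (\<lambda>q. \<i> * complex_of_real (snd q $ i)) u x = dderiv (axis i 1) u x"
proof -
  have "scalar_op (\<lambda>q. \<i> * complex_of_real (snd q $ i)) u x = (\<Sum>\<^sub>\<infinity>k\<in>D. fourier (dderiv (axis i 1) u) k * wave k x)"
    unfolding scalar_op_def by (rule infsum_cong) (simp add: fourier_dderiv[OF assms] inner_axis mult_ac)
  also have "\<dots> = dderiv (axis i 1) u x"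
    by (rule infsumI[OF fourier_inversion[OF smooth_periodic_dderiv[OF assms]]])
  finally show ?thesis .
qed

end


section \<open>Functions on the strip\<close>

locale strip = torus +
  fixes h :: real
begin

abbreviation "I \<equiv> {- h<..<0}"
abbreviation "ST \<equiv> smooth_periodic_strip v1 v2 h"

lemma open_strip: "open ((UNIV :: (real^2) set) \<times> I)"
  by (intro open_Times) auto

lemma ST_smooth: "F \<in> ST \<Longrightarrow> smooth_on (UNIV \<times> I) F"
  and ST_periodic: "F \<in> ST \<Longrightarrow> w \<in> I \<Longrightarrow> l \<in> L \<Longrightarrow> F (x + l, w) = F (x, w)"
  by (auto simp: smooth_periodic_strip_def)

lemma ST_diff: "F \<in> ST \<Longrightarrow> w \<in> I \<Longrightarrow> F differentiable (at (x, w))"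
  by (rule smooth_on_differentiable[OF ST_smooth]) auto

lemma ST_dderiv:
  assumes F: "F \<in> ST"
  shows "dderiv v F \<in> ST"
proof -
  have "dderiv v F (x + l, w) = dderiv v F (x, w)" if "w \<in> I" "l \<in> L" for x w l
  proof -
    have "(x + l, w) + t *\<^sub>R v = ((x, w) + t *\<^sub>R v) + (l, 0)" for t
      by (cases v) (simp add: add_ac)
    then have "dderiv v F (x + l, w) = dderiv v (\<lambda>q. F (q + (l, 0))) (x, w)"
      by (simp only: dderiv_def)
    also have "\<dots> = dderiv v F (x, w)"
      by (rule dderiv_cong_open[OF open_strip]) (use that ST_periodic[OF F] in auto)
    finally show ?thesis .
  qed
  then show ?thesis
    using smooth_on_dderiv[OF ST_smooth[OF F]] by (simp add: smooth_periodic_strip_def)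
qed

lemma ST_bounded_linear:
  assumes "bounded_linear B" "F \<in> ST"
  shows "(\<lambda>q. B (F q)) \<in> ST"
  using smooth_on_bounded_linear[OF open_strip assms(1) ST_smooth[OF assms(2)]] ST_periodic[OF assms(2)]
  by (simp add: smooth_periodic_strip_def)

lemma ST_add:
  assumes "F \<in> ST" "G \<in> ST"
  shows "(\<lambda>q. F q + G q) \<in> ST"
  using smooth_on_add[OF open_strip ST_smooth[OF assms(1)] ST_smooth[OF assms(2)]]
    ST_periodic[OF assms(1)] ST_periodic[OF assms(2)]
  by (simp add: smooth_periodic_strip_def)

lemma ST_slice:
  assumes "F \<in> ST" and w: "w \<in> I"
  shows "(\<lambda>y. F (y, w)) \<in> SP"
proof -
  have diff: "(\<lambda>y. F (y, w)) differentiable (at p)" if "F \<in> ST" for F p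
    by (rule differentiable_compose[of F "\<lambda>y. (y, w)", OF ST_diff[OF that w]])
      (auto intro!: derivative_intros simp: differentiable_def)
  have "smooth_on UNIV (\<lambda>y. F (y, w))"
  proof (rule smooth_on_coinduct[where T = "{\<lambda>y. F (y, w) | F. F \<in> ST}"])
    fix f v assume "f \<in> {\<lambda>y. F (y, w) | F. F \<in> ST}"
    then obtain F where F: "F \<in> ST" "f = (\<lambda>y. F (y, w))" by blast
    then show "\<exists>g\<in>{\<lambda>y. F (y, w) | F. F \<in> ST}. \<forall>p\<in>UNIV. dderiv v f p = g p"
      using ST_dderiv[OF F(1), of "(v, 0)"] by (intro bexI[of _ "\<lambda>y. dderiv (v, 0) F (y, w)"]) (auto simp: dderiv_slice)
  qed (use assms diff in auto)
  then show ?thesis using ST_periodic[OF assms(1) w] by (simp add: smooth_periodic_def)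
qed

text \<open>Bounds hold on compact subintervals of \<open>w\<close>, as members of \<open>ST\<close>
  may be unbounded near the ends of the strip.\<close>

lemma ST_bounded:
  assumes F: "F \<in> ST" and cd: "{c..d} \<subseteq> I"
  shows "\<exists>C\<ge>0. \<forall>x. \<forall>w\<in>{c..d}. norm (F (x, w)) \<le> C"
proof -
  define K :: "((real \<times> real) \<times> real) set" where "K = cbox (0, 0) (1, 1) \<times> {c..d}"
  define \<psi> where "\<psi> z = (fst (fst z) *\<^sub>R v1 + snd (fst z) *\<^sub>R v2, snd z)" for z :: "(real \<times> real) \<times> real"
  have "compact K" unfolding K_def by (intro compact_Times compact_cbox) simp
  moreover have "continuous_on K (\<lambda>z. F (\<psi> z))"
    by (rule continuous_on_compose2[OF smooth_on_continuous[OF ST_smooth[OF F]]])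
      (use cd in \<open>auto simp: \<psi>_def K_def intro!: continuous_intros\<close>)
  ultimately have "bounded ((\<lambda>z. F (\<psi> z)) ` K)"
    by (intro compact_imp_bounded compact_continuous_image)
  then obtain C where C: "\<And>z. z \<in> K \<Longrightarrow> norm (F (\<psi> z)) \<le> C" unfolding bounded_iff by auto
  have "norm (F (x, w)) \<le> \<bar>C\<bar>" if w: "w \<in> {c..d}" for x w
  proof -
    obtain s t l where st: "s \<in> {0..1}" "t \<in> {0..1}" "l \<in> L" "x = s *\<^sub>R v1 + t *\<^sub>R v2 + l"
      by (rule fundamental_cell)
    have "F (x, w) = F (\<psi> ((s, t), w))"
      using ST_periodic[OF F _ st(3)] w cd st(4) by (auto simp: \<psi>_def)
    moreover have "((s, t), w) \<in> K" using st w by (auto simp: K_def cbox_Pair_eq)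
    ultimately show ?thesis using C by (metis abs_ge_self order_trans)
  qed
  then show ?thesis by (intro exI[of _ "\<bar>C\<bar>"]) auto
qed

lemma bessel_symbol_ST:
  fixes f :: "(real^2) \<times> real \<Rightarrow> complex"
  assumes "f \<in> ST"
  shows "bessel_symbol f \<in> ST"
proof -
  have "bessel_symbol f = (\<lambda>q. f q + (-1) *\<^sub>R (dderiv (axis 1 1, 0) (dderiv (axis 1 1, 0) f) q
      + dderiv (axis 2 1, 0) (dderiv (axis 2 1, 0) f) q))"
    by (rule ext) (simp add: bessel_symbol_def sum_2)
  also have "\<dots> \<in> ST"
    by (intro ST_add assms ST_bounded_linear[OF bounded_linear_scaleR_right] ST_dderiv)
  finally show ?thesis .
qed

lemma ST_fourier_bound:
  fixes f :: "(real^2) \<times> real \<Rightarrow> complex"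
  assumes f: "f \<in> ST" and cd: "{c..d} \<subseteq> I"
  obtains C where "C \<ge> 0"
    "\<And>k w. k \<in> D \<Longrightarrow> w \<in> {c..d} \<Longrightarrow> norm (fourier (\<lambda>y. f (y, w)) k) \<le> C / (1 + (norm k)\<^sup>2) ^ n"
proof -
  have "(bessel_symbol ^^ n) f \<in> ST" by (induction n) (auto simp: f intro: bessel_symbol_ST)
  from ST_bounded[OF this cd] obtain C where
    C: "C \<ge> 0" "\<And>x w. w \<in> {c..d} \<Longrightarrow> norm ((bessel_symbol ^^ n) f (x, w)) \<le> C" by blast
  have "norm (fourier (\<lambda>y. f (y, w)) k) \<le> C / (1 + (norm k)\<^sup>2) ^ n" if "k \<in> D" "w \<in> {c..d}" for k w
    by (rule fourier_decay_explicit[OF ST_slice[OF f] that(1)])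
      (use that cd C(2) in \<open>auto simp: bessel_funpow_slice\<close>)
  then show ?thesis using that C(1) by blast
qed

lemma fourier_has_vector_derivative:
  fixes f :: "(real^2) \<times> real \<Rightarrow> complex"
  assumes f: "f \<in> ST" and w: "w \<in> I"
  shows "((\<lambda>w. fourier (\<lambda>y. f (y, w)) k) has_vector_derivative fourier (\<lambda>y. dw f (y, w)) k) (at w)"
proof -
  define \<phi> where "\<phi> p = fst p *\<^sub>R v1 + snd p *\<^sub>R v2" for p :: "real \<times> real"
  have der: "((\<lambda>w. f (y, w)) has_vector_derivative dw f (y, w)) (at w within A)" if "w \<in> I" for w y A
  proof -
    have "((\<lambda>w. f ((y, 0) + w *\<^sub>R (0, 1))) has_vector_derivative dderiv (0, 1) f ((y, 0) + w *\<^sub>R (0, 1))) (at w within A)"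
      by (rule has_vector_derivative_dderiv) (use ST_diff[OF f that] in simp)
    then show ?thesis by (simp add: dw_def)
  qed
  have cont: "continuous_on A (\<lambda>q. wave (- k) (\<phi> (g q)) * F (\<phi> (g q), r q))"
    if "F \<in> ST" "continuous_on A g" "continuous_on A r" "\<And>q. q \<in> A \<Longrightarrow> r q \<in> I"
    for F g r and A :: "'x::topological_space set"
    unfolding \<phi>_def
    by (intro continuous_intros continuous_on_compose2[OF continuous_wave[of UNIV]]
        continuous_on_compose2[OF smooth_on_continuous[OF ST_smooth[OF that(1)]]] that(2,3)) (use that(4) in auto)
  have dwf: "dw f \<in> ST" unfolding dw_def by (rule ST_dderiv[OF f])
  have "((\<lambda>w. integral (cbox (0, 0) (1, 1)) (\<lambda>p. wave (- k) (\<phi> p) * f (\<phi> p, w))) has_vector_derivative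
      integral (cbox (0, 0) (1, 1)) (\<lambda>p. wave (- k) (\<phi> p) * dw f (\<phi> p, w))) (at w within I)"
  proof (rule leibniz_rule_vector_derivative[OF _ _ _ w])
    fix w p assume w: "w \<in> I"
    show "((\<lambda>w. wave (- k) (\<phi> p) * f (\<phi> p, w)) has_vector_derivative wave (- k) (\<phi> p) * dw f (\<phi> p, w)) (at w within I)"
      by (rule bounded_linear.has_vector_derivative[OF bounded_linear_mult_right der[OF w]])
  next
    fix w assume w: "w \<in> I"
    show "(\<lambda>p. wave (- k) (\<phi> p) * f (\<phi> p, w)) integrable_on cbox (0, 0) (1, 1)"
      by (rule integrable_continuous, rule cont[of f _ "\<lambda>p. p" "\<lambda>p. w"]) (use f w in auto)
  next
    show "continuous_on (I \<times> cbox (0, 0) (1, 1)) (\<lambda>(w, p). wave (- k) (\<phi> p) * dw f (\<phi> p, w))"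
      unfolding case_prod_unfold
      by (rule cont[of "dw f" _ snd fst]) (auto intro!: dwf continuous_intros)
  qed auto
  moreover have "at w within I = at w" using w by (intro at_within_open) auto
  ultimately show ?thesis by (simp add: fourier_def mean_def \<phi>_def)
qed

text \<open>The series is differentiated term by term. Its majorant is uniform in \<open>w\<close>
  near the given point because the Bessel iterates of \<open>f\<close> and \<open>dw f\<close> are
  bounded on a compact subinterval.\<close>

lemma scalar_op_has_vector_derivative:
  fixes f :: "(real^2) \<times> real \<Rightarrow> complex"
  assumes s: "s \<in> S m" and f: "f \<in> ST" and w: "w \<in> I"
  shows "((\<lambda>w. scalar_op s (\<lambda>y. f (y, w)) x) has_vector_derivative scalar_op s (\<lambda>y. dw f (y, w)) x) (at w)"
proof -
  \<comment> \<open>Half the distance to the nearer end of the interval, so the closed neighbourhood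
    stays inside.\<close>
  define e where "e = min (w + h) (- w) / 2"
  have e: "e > 0" "{w - e..w + e} \<subseteq> I" using w by (auto simp: e_def min_def field_simps)
  have dwf: "dw f \<in> ST" unfolding dw_def by (rule ST_dderiv[OF f])
  obtain C where C: "C \<ge> 0" "\<And>x k. norm (s (x, k)) \<le> C * (1 + norm k) powr m"
    using symbol_class_bound[OF s] by blast
  obtain N :: nat and B where B: "B \<ge> 0" "\<And>k. (1 + norm k) powr m / (1 + (norm k)\<^sup>2) ^ N \<le> B * decay_weight k"
    using weight_absorb[where r = m] by metis
  obtain E1 where E1: "E1 \<ge> 0" "\<And>k w'. k \<in> D \<Longrightarrow> w' \<in> {w - e..w + e} \<Longrightarrow> norm (fourier (\<lambda>y. f (y, w')) k) \<le> E1 / (1 + (norm k)\<^sup>2) ^ N"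
    using ST_fourier_bound[OF f e(2), where n = N] by metis
  obtain E2 where E2: "E2 \<ge> 0" "\<And>k w'. k \<in> D \<Longrightarrow> w' \<in> {w - e..w + e} \<Longrightarrow> norm (fourier (\<lambda>y. dw f (y, w')) k) \<le> E2 / (1 + (norm k)\<^sup>2) ^ N"
    using ST_fourier_bound[OF dwf e(2), where n = N] by metis
  have bound: "norm (wave k x * (s (x, k) * z)) \<le> C * (E1 + E2) * B * decay_weight k"
    if z: "norm z \<le> E / (1 + (norm k)\<^sup>2) ^ N" and E: "E \<le> E1 + E2" for z k E
  proof -
    have pos: "0 < (1 + (norm k)\<^sup>2) ^ N" by (simp add: add_pos_nonneg)
    have "norm (wave k x * (s (x, k) * z)) = norm (s (x, k)) * norm z" by (simp add: norm_mult)
    also have "\<dots> \<le> (C * (1 + norm k) powr m) * ((E1 + E2) / (1 + (norm k)\<^sup>2) ^ N)"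
      using z E pos C by (intro mult_mono order_trans[OF z] divide_right_mono) auto
    also have "\<dots> = C * (E1 + E2) * ((1 + norm k) powr m / (1 + (norm k)\<^sup>2) ^ N)" by simp
    also have "\<dots> \<le> C * (E1 + E2) * (B * decay_weight k)"
      using C(1) E1(1) E2(1) by (intro mult_left_mono B(2)) auto
    finally show ?thesis by (simp add: mult_ac)
  qed
  have "((\<lambda>w. \<Sum>\<^sub>\<infinity>k\<in>D. wave k x * (s (x, k) * fourier (\<lambda>y. f (y, w)) k)) has_derivative
      (\<lambda>t. \<Sum>\<^sub>\<infinity>k\<in>D. t *\<^sub>R (wave k x * (s (x, k) * fourier (\<lambda>y. dw f (y, w)) k)))) (at w)"
  proof (rule has_derivative_infsum[where U = "{w - e<..<w + e}" and M = "\<lambda>k. C * (E1 + E2) * B * decay_weight k"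
        and f' = "\<lambda>k w t. t *\<^sub>R (wave k x * (s (x, k) * fourier (\<lambda>y. dw f (y, w)) k))"])
    fix k w' assume k: "k \<in> D" and w': "w' \<in> {w - e<..<w + e}"
    from w' have "w' \<in> {w - e..w + e}" by auto
    with e(2) have w': "w' \<in> I" "w' \<in> {w - e..w + e}" by blast+
    have "bounded_linear (\<lambda>z. wave k x * (s (x, k) * z))"
      by (intro bounded_linear_compose[OF bounded_linear_mult_right] bounded_linear_mult_right)
    from bounded_linear.has_vector_derivative[OF this fourier_has_vector_derivative[OF f w'(1)]]
    show "((\<lambda>w. wave k x * (s (x, k) * fourier (\<lambda>y. f (y, w)) k)) has_derivative
        (\<lambda>t. t *\<^sub>R (wave k x * (s (x, k) * fourier (\<lambda>y. dw f (y, w')) k)))) (at w')"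
      by (simp add: has_vector_derivative_def)
    show "norm (wave k x * (s (x, k) * fourier (\<lambda>y. f (y, w')) k)) \<le> C * (E1 + E2) * B * decay_weight k"
      by (rule bound[OF E1(2)[OF k w'(2)]]) (use E2(1) in simp)
    have "norm (wave k x * (s (x, k) * fourier (\<lambda>y. dw f (y, w')) k)) \<le> C * (E1 + E2) * B * decay_weight k"
      by (rule bound[OF E2(2)[OF k w'(2)]]) (use E1(1) in simp)
    from mult_left_mono[OF this abs_ge_zero]
    show "norm (t *\<^sub>R (wave k x * (s (x, k) * fourier (\<lambda>y. dw f (y, w')) k))) \<le> C * (E1 + E2) * B * decay_weight k * norm t" for t
      by (simp add: mult.commute)
  qed (use e(1) in \<open>auto intro!: summable_on_cmult_right decay_weight_summable\<close>)
  then show ?thesis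
    unfolding has_vector_derivative_def scalar_op_def by (simp add: infsum_scaleR_right)
qed

end


section \<open>The factorisation\<close>

locale factorisation = strip +
  fixes \<alpha> \<delta> :: real and \<eta> :: "real^2 \<Rightarrow> real"
  assumes eta: "\<eta> \<in> smooth_periodic v1 v2" and delta_pos: "\<delta> > 0"
begin

section \<open>The coefficients of \<open>L\<close> and the characteristic discriminant\<close>

definition ac :: "real^2 \<Rightarrow> complex" where "ac x = complex_of_real (coeff_a \<delta> \<eta> x)"
definition bc :: "2 \<Rightarrow> real^2 \<Rightarrow> complex" where "bc i x = complex_of_real (coeff_b \<delta> \<eta> x $ i)"
definition cc :: "real^2 \<Rightarrow> complex" where "cc x = complex_of_real (coeff_c \<delta> \<eta> x)"

definition ik :: "2 \<Rightarrow> phase \<Rightarrow> complex" where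
  "ik i q = \<i> * complex_of_real (snd q $ i)"

lemma grad_SP: "(\<lambda>x. complex_of_real (grad \<eta> x $ i)) \<in> SP"
  unfolding grad_def vec_lambda_beta
  by (rule smooth_periodic_bounded_linear[OF bounded_linear_of_real smooth_periodic_dderiv[OF eta]])

lemma norm_grad: "(norm (grad \<eta> x))\<^sup>2 = (grad \<eta> x $ 1)\<^sup>2 + (grad \<eta> x $ 2)\<^sup>2"
  unfolding power2_norm_eq_inner by (simp add: inner_vec_def sum_2 power2_eq_square)

lemma ac_SP: "ac \<in> SP"
proof -
  let ?g = "\<lambda>i x. complex_of_real (grad \<eta> x $ i)"
  have "(\<lambda>x. complex_of_real (1 / \<delta>\<^sup>2) * (1 + (?g 1 x * ?g 1 x + ?g 2 x * ?g 2 x))) \<in> SP"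
    by (intro SP_cmult SP_add SP_mult grad_SP smooth_periodic_const)
  moreover have "ac = (\<lambda>x. complex_of_real (1 / \<delta>\<^sup>2) * (1 + (?g 1 x * ?g 1 x + ?g 2 x * ?g 2 x)))"
    unfolding ac_def[abs_def] coeff_a_def norm_grad by (rule ext) (simp add: power2_eq_square)
  ultimately show ?thesis by simp
qed

lemma bc_SP: "bc i \<in> SP"
proof -
  have "(\<lambda>x. complex_of_real (- (2 / \<delta>)) * complex_of_real (grad \<eta> x $ i)) \<in> SP"
    by (intro SP_cmult grad_SP)
  moreover have "bc i = (\<lambda>x. complex_of_real (- (2 / \<delta>)) * complex_of_real (grad \<eta> x $ i))"
    by (rule ext) (simp add: bc_def coeff_b_def)
  ultimately show ?thesis by simp
qed

lemma cc_SP: "cc \<in> SP"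
proof -
  let ?d = "\<lambda>i x. complex_of_real (dderiv (axis i 1) (dderiv (axis i 1) \<eta>) x)"
  have "(\<lambda>x. complex_of_real (1 / \<delta>) * (?d 1 x + ?d 2 x)) \<in> SP"
    by (intro SP_cmult SP_add smooth_periodic_bounded_linear[OF bounded_linear_of_real] smooth_periodic_dderiv eta)
  moreover have "cc = (\<lambda>x. complex_of_real (1 / \<delta>) * (?d 1 x + ?d 2 x))"
    by (rule ext) (simp add: cc_def coeff_c_def laplacian_def sum_2)
  ultimately show ?thesis by simp
qed

lemma a_pos: "0 < coeff_a \<delta> \<eta> x" and a_lower: "1 / \<delta>\<^sup>2 \<le> coeff_a \<delta> \<eta> x"
  using delta_pos by (auto simp: coeff_a_def add_pos_nonneg divide_right_mono)

definition ai :: "real^2 \<Rightarrow> complex" where "ai x = complex_of_real (inverse (coeff_a \<delta> \<eta> x))"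

text \<open>Smoothness of the reciprocal comes from \<open>symbol_powr\<close> in order 0 with
  exponent -1, read off at \<open>k = 0\<close>.\<close>

lemma ai_SP: "ai \<in> SP"
proof -
  have "(\<lambda>q. complex_of_real (coeff_a \<delta> \<eta> (fst q))) \<in> S 0"
    using symbol_of_function[OF ac_SP] by (simp add: ac_def)
  then have "(\<lambda>q. complex_of_real (coeff_a \<delta> \<eta> (fst q) powr (- 1))) \<in> S (0 * (- 1))"
    by (rule symbol_powr[where c = "1 / \<delta>\<^sup>2"])
      (use delta_pos a_lower in \<open>auto simp: add_nonneg_eq_0_iff\<close>)
  from symbol_slice[OF this, of 0] show ?thesis
    using a_pos by (simp add: ai_def[abs_def] powr_minus abs_of_pos)
qed

lemma ac_ai: "ac x * ai x = 1"
  using a_pos[of x] by (simp add: ac_def ai_def flip: of_real_mult)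

lemma ik_symbol: "ik i \<in> S 1"
  unfolding ik_def[abs_def] by (rule symbol_cmult[OF symbol_coordinate])

text \<open>The symbol of \<open>b . grad\<close>, the scalar principal part of \<open>L1\<close>;
  \<open>\<kappa>\<close> below is that of the Laplacian in \<open>L0\<close>.\<close>

definition \<beta> :: "phase \<Rightarrow> complex" where
  "\<beta> q = bc 1 (fst q) * ik 1 q + bc 2 (fst q) * ik 2 q"

definition \<kappa> :: "phase \<Rightarrow> complex" where
  "\<kappa> q = ik 1 q * ik 1 q + ik 2 q * ik 2 q"

lemma \<beta>_symbol: "\<beta> \<in> S 1"
  unfolding \<beta>_def[abs_def] by (intro symbol_class_add symbol_function_mult bc_SP ik_symbol)

lemma \<kappa>_symbol: "\<kappa> \<in> S 2"
  unfolding \<kappa>_def[abs_def] by (intro symbol_class_add symbol_class_mult[OF ik_symbol ik_symbol]) auto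

lemma \<beta>_eq: "\<beta> q = \<i> * complex_of_real (coeff_b \<delta> \<eta> (fst q) \<bullet> snd q)"
  by (simp add: \<beta>_def bc_def ik_def inner_vec_def sum_2 algebra_simps)

lemma \<kappa>_eq: "\<kappa> q = - complex_of_real ((norm (snd q))\<^sup>2)"
proof -
  have "(norm (snd q))\<^sup>2 = snd q $ 1 * snd q $ 1 + snd q $ 2 * snd q $ 2"
    unfolding power2_norm_eq_inner by (simp add: inner_vec_def sum_2)
  then show ?thesis by (simp add: \<kappa>_def ik_def algebra_simps)
qed

text \<open>The bump \<open>flat_ball 0 1\<close>, supported in \<open>\<bar>k\<bar> \<le> 1\<close>, keeps the square root away from its
  singularity at \<open>k = 0\<close>.\<close>

definition disc :: "phase \<Rightarrow> real" where
  "disc q = 4 * coeff_a \<delta> \<eta> (fst q) * (norm (snd q))\<^sup>2 - (coeff_b \<delta> \<eta> (fst q) \<bullet> snd q)\<^sup>2 + flat_ball 0 1 q"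

lemma disc_complex:
  "complex_of_real (disc q) = \<beta> q * \<beta> q - 4 * (ac (fst q) * \<kappa> q) + complex_of_real (flat_ball 0 1 q)"
proof -
  have "\<i> * z * (\<i> * z) = - (z * z)" for z by (simp add: algebra_simps)
  then show ?thesis unfolding \<beta>_eq \<kappa>_eq disc_def ac_def by (simp add: power2_eq_square)
qed

lemma bump_symbol: "(\<lambda>q. complex_of_real (flat_ball 0 1 q)) \<in> S m"
  using symbol_cutoff[OF symbol_const[of 1], of 1 0 m] by simp

lemma disc_symbol: "(\<lambda>q. complex_of_real (disc q)) \<in> S 2"
  unfolding disc_complex
  by (intro symbol_class_add symbol_class_diff_closed symbol_cmult symbol_function_mult ac_SP \<kappa>_symbol
      bump_symbol symbol_class_mult[OF \<beta>_symbol \<beta>_symbol]) auto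

text \<open>Inserting \<open>b = - 2 grad \<eta> / \<delta>\<close> turns the quadratic part into
  \<open>4 / \<delta>^2\<close> times
  \<open>(1 + |grad \<eta>|^2) |k|^2 - (grad \<eta> . k)^2\<close>; Cauchy-Schwarz leaves
  \<open>|k|^2\<close>.\<close>

lemma disc_lower_quadratic: "4 / \<delta>\<^sup>2 * (norm k)\<^sup>2 + flat_ball 0 1 (x, k) \<le> disc (x, k)"
proof -
  let ?g = "grad \<eta> x"
  have "(?g \<bullet> k)\<^sup>2 \<le> (norm ?g)\<^sup>2 * (norm k)\<^sup>2"
    using Cauchy_Schwarz_ineq[of ?g k] by (simp add: power2_norm_eq_inner)
  then have "4 / \<delta>\<^sup>2 * (norm k)\<^sup>2 \<le> 4 / \<delta>\<^sup>2 * ((1 + (norm ?g)\<^sup>2) * (norm k)\<^sup>2 - (?g \<bullet> k)\<^sup>2)"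
    using delta_pos by (intro mult_left_mono) (auto simp: algebra_simps)
  also have "\<dots> = disc (x, k) - flat_ball 0 1 (x, k)"
    using delta_pos by (simp add: disc_def coeff_a_def coeff_b_def power_mult_distrib power_divide field_simps)
  finally show ?thesis by simp
qed

lemma disc_lower: "\<exists>c>0. \<forall>x k. c * (1 + norm k)\<^sup>2 \<le> disc (x, k)"
proof -
  define c0 where "c0 = exp (- (4 / 3) :: real)"
  \<comment> \<open>For \<open>|k| \<le> 1/2\<close> the bump is at least \<open>c0\<close>, as
    \<open>1 - |k|^2 \<ge> 3/4\<close>, and \<open>(1 + |k|)^2 \<le> 9/4\<close>. Otherwise
    \<open>1 + |k| \<le> 3 |k|\<close>, and the quadratic part suffices with \<open>4/9\<close> of
    \<open>1 / \<delta>^2\<close>.\<close>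
  define c where "c = min (4 / 9 * c0) (4 / 9 / \<delta>\<^sup>2)"
  have c: "c > 0" using delta_pos by (auto simp: c_def c0_def)
  have "c * (1 + norm k)\<^sup>2 \<le> disc (x, k)" for x k
  proof (cases "norm k \<le> 1 / 2")
    case True
    then have n: "(norm k)\<^sup>2 \<le> (1/2)\<^sup>2" by (intro power_mono) auto
    then have t: "1 - (norm k)\<^sup>2 \<ge> 3 / 4" by (simp add: power2_eq_square)
    then have "1 / (1 - (norm k)\<^sup>2) \<le> 4 / 3" by (simp add: divide_simps)
    then have "c0 \<le> flat_ball 0 1 (x, k)"
      using t by (simp add: c0_def flat_ball_def flat_def)
    moreover have "(1 + norm k)\<^sup>2 \<le> (3 / 2)\<^sup>2" using True by (intro power_mono) auto
    then have "c * (1 + norm k)\<^sup>2 \<le> 4 / 9 * c0 * (3 / 2)\<^sup>2"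
      using c by (intro mult_mono) (auto simp: c_def c0_def)
    moreover have "4 / 9 * c0 * (3 / 2)\<^sup>2 = c0" by (simp add: power2_eq_square)
    moreover have "0 \<le> 4 / \<delta>\<^sup>2 * (norm k)\<^sup>2" by simp
    ultimately show ?thesis using disc_lower_quadratic[of k x] by linarith
  next
    case False
    then have "(1 + norm k)\<^sup>2 \<le> (3 * norm k)\<^sup>2" by (intro power_mono) auto
    then have "c * (1 + norm k)\<^sup>2 \<le> (4 / 9 / \<delta>\<^sup>2) * (3 * norm k)\<^sup>2"
      using c by (intro mult_mono) (auto simp: c_def)
    also have "\<dots> = 4 / \<delta>\<^sup>2 * (norm k)\<^sup>2" by (simp add: power_mult_distrib)
    finally show ?thesis using disc_lower_quadratic[of k x] flat_ball_nonneg[of 0 1 "(x, k)"] by linarith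
  qed
  then show ?thesis using c by blast
qed

lemma disc_pos: "disc q > 0"
proof -
  obtain c where c: "c > 0" "\<And>x k. c * (1 + norm k)\<^sup>2 \<le> disc (x, k)" using disc_lower by blast
  have "0 < c * (1 + norm (snd q))\<^sup>2" using c(1) norm_ge_zero[of "snd q"] by (intro mult_pos_pos zero_less_power) (auto simp: add_pos_nonneg)
  then show ?thesis using c(2)[of "snd q" "fst q"] by simp
qed

lemma disc_powr_symbol: "(\<lambda>q. complex_of_real (disc q powr r)) \<in> S (2 * r)"
proof -
  obtain c where c: "c > 0" "\<And>x k. c * (1 + norm k)\<^sup>2 \<le> disc (x, k)" using disc_lower by blast
  have "(1 + norm k) powr 2 = (1 + norm k)\<^sup>2" for k :: "real^2" by (simp add: add_pos_nonneg)
  then show ?thesis using symbol_powr[OF disc_symbol c(1)] c(2) by simp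
qed

section \<open>The square root of the discriminant and the characteristic roots\<close>

definition \<rho> :: "phase \<Rightarrow> complex" where "\<rho> q = complex_of_real (sqrt (disc q))"

lemma \<rho>_powr: "\<rho> = (\<lambda>q. complex_of_real (disc q powr (1 / 2)))"
  using disc_pos by (intro ext) (simp add: \<rho>_def powr_half_sqrt less_imp_le)

lemma \<rho>_symbol: "\<rho> \<in> S 1"
  using disc_powr_symbol[of "1/2"] by (simp add: \<rho>_powr)

lemma \<rho>_square: "\<rho> q * \<rho> q = complex_of_real (disc q)"
  using disc_pos[of q] by (simp add: \<rho>_def flip: of_real_mult)

text \<open>\<open>root_symbol 1\<close> and \<open>root_symbol (- 1)\<close> are, up to the bump, \<open>m\<close> and \<open>- n\<close>: the roots of the
  characteristic equation \<open>a \<mu>\<^sup>2 + i (b \<cdot> k) \<mu> - \<bar>k\<bar>\<^sup>2 = 0\<close> are \<open>m\<close> and \<open>n\<close>.\<close>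

definition root_symbol :: "real \<Rightarrow> phase \<Rightarrow> complex" where
  "root_symbol \<sigma> q = 1/2 * (ai (fst q) * (\<rho> q - complex_of_real \<sigma> * \<beta> q))"

lemma root_symbol: "root_symbol \<sigma> \<in> S 1"
  unfolding root_symbol_def[abs_def]
  by (intro symbol_cmult symbol_function_mult ai_SP symbol_class_diff_closed \<rho>_symbol \<beta>_symbol)

lemma ac_root_symbol: "ac (fst q) * root_symbol \<sigma> q = 1/2 * (\<rho> q - complex_of_real \<sigma> * \<beta> q)"
proof -
  have "ac (fst q) * root_symbol \<sigma> q = 1/2 * ((ac (fst q) * ai (fst q)) * (\<rho> q - complex_of_real \<sigma> * \<beta> q))"
    by (simp add: root_symbol_def)
  then show ?thesis by (simp add: ac_ai)
qed

text \<open>The root formula solves the quadratic with the bump added to its discriminant, so the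
  original expression equals the bump divided by \<open>4 a\<close>, which is smoothing.\<close>

lemma eikonal: "(\<lambda>q. ac (fst q) * root_symbol 1 q * root_symbol 1 q + \<beta> q * root_symbol 1 q + \<kappa> q) \<in> S 1"
proof -
  have "ac (fst q) * root_symbol 1 q * root_symbol 1 q + \<beta> q * root_symbol 1 q + \<kappa> q =
      1/4 * (ai (fst q) * complex_of_real (flat_ball 0 1 q))" for q
  proof -
    let ?m = "root_symbol 1 q" and ?a = "ac (fst q)" and ?ai = "ai (fst q)"
    have "?a * ?m * ?m + \<beta> q * ?m + \<kappa> q = (?a * ?m + \<beta> q) * ?m + \<kappa> q"
      by (simp add: algebra_simps)
    also have "\<dots> = 1/4 * (?ai * (\<rho> q * \<rho> q - \<beta> q * \<beta> q)) + (?a * ?ai) * \<kappa> q"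
      unfolding ac_root_symbol ac_ai unfolding root_symbol_def by (simp add: field_simps)
    also have "\<dots> = 1/4 * (?ai * complex_of_real (flat_ball 0 1 q))"
      unfolding \<rho>_square disc_complex by (simp add: field_simps)
    finally show ?thesis .
  qed
  then show ?thesis by (simp only:) (intro symbol_cmult symbol_function_mult ai_SP bump_symbol)
qed

text \<open>Since \<open>\<beta>\<close> is purely imaginary, the real part is
  \<open>sqrt disc / (2 a)\<close> for either sign; \<open>disc\<close> is bounded below
  quadratically and \<open>a\<close> is bounded above by periodicity.\<close>

lemma root_symbol_elliptic: "strongly_elliptic v1 v2 (root_symbol \<sigma>)"
proof -
  obtain c where c: "c > 0" "\<And>x k. c * (1 + norm k)\<^sup>2 \<le> disc (x, k)" using disc_lower by blast
  obtain A where A: "A \<ge> 0" "\<And>x. norm (ac x) \<le> A"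
    using periodic_bounded[OF smooth_periodicD(3,2)[OF ac_SP]] by blast
  have A': "coeff_a \<delta> \<eta> x \<le> A" for x using A(2)[of x] a_pos[of x] by (simp add: ac_def)
  then have Apos: "A > 0" using a_pos[of 0] less_le_trans by blast
  have "Re (root_symbol \<sigma> (x, k)) \<ge> sqrt c / (2 * A) * sqrt (1 + (norm k)\<^sup>2)" for x k
  proof -
    have "1 + (norm k)\<^sup>2 \<le> (1 + norm k)\<^sup>2" by (simp add: power2_eq_square algebra_simps)
    then have "c * (1 + (norm k)\<^sup>2) \<le> disc (x, k)"
      using c(2)[of k x] mult_left_mono[OF _ less_imp_le[OF c(1)]] order_trans by blast
    then have 1: "sqrt c * sqrt (1 + (norm k)\<^sup>2) \<le> sqrt (disc (x, k))"
      by (simp flip: real_sqrt_mult)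
    have 2: "inverse A \<le> inverse (coeff_a \<delta> \<eta> x)"
      using A' a_pos by (intro le_imp_inverse_le)
    have "Re (root_symbol \<sigma> (x, k)) = 1/2 * (inverse (coeff_a \<delta> \<eta> x) * sqrt (disc (x, k)))"
    proof -
      have "Re (1/2 * (complex_of_real a' * (complex_of_real s - complex_of_real \<sigma> * (\<i> * complex_of_real b)))) = 1/2 * (a' * s)"
        for a' s b by simp
      then show ?thesis unfolding root_symbol_def \<beta>_eq \<rho>_def ai_def fst_conv snd_conv .
    qed
    moreover have "inverse A * (sqrt c * sqrt (1 + (norm k)\<^sup>2)) \<le> inverse (coeff_a \<delta> \<eta> x) * sqrt (disc (x, k))"
      using 1 2 Apos a_pos[of x] c(1) by (intro mult_mono) (auto simp: less_imp_le)
    moreover have "sqrt c / (2 * A) * sqrt (1 + (norm k)\<^sup>2) = 1/2 * (inverse A * (sqrt c * sqrt (1 + (norm k)\<^sup>2)))"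
      using Apos by (simp add: field_simps)
    ultimately show ?thesis by linarith
  qed
  moreover have "sqrt c / (2 * A) > 0" using c(1) Apos by simp
  ultimately show ?thesis unfolding strongly_elliptic_def using root_symbol by blast
qed

text \<open>For \<open>|k| \<ge> 1\<close> the bump vanishes, and \<open>disc\<close> is a quadratic
  form in \<open>k\<close>.\<close>

lemma root_symbol_homogeneous:
  assumes "norm k \<ge> 1" "t \<ge> 1"
  shows "root_symbol \<sigma> (x, t *\<^sub>R k) = complex_of_real t * root_symbol \<sigma> (x, k)"
proof -
  have "1 \<le> norm (t *\<^sub>R k)" using assms mult_mono[of 1 t 1 "norm k"] by simp
  then have "flat_ball 0 1 (x, t *\<^sub>R k) = 0" "flat_ball 0 1 (x, k) = 0"
    using assms(1) by (auto intro!: flat_ball_support)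
  then have "disc (x, t *\<^sub>R k) = t\<^sup>2 * disc (x, k)"
    by (simp add: disc_def power_mult_distrib algebra_simps)
  then have "\<rho> (x, t *\<^sub>R k) = complex_of_real t * \<rho> (x, k)"
    using assms(2) by (simp add: \<rho>_def real_sqrt_mult)
  moreover have "\<beta> (x, t *\<^sub>R k) = complex_of_real t * \<beta> (x, k)"
    by (simp add: \<beta>_eq)
  ultimately show ?thesis by (simp add: root_symbol_def algebra_simps)
qed

text \<open>The skew-symmetric part of \<open>L1\<close>, coming from the
  \<open>w\<close>-derivatives in \<open>\<alpha> curl\<close>; it has order 0.\<close>

definition Z :: "3 \<Rightarrow> 3 \<Rightarrow> real^2 \<Rightarrow> complex" where
  "Z i j x = (let g = complex_of_real (\<alpha> / \<delta>); gx = g * complex_of_real (grad \<eta> x $ 1);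
       gy = g * complex_of_real (grad \<eta> x $ 2)
     in (vector [vector [0, - g, - gy], vector [g, 0, gx], vector [gy, - gx, 0]] :: complex^3^3) $ i $ j)"

text \<open>The symbol of the horizontal derivatives in \<open>\<alpha> curl\<close>; it has order 1
  and so does not enter the principal part of \<open>L0\<close>.\<close>

definition V :: "3 \<Rightarrow> 3 \<Rightarrow> phase \<Rightarrow> complex" where
  "V i j q = (let kx = complex_of_real \<alpha> * ik 1 q; ky = complex_of_real \<alpha> * ik 2 q
     in (vector [vector [0, 0, ky], vector [0, 0, - kx], vector [- ky, kx, 0]] :: complex^3^3) $ i $ j)"

definition l1 :: "3 \<Rightarrow> 3 \<Rightarrow> phase \<Rightarrow> complex" where
  "l1 i j q = delta i j * \<beta> q + (- delta i j * cc (fst q) + Z i j (fst q))"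

definition l0 :: "3 \<Rightarrow> 3 \<Rightarrow> phase \<Rightarrow> complex" where
  "l0 i j q = delta i j * \<kappa> q + V i j q"

lemma Z_SP: "Z i j \<in> SP"
proof -
  let ?g = "complex_of_real (\<alpha> / \<delta>)"
  have 0: "(\<lambda>x. 0) \<in> SP" "(\<lambda>x. ?g) \<in> SP" "(\<lambda>x. - ?g) \<in> SP" by (rule smooth_periodic_const)+
  have 1: "(\<lambda>x. ?g * complex_of_real (grad \<eta> x $ i)) \<in> SP" for i by (rule SP_cmult[OF grad_SP])
  have 2: "(\<lambda>x. - (?g * complex_of_real (grad \<eta> x $ i))) \<in> SP" for i
    using SP_cmult[OF 1, of "- 1" i] by simp
  show ?thesis
    using exhaust_3[of i] exhaust_3[of j] 0 1 2
    by (elim disjE) (simp_all add: Z_def[abs_def] Let_def)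
qed

lemma V_symbol: "V i j \<in> S 1"
proof -
  have 1: "(\<lambda>q. complex_of_real \<alpha> * ik i q) \<in> S 1" for i by (rule symbol_cmult[OF ik_symbol])
  have 2: "(\<lambda>q. - (complex_of_real \<alpha> * ik i q)) \<in> S 1" for i by (rule symbol_class_uminus[OF 1])
  show ?thesis
    using exhaust_3[of i] exhaust_3[of j] 1 2
    by (elim disjE) (simp_all add: V_def[abs_def] Let_def symbol_class_zero)
qed

lemma l1_lower: "(\<lambda>q. - delta i j * cc (fst q) + Z i j (fst q)) \<in> S 0"
  by (intro symbol_class_add symbol_cmult symbol_of_function cc_SP Z_SP)

lemma l1_symbol: "l1 i j \<in> S 1"
  unfolding l1_def[abs_def]
  by (intro symbol_class_add[OF delta_mult[OF \<beta>_symbol]] symbol_class_mono[OF l1_lower]) simp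

lemma l0_symbol: "l0 i j \<in> S 2"
  unfolding l0_def[abs_def]
  by (intro symbol_class_add[OF delta_mult[OF \<kappa>_symbol]] symbol_class_mono[OF V_symbol]) simp

section \<open>\<open>L1\<close> and \<open>L0\<close> as operators with matrix symbols\<close>

lemma scalar_op_ik: "u \<in> SP \<Longrightarrow> scalar_op (ik i) u x = dderiv (axis i 1) u x"
  unfolding ik_def[abs_def] by (rule scalar_op_coordinate)

lemma scalar_op_ik_ik:
  assumes "u \<in> SP"
  shows "scalar_op (\<lambda>q. ik i q * ik i q) u x = dderiv (axis i 1) (dderiv (axis i 1) u) x"
proof -
  have "scalar_op (\<lambda>q. ik i q * ik i q) u x = scalar_op (ik i) (dderiv (axis i 1) u) x"
    unfolding scalar_op_def
    by (rule infsum_cong) (simp add: ik_def fourier_dderiv[OF assms] inner_axis mult_ac)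
  then show ?thesis by (simp add: scalar_op_ik smooth_periodic_dderiv[OF assms])
qed

lemma scalar_op_cmult: "scalar_op (\<lambda>q. c * s q) u x = c * scalar_op s u x"
  using scalar_op_function_mult[of "\<lambda>x. c"] by simp

lemma scalar_op_function: "u \<in> SP \<Longrightarrow> scalar_op (\<lambda>q. f (fst q)) u x = f x * u x"
  using scalar_op_function_mult[of f "\<lambda>q. 1" u x] by (simp add: scalar_op_one)

lemma scalar_op_l1:
  assumes u: "u \<in> SP"
  shows "scalar_op (l1 i j) u x = delta i j * (bc 1 x * dderiv (axis 1 1) u x + bc 2 x * dderiv (axis 2 1) u x)
    + (- delta i j * cc x + Z i j x) * u x"
proof -
  have "scalar_op \<beta> u x = bc 1 x * dderiv (axis 1 1) u x + bc 2 x * dderiv (axis 2 1) u x"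
    unfolding \<beta>_def[abs_def]
    by (subst scalar_op_add_symbol[OF symbol_function_mult[OF bc_SP ik_symbol] symbol_function_mult[OF bc_SP ik_symbol] u])
      (simp add: scalar_op_function_mult scalar_op_ik[OF u])
  moreover have "scalar_op (\<lambda>q. - delta i j * cc (fst q) + Z i j (fst q)) u x = (- delta i j * cc x + Z i j x) * u x"
    by (rule scalar_op_function[OF u])
  ultimately show ?thesis
    unfolding l1_def[abs_def]
    by (subst scalar_op_add_symbol[OF delta_mult[OF \<beta>_symbol] l1_lower u]) (simp add: scalar_op_cmult)
qed

lemma scalar_op_V:
  assumes u: "u \<in> SP"
  shows "scalar_op (V i j) u x = (let kx = complex_of_real \<alpha> * dderiv (axis 1 1) u x; ky = complex_of_real \<alpha> * dderiv (axis 2 1) u x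
     in (vector [vector [0, 0, ky], vector [0, 0, - kx], vector [- ky, kx, 0]] :: complex^3^3) $ i $ j)"
proof -
  have 0: "scalar_op (\<lambda>q. 0) u x = 0" by (simp add: scalar_op_def)
  have 1: "scalar_op (\<lambda>q. complex_of_real \<alpha> * ik i q) u x = complex_of_real \<alpha> * dderiv (axis i 1) u x" for i
    by (simp add: scalar_op_cmult scalar_op_ik[OF u])
  have 2: "scalar_op (\<lambda>q. - (complex_of_real \<alpha> * ik i q)) u x = - (complex_of_real \<alpha> * dderiv (axis i 1) u x)" for i
    using scalar_op_cmult[of "- complex_of_real \<alpha>" "ik i" u x] by (simp add: scalar_op_ik[OF u])
  show ?thesis
    using exhaust_3[of i] exhaust_3[of j]
    by (elim disjE) (simp_all add: V_def[abs_def] Let_def 0 1 2)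
qed

lemma scalar_op_l0:
  assumes u: "u \<in> SP"
  shows "scalar_op (l0 i j) u x = delta i j * (dderiv (axis 1 1) (dderiv (axis 1 1) u) x + dderiv (axis 2 1) (dderiv (axis 2 1) u) x)
    + scalar_op (V i j) u x"
proof -
  have kk: "(\<lambda>q. ik i q * ik i q) \<in> S 2" for i by (rule symbol_class_mult[OF ik_symbol ik_symbol]) simp
  have "scalar_op \<kappa> u x = dderiv (axis 1 1) (dderiv (axis 1 1) u) x + dderiv (axis 2 1) (dderiv (axis 2 1) u) x"
    unfolding \<kappa>_def[abs_def]
    by (subst scalar_op_add_symbol[OF kk kk u]) (simp add: scalar_op_ik_ik[OF u])
  then show ?thesis
    unfolding l0_def[abs_def]
    by (subst scalar_op_add_symbol[OF delta_mult[OF \<kappa>_symbol] V_symbol u]) (simp add: scalar_op_cmult)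
qed

lemma dx_slice: "dx i f (x, w) = dderiv (axis i 1) (\<lambda>y. f (y, w)) x"
  by (simp add: dx_def dderiv_slice)

lemma dx_dx_slice: "dx i (dx i f) (x, w) = dderiv (axis i 1) (dderiv (axis i 1) (\<lambda>y. f (y, w))) x"
  by (simp add: dx_def dderiv_slice)

lemma op_L1_op:
  fixes G :: "(real^2) \<times> real \<Rightarrow> complex^3"
  assumes G: "G \<in> ST" and w: "w \<in> I"
  shows "op_L1 \<alpha> \<delta> \<eta> G (x, w) $ i = (\<Sum>j\<in>UNIV. scalar_op (l1 i j) (\<lambda>y. G (y, w) $ j) x)"
proof -
  have u: "(\<lambda>y. G (y, w) $ j) \<in> SP" for j by (rule SP_component[OF ST_slice[OF G w]])
  show ?thesis
    using exhaust_3[of i]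
    by (elim disjE)
      (simp_all add: op_L1_def Let_def sum_3 sum_2 scalar_op_l1[OF u] dx_slice Z_def delta_def bc_def cc_def
        scaleR_conv_of_real algebra_simps)
qed

lemma op_L0_op:
  fixes F :: "(real^2) \<times> real \<Rightarrow> complex^3"
  assumes F: "F \<in> ST" and w: "w \<in> I"
  shows "op_L0 \<alpha> F (x, w) $ i = (\<Sum>j\<in>UNIV. scalar_op (l0 i j) (\<lambda>y. F (y, w) $ j) x)"
proof -
  have u: "(\<lambda>y. F (y, w) $ j) \<in> SP" for j by (rule SP_component[OF ST_slice[OF F w]])
  show ?thesis
    using exhaust_3[of i]
    by (elim disjE)
      (simp_all add: op_L0_def Let_def sum_3 sum_2 scalar_op_l0[OF u] scalar_op_V[OF u] dx_slice dx_dx_slice delta_def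
        scaleR_conv_of_real algebra_simps)
qed

section \<open>Derivatives in \<open>w\<close> and the remainder of the factorisation\<close>

lemma dw_ST: "F \<in> ST \<Longrightarrow> dw F \<in> ST"
  unfolding dw_def by (rule ST_dderiv)

lemma has_vector_derivative_dw:
  assumes "F \<in> ST" "w \<in> I"
  shows "((\<lambda>w. F (x, w)) has_vector_derivative dw F (x, w)) (at w)"
proof -
  have "((\<lambda>w. F ((x, 0) + w *\<^sub>R (0, 1))) has_vector_derivative dderiv (0, 1) F ((x, 0) + w *\<^sub>R (0, 1))) (at w)"
    by (rule has_vector_derivative_dderiv) (use ST_diff[OF assms] in simp)
  then show ?thesis by (simp add: dw_def)
qed

text \<open>\<open>dderiv\<close> looks only along the line through \<open>(x, w)\<close>, so a
  derivative in \<open>w\<close> alone determines \<open>dw\<close>; this is what the series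
  argument supplies for operators applied fibrewise.\<close>

lemma dw_eq:
  assumes "((\<lambda>w. F (x, w)) has_vector_derivative d) (at w)"
  shows "dw F (x, w) = d"
proof -
  have "((\<lambda>w. F (x, w)) has_derivative (\<lambda>t. t *\<^sub>R d)) (at (w + 0 *\<^sub>R (1::real)))"
    using assms by (simp add: has_vector_derivative_def)
  from has_vector_derivative_line[OF this, of UNIV]
  show ?thesis by (simp add: dw_def dderiv_def vector_derivative_at)
qed

lemma dw_component:
  fixes F :: "(real^2) \<times> real \<Rightarrow> complex^3"
  assumes "F \<in> ST" "w \<in> I"
  shows "dw (\<lambda>q. F q $ j) (x, w) = dw F (x, w) $ j"
  unfolding dw_def by (rule dderiv_bounded_linear[OF bounded_linear_vec_nth ST_diff[OF assms]])

lemma dw_dw_minus: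
  fixes F :: "(real^2) \<times> real \<Rightarrow> complex^3"
  assumes A: "\<And>i j. A i j \<in> S m" and F: "F \<in> ST" and w: "w \<in> I"
  shows "dw (dw_minus (Op v1 v2 (matsym A)) F) (x, w) =
    dw (dw F) (x, w) - Op v1 v2 (matsym A) (\<lambda>y. dw F (y, w)) x"
proof (rule dw_eq)
  let ?O = "Op v1 v2 (matsym A)"
  have "((\<lambda>w. ?O (\<lambda>y. F (y, w)) x) has_vector_derivative ?O (\<lambda>y. dw F (y, w)) x) (at w)"
  proof (rule has_vector_derivative_vec)
    fix i
    have "((\<lambda>w. \<Sum>j\<in>UNIV. scalar_op (A i j) (\<lambda>y. F (y, w) $ j) x) has_vector_derivative
        (\<Sum>j\<in>UNIV. scalar_op (A i j) (\<lambda>y. dw (\<lambda>q. F q $ j) (y, w)) x)) (at w)"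
      by (intro has_vector_derivative_sum scalar_op_has_vector_derivative[OF A _ w, of "\<lambda>q. F q $ _"]
          ST_bounded_linear[OF bounded_linear_vec_nth F])
    also have "(\<Sum>j\<in>UNIV. scalar_op (A i j) (\<lambda>y. dw (\<lambda>q. F q $ j) (y, w)) x) = ?O (\<lambda>y. dw F (y, w)) x $ i"
      by (simp add: Op_matsym[OF A ST_slice[OF dw_ST[OF F] w]] dw_component[OF F w])
    finally show "((\<lambda>w. ?O (\<lambda>y. F (y, w)) x $ i) has_vector_derivative ?O (\<lambda>y. dw F (y, w)) x $ i) (at w)"
      by (rule has_vector_derivative_transform_within_open[where S = I])
        (use w in \<open>auto simp: Op_matsym[OF A ST_slice[OF F]]\<close>)
  qed
  from has_vector_derivative_diff[OF has_vector_derivative_dw[OF dw_ST[OF F] w] this]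
  show "((\<lambda>w. dw_minus ?O F (x, w)) has_vector_derivative
      dw (dw F) (x, w) - ?O (\<lambda>y. dw F (y, w)) x) (at w)"
    by (simp add: dw_minus_def fibrewise_def)
qed

text \<open>With \<open>a N = - (a M + L1)\<close> the terms in \<open>dw F\<close> cancel and
  \<open>- a N M\<close> becomes \<open>(a M + L1) M\<close>. Composition through
  \<open>sharp\<close> is exact, so this is an equality for every \<open>s\<close> of order 1;
  smoothing enters only through the choice of \<open>s\<close>.\<close>

lemma factorisation_remainder:
  fixes F :: "(real^2) \<times> real \<Rightarrow> complex^3" and s :: "3 \<Rightarrow> 3 \<Rightarrow> phase \<Rightarrow> complex"
  assumes s: "\<And>i j. s i j \<in> S 1" and F: "F \<in> ST" and w: "w \<in> I"
  defines "M \<equiv> Op v1 v2 (matsym s)"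
    and "N \<equiv> Op v1 v2 (matsym (\<lambda>i j q. - ai (fst q) * (ac (fst q) * s i j q + l1 i j q)))"
  shows "op_L \<alpha> \<delta> \<eta> F (x, w) - coeff_a \<delta> \<eta> x *\<^sub>R dw_minus N (dw_minus M F) (x, w) =
    Op v1 v2 (matsym (riccati ac l1 l0 s)) (\<lambda>y. F (y, w)) x"
proof (rule vec_eq_iff[THEN iffD2], rule allI)
  fix i
  define X where "X i j q = ac (fst q) * s i j q + l1 i j q" for i j q
  have as: "(\<lambda>q. ac (fst q) * s i j q) \<in> S 1" for i j by (intro symbol_function_mult ac_SP s)
  have X: "X i j \<in> S 1" for i j
    unfolding X_def[abs_def] by (intro symbol_class_add as l1_symbol)
  have nai: "(\<lambda>x. - ai x) \<in> SP" using SP_cmult[OF ai_SP, of "- 1"] by simp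
  have nX: "(\<lambda>q. - ai (fst q) * X i j q) \<in> S 1" for i j
    using symbol_function_mult[OF nai X] by simp
  have N: "N = Op v1 v2 (matsym (\<lambda>i j q. - ai (fst q) * X i j q))"
    by (simp add: N_def X_def[abs_def])
  define f where "f j y = F (y, w) $ j" for j y
  define g where "g j y = dw F (y, w) $ j" for j y
  have f: "f j \<in> SP" and g: "g j \<in> SP" for j
    unfolding f_def[abs_def] g_def[abs_def]
    using SP_component[OF ST_slice[OF F w]] SP_component[OF ST_slice[OF dw_ST[OF F] w]] by auto
  have M_comp: "M (\<lambda>y. F (y, w)) y $ j = (\<Sum>p\<in>UNIV. scalar_op (s j p) (f p) y)" for y j
    unfolding M_def f_def[abs_def] by (rule Op_matsym[OF s ST_slice[OF F w]])
  \<comment> \<open>The slice of \<open>dw_minus M F\<close>. It has to be smooth and periodic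
    before the symbol calculus applies to \<open>N G\<close>.\<close>
  define G where "G y = dw F (y, w) - M (\<lambda>y. F (y, w)) y" for y
  have G_comp: "(\<lambda>y. G y $ j) = (\<lambda>y. g j y - (\<Sum>p\<in>UNIV. scalar_op (s j p) (f p) y))" for j
    by (rule ext) (simp add: G_def g_def M_comp)
  have sum_SP: "(\<lambda>y. \<Sum>p\<in>UNIV. scalar_op (s j p) (f p) y) \<in> SP" for j
    unfolding sum_3 by (intro SP_add scalar_op_SP[OF s f])
  have G: "G \<in> SP"
    by (rule SP_vec) (simp only: G_comp SP_diff[OF g sum_SP])
  have fib: "fibrewise N (dw_minus M F) (x, w) = N G x"
    by (simp add: fibrewise_def dw_minus_def G_def[abs_def])
  have scalar_op_sum: "scalar_op r (\<lambda>y. \<Sum>p\<in>UNIV. scalar_op (s j p) (f p) y) x = (\<Sum>p\<in>UNIV. scalar_op (sharp r (s j p)) (f p) x)"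
    if r: "r \<in> S 1" for r j
    unfolding sum_3
    by (simp add: scalar_op_add[OF r SP_add[OF scalar_op_SP[OF s f] scalar_op_SP[OF s f]] scalar_op_SP[OF s f]]
        scalar_op_add[OF r scalar_op_SP[OF s f] scalar_op_SP[OF s f]] scalar_op_op[OF r s f])
  have N_comp: "ac x * N G x $ i = - (\<Sum>j\<in>UNIV. scalar_op (X i j) (g j) x - (\<Sum>p\<in>UNIV. scalar_op (sharp (X i j) (s j p)) (f p) x))"
  proof -
    have "N G x $ i = (\<Sum>j\<in>UNIV. scalar_op (\<lambda>q. - ai (fst q) * X i j q) (\<lambda>y. G y $ j) x)"
      unfolding N by (rule Op_matsym[OF nX G])
    also have "\<dots> = (\<Sum>j\<in>UNIV. - ai x * scalar_op (X i j) (\<lambda>y. G y $ j) x)"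
      by (rule sum.cong[OF refl]) (rule scalar_op_function_mult[of "\<lambda>x. - ai x"])
    also have "\<dots> = - ai x * (\<Sum>j\<in>UNIV. scalar_op (X i j) (g j) x - (\<Sum>p\<in>UNIV. scalar_op (sharp (X i j) (s j p)) (f p) x))"
      unfolding G_comp scalar_op_diff[OF X g sum_SP] scalar_op_sum[OF X] sum_distrib_left ..
    finally have eq: "N G x $ i = - ai x * (\<Sum>j\<in>UNIV. scalar_op (X i j) (g j) x - (\<Sum>p\<in>UNIV. scalar_op (sharp (X i j) (s j p)) (f p) x))" .
    have "ac x * (- ai x * z) = - z" for z
      using ac_ai[of x] by (simp add: mult.assoc[symmetric])
    then show ?thesis unfolding eq .
  qed
  have opX: "scalar_op (X i j) u x = ac x * scalar_op (s i j) u x + scalar_op (l1 i j) u x" if "u \<in> SP" for j u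
    unfolding X_def[abs_def]
    by (subst scalar_op_add_symbol[OF as l1_symbol that]) (simp add: scalar_op_function_mult)
  have P: "scalar_op (riccati ac l1 l0 s i p) (f p) x = scalar_op (l0 i p) (f p) x + (\<Sum>j\<in>UNIV. scalar_op (sharp (X i j) (s j p)) (f p) x)" for p
  proof -
    have sh: "sharp (X i j) (s j p) \<in> S 2" for j by (rule sharp_symbol[OF X s]) simp
    have "scalar_op (riccati ac l1 l0 s i p) (f p) x = scalar_op (\<lambda>q. l0 i p q + (\<Sum>j\<in>UNIV. sharp (X i j) (s j p) q)) (f p) x"
      unfolding riccati_def[abs_def] X_def[abs_def] ..
    also have "\<dots> = scalar_op (l0 i p) (f p) x + scalar_op (\<lambda>q. \<Sum>j\<in>UNIV. sharp (X i j) (s j p) q) (f p) x"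
      by (rule scalar_op_add_symbol[OF l0_symbol symbol_class_sum f]) (rule sh)
    also have "scalar_op (\<lambda>q. \<Sum>j\<in>UNIV. sharp (X i j) (s j p) q) (f p) x = (\<Sum>j\<in>UNIV. scalar_op (sharp (X i j) (s j p)) (f p) x)"
      by (rule scalar_op_sum_symbol[OF sh f])
    finally show ?thesis .
  qed
  have ricc: "riccati ac l1 l0 s i j \<in> S 2" for i j
    unfolding riccati_def[abs_def]
    by (intro symbol_class_add symbol_class_sum l0_symbol sharp_symbol[OF symbol_class_add[OF as l1_symbol] s]) auto
  have dwM: "dw (dw_minus M F) (x, w) $ i = dw (dw F) (x, w) $ i - (\<Sum>j\<in>UNIV. scalar_op (s i j) (g j) x)"
    unfolding M_def dw_dw_minus[OF s F w] g_def[abs_def]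
    by (simp add: Op_matsym[OF s ST_slice[OF dw_ST[OF F] w]])
  have scaleR_complex: "r *\<^sub>R z = complex_of_real r * z" for r and z :: complex
    by (rule scaleR_conv_of_real)
  have L1: "op_L1 \<alpha> \<delta> \<eta> (dw F) (x, w) $ i = (\<Sum>j\<in>UNIV. scalar_op (l1 i j) (g j) x)"
    unfolding g_def[abs_def] by (rule op_L1_op[OF dw_ST[OF F] w])
  have L0: "op_L0 \<alpha> F (x, w) $ i = (\<Sum>j\<in>UNIV. scalar_op (l0 i j) (f j) x)"
    unfolding f_def[abs_def] by (rule op_L0_op[OF F w])
  have "(op_L \<alpha> \<delta> \<eta> F (x, w) - coeff_a \<delta> \<eta> x *\<^sub>R dw_minus N (dw_minus M F) (x, w)) $ i =
      ac x * dw (dw F) (x, w) $ i + op_L1 \<alpha> \<delta> \<eta> (dw F) (x, w) $ i + op_L0 \<alpha> F (x, w) $ i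
      - ac x * (dw (dw_minus M F) (x, w) $ i - N G x $ i)"
    by (simp add: op_L_def dw_minus_def[of N] fib ac_def scaleR_complex)
  also have "\<dots> = op_L1 \<alpha> \<delta> \<eta> (dw F) (x, w) $ i + op_L0 \<alpha> F (x, w) $ i
      + (\<Sum>j\<in>UNIV. ac x * scalar_op (s i j) (g j) x) + ac x * N G x $ i"
    unfolding dwM by (simp add: algebra_simps sum_distrib_left)
  also have "\<dots> = op_L0 \<alpha> F (x, w) $ i + (\<Sum>j\<in>UNIV. \<Sum>p\<in>UNIV. scalar_op (sharp (X i j) (s j p)) (f p) x)"
    unfolding N_comp L1 by (simp add: opX[OF g] sum_subtractf sum.distrib)
  also have "\<dots> = op_L0 \<alpha> F (x, w) $ i + (\<Sum>p\<in>UNIV. \<Sum>j\<in>UNIV. scalar_op (sharp (X i j) (s j p)) (f p) x)"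
    by (subst sum.swap) (rule refl)
  also have "\<dots> = (\<Sum>p\<in>UNIV. scalar_op (riccati ac l1 l0 s i p) (f p) x)"
    unfolding L0 P sum.distrib ..
  also have "\<dots> = Op v1 v2 (matsym (riccati ac l1 l0 s)) (\<lambda>y. F (y, w)) x $ i"
    unfolding f_def[abs_def] by (rule Op_matsym[OF ricc ST_slice[OF F w], symmetric])
  finally show "(op_L \<alpha> \<delta> \<eta> F (x, w) - coeff_a \<delta> \<eta> x *\<^sub>R dw_minus N (dw_minus M F) (x, w)) $ i =
      Op v1 v2 (matsym (riccati ac l1 l0 s)) (\<lambda>y. F (y, w)) x $ i" .
qed

section \<open>Principal symbols, proper support and the conclusion\<close>

lemma matsym_delta: "matsym (\<lambda>i j q. delta i j * m q) = (\<lambda>q. mat (m q))"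
  by (rule ext) (simp add: matsym_def delta_def mat_def vec_eq_iff)

lemma principal_symbol_matsym:
  assumes A: "\<And>i j. A i j \<in> S 1" and \<mu>: "\<mu> \<in> S 1"
    and diff: "\<And>i j. (\<lambda>q. A i j q - delta i j * \<mu> q) \<in> S 0"
    and hom: "\<And>x k t. norm k \<ge> 1 \<Longrightarrow> t \<ge> 1 \<Longrightarrow> \<mu> (x, t *\<^sub>R k) = complex_of_real t * \<mu> (x, k)"
  shows "principal_symbol v1 v2 1 (Op v1 v2 (matsym A)) (\<lambda>q. mat (\<mu> q))"
  unfolding principal_symbol_def
proof (intro conjI)
  show "(\<lambda>q. mat (\<mu> q) :: complex^3^3) \<in> S 1"
    unfolding matsym_delta[symmetric] by (intro matsym_symbol delta_mult \<mu>)
  show "homogeneous_symbol 1 (\<lambda>q. mat (\<mu> q) :: complex^3^3)"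
    unfolding homogeneous_symbol_def
    by (intro exI[of _ 1]) (auto simp: hom mat_def vec_eq_iff scaleR_conv_of_real[where 'a = complex])
  show "(\<lambda>u x. Op v1 v2 (matsym A) u x - Op v1 v2 (\<lambda>q. mat (\<mu> q)) u x) \<in> Psi v1 v2 (1 - 1)"
    unfolding Psi_def
  proof (intro CollectI bexI[of _ "matsym (\<lambda>i j q. A i j q - delta i j * \<mu> q)"] ballI ext)
    show "matsym (\<lambda>i j q. A i j q - delta i j * \<mu> q) \<in> symbol_class v1 v2 (1 - 1)"
      using matsym_symbol[OF diff] by simp
    fix u :: "real^2 \<Rightarrow> complex^3" and x assume u: "u \<in> SP"
    have d\<mu>: "(\<lambda>q. delta i j * \<mu> q) \<in> S 1" for i j by (rule delta_mult[OF \<mu>])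
    have "scalar_op (A i j) v x = scalar_op (\<lambda>q. A i j q - delta i j * \<mu> q) v x + scalar_op (\<lambda>q. delta i j * \<mu> q) v x"
      if "v \<in> SP" for i j v
      using scalar_op_add_symbol[OF diff d\<mu> that, of i j i j x] by simp
    then show "Op v1 v2 (matsym A) u x - Op v1 v2 (\<lambda>q. mat (\<mu> q)) u x =
        Op v1 v2 (matsym (\<lambda>i j q. A i j q - delta i j * \<mu> q)) u x"
      unfolding matsym_delta[symmetric]
      by (simp add: vec_eq_iff Op_matsym[OF A u] Op_matsym[OF d\<mu> u] Op_matsym[OF diff u]
          SP_component[OF u] sum.distrib)
  qed
qed

text \<open>The whole plane is the periodic lift of the compact cell, so it serves as
  \<open>K'\<close>; the second clause then asks only that zero be mapped to zero.\<close>

lemma properly_supported_Op: "properly_supported v1 v2 (Op v1 v2 s)"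
proof -
  have "compact_mod v1 v2 UNIV"
  proof -
    define C where "C = (\<lambda>p. fst p *\<^sub>R v1 + snd p *\<^sub>R v2) ` cbox (0, 0) (1::real, 1::real)"
    have "compact C" unfolding C_def by (intro compact_continuous_image continuous_intros compact_cbox)
    moreover have "\<exists>y l. x = y + l \<and> y \<in> C \<and> l \<in> L" for x
    proof -
      obtain s t l where "s \<in> {0..1}" "t \<in> {0..1}" "l \<in> L" "x = s *\<^sub>R v1 + t *\<^sub>R v2 + l"
        by (rule fundamental_cell)
      then show ?thesis
        by (intro exI[of _ "s *\<^sub>R v1 + t *\<^sub>R v2"] exI[of _ l])
          (auto simp: C_def cbox_Pair_eq intro!: image_eqI[of _ _ "(s, t)"])
    qed
    ultimately show ?thesis unfolding compact_mod_def by (intro exI[of _ C]) auto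
  qed
  moreover have "Op v1 v2 s (\<lambda>x. 0) x = 0" for x
  proof -
    have "fourier_coeff v1 v2 (\<lambda>x. 0) k = 0" for k
      by (simp add: vec_eq_iff fourier_coeff_component[OF smooth_periodic_const])
    then show ?thesis by (simp add: Op_def)
  qed
  moreover have "u = (\<lambda>x. 0)" if "\<forall>x\<in>UNIV. u x = 0" for u :: "real^2 \<Rightarrow> complex^3"
    using that by auto
  ultimately show ?thesis
    unfolding properly_supported_def by (intro allI impI exI[of _ UNIV]) auto
qed

theorem factorisation_exists:
  "\<exists>M\<in>Psi v1 v2 1. \<exists>N\<in>Psi v1 v2 1.
    properly_supported v1 v2 M \<and> properly_supported v1 v2 N \<and>
    in_Psi_minf v1 v2 h
      (\<lambda>F p. op_L \<alpha> \<delta> \<eta> F p - coeff_a \<delta> \<eta> (fst p) *\<^sub>R dw_minus N (dw_minus M F) p) \<and>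
    (\<exists>m1 n1.
       principal_symbol v1 v2 1 M (\<lambda>q. mat (m1 q)) \<and>
       principal_symbol v1 v2 1 N (\<lambda>q. mat (n1 q)) \<and>
       strongly_elliptic v1 v2 m1 \<and>
       strongly_elliptic v1 v2 (\<lambda>q. - n1 q))"
proof -
  let ?\<mu> = "root_symbol 1" and ?\<nu> = "\<lambda>q. - root_symbol (- 1) q"
  define \<rho>' where "\<rho>' q = complex_of_real (disc q powr (- (1 / 2)))" for q
  have \<rho>': "\<rho>' \<in> S (- 1)" using disc_powr_symbol[of "- (1/2)"] by (simp add: \<rho>'_def[abs_def])
  have inv: "\<rho> q * \<rho>' q = 1" for q
    using disc_pos[of q] unfolding \<rho>_powr \<rho>'_def of_real_mult[symmetric] powr_add[symmetric] by simp
  have lin: "\<rho> q = 2 * ac (fst q) * ?\<mu> q + \<beta> q" for q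
    unfolding mult.assoc ac_root_symbol by (simp add: field_simps)
  have principal: "(\<lambda>q. l1 i j q - delta i j * \<beta> q) \<in> S 0" "(\<lambda>q. l0 i j q - delta i j * \<kappa> q) \<in> S 1" for i j
    using l1_lower V_symbol unfolding l1_def l0_def add_diff_cancel_left' by auto
  obtain s where wave: "(\<forall>i j. s i j \<in> S 1) \<and> (\<forall>i j. (\<lambda>q. s i j q - delta i j * ?\<mu> q) \<in> S 0) \<and>
      (\<forall>i j m. riccati ac l1 l0 s i j \<in> S m)"
    by (rule exE[OF riccati_solvable[OF ac_SP l1_symbol l0_symbol root_symbol \<rho>_symbol \<rho>' \<beta>_symbol \<kappa>_symbol
          inv principal lin eikonal]])
  have s: "s i j \<in> S 1" "(\<lambda>q. s i j q - delta i j * ?\<mu> q) \<in> S 0" "riccati ac l1 l0 s i j \<in> S m" for i j m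
    using wave by auto
  define M where "M = Op v1 v2 (matsym s)"
  define n where "n i j q = - ai (fst q) * (ac (fst q) * s i j q + l1 i j q)" for i j q
  define N where "N = Op v1 v2 (matsym n)"
  have nai: "(\<lambda>x. - ai x) \<in> SP" using SP_cmult[OF ai_SP, of "- 1"] by simp
  have n: "n i j \<in> S 1" for i j
    unfolding n_def[abs_def]
    by (intro symbol_function_mult[OF nai] symbol_class_add symbol_function_mult[OF ac_SP] s(1) l1_symbol)
  have n': "(\<lambda>q. n i j q - delta i j * ?\<nu> q) \<in> S 0" for i j
  proof -
    \<comment> \<open>Vieta's relation: the two roots sum to \<open>- \<beta> / a\<close>, so the
      choice of \<open>N\<close> automatically has the other root as its principal symbol.\<close>
    have root: "root_symbol (- 1) q = ai (fst q) * (ac (fst q) * ?\<mu> q + \<beta> q)" for q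
      unfolding ac_root_symbol unfolding root_symbol_def by (simp add: field_simps)
    have "(\<lambda>q. - ai (fst q) * (ac (fst q) * (s i j q - delta i j * ?\<mu> q) + (- delta i j * cc (fst q) + Z i j (fst q)))) \<in> S 0"
      by (intro symbol_function_mult[OF nai] symbol_class_add symbol_function_mult[OF ac_SP] s(2) l1_lower)
    then show ?thesis unfolding n_def l1_def root by (simp add: algebra_simps)
  qed
  have Psi: "Op v1 v2 a \<in> Psi v1 v2 m" if "a \<in> symbol_class v1 v2 m" for a m
    using that unfolding Psi_def by blast
  have "in_Psi_minf v1 v2 h
      (\<lambda>F p. op_L \<alpha> \<delta> \<eta> F p - coeff_a \<delta> \<eta> (fst p) *\<^sub>R dw_minus N (dw_minus M F) p)"
    unfolding in_Psi_minf_def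
  proof (intro bexI[of _ "Op v1 v2 (matsym (riccati ac l1 l0 s))"] ballI)
    show "Op v1 v2 (matsym (riccati ac l1 l0 s)) \<in> Psi_minf v1 v2"
      unfolding Psi_minf_def by (intro INT_I Psi matsym_symbol s(3))
    fix F :: "(real^2) \<times> real \<Rightarrow> complex^3" and p
    assume F: "F \<in> ST" and p: "p \<in> (UNIV :: (real^2) set) \<times> I"
    then obtain x w where "p = (x, w)" "w \<in> I" by auto
    then show "op_L \<alpha> \<delta> \<eta> F p - coeff_a \<delta> \<eta> (fst p) *\<^sub>R dw_minus N (dw_minus M F) p =
        fibrewise (Op v1 v2 (matsym (riccati ac l1 l0 s))) F p"
      using factorisation_remainder[OF s(1) F] by (simp add: fibrewise_def M_def N_def n_def[abs_def])
  qed
  moreover have "principal_symbol v1 v2 1 M (\<lambda>q. mat (?\<mu> q))"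
    unfolding M_def by (rule principal_symbol_matsym[OF s(1) root_symbol s(2) root_symbol_homogeneous])
  moreover have "principal_symbol v1 v2 1 N (\<lambda>q. mat (?\<nu> q))"
    unfolding N_def
    by (rule principal_symbol_matsym[OF n symbol_class_uminus[OF root_symbol] n']) (simp add: root_symbol_homogeneous)
  moreover have "strongly_elliptic v1 v2 ?\<mu>" "strongly_elliptic v1 v2 (\<lambda>q. - ?\<nu> q)"
    using root_symbol_elliptic by auto
  moreover have "M \<in> Psi v1 v2 1" "N \<in> Psi v1 v2 1"
    unfolding M_def N_def by (intro Psi matsym_symbol s(1) n)+
  moreover have "properly_supported v1 v2 M" "properly_supported v1 v2 N"
    unfolding M_def N_def by (rule properly_supported_Op)+
  ultimately show ?thesis
    by (intro bexI[of _ M] bexI[of _ N] conjI exI[of _ ?\<mu>] exI[of _ ?\<nu>])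
qed

end

theorem lemma1p9:
  fixes v1 v2 :: "real^2" and h \<alpha> \<delta> :: real and \<eta> :: "real^2 \<Rightarrow> real"
  assumes "v1 \<noteq> v2" and "independent {v1, v2}"
    and "h > 0"
    and "\<forall>k\<in>dual_lattice v1 v2. norm k \<noteq> \<bar>\<alpha>\<bar> \<and>
           (norm k < \<bar>\<alpha>\<bar> \<longrightarrow>
              h * sqrt (\<alpha>\<^sup>2 - (norm k)\<^sup>2) \<notin> {pi / 2 * real n | n :: nat. True})"
    and "\<eta> \<in> smooth_periodic v1 v2"
    and "\<forall>x. \<eta> x > - h"
    and "\<delta> > 0"
    and "{(x, z). \<eta> x - \<delta> * h \<le> z \<and> z < \<eta> x} \<subseteq> {(x, z). - h < z \<and> z < \<eta> x}"
  shows "\<exists>M\<in>Psi v1 v2 1. \<exists>N\<in>Psi v1 v2 1.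
    properly_supported v1 v2 M \<and> properly_supported v1 v2 N \<and>
    in_Psi_minf v1 v2 h
      (\<lambda>F p. op_L \<alpha> \<delta> \<eta> F p - coeff_a \<delta> \<eta> (fst p) *\<^sub>R dw_minus N (dw_minus M F) p) \<and>
    (\<exists>m1 n1.
       principal_symbol v1 v2 1 M (\<lambda>q. mat (m1 q)) \<and>
       principal_symbol v1 v2 1 N (\<lambda>q. mat (n1 q)) \<and>
       strongly_elliptic v1 v2 m1 \<and>
       strongly_elliptic v1 v2 (\<lambda>q. - n1 q))"
proof -
  interpret factorisation v1 v2 h \<alpha> \<delta> \<eta>
    by unfold_locales (use assms in auto)
  show ?thesis by (rule factorisation_exists)
qed

end
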